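(* Let $d\ge5$, set $s_0=\frac{d+2}3$. For every $s$ with $s_0<s<\infty$ there is a constant $C_{d,s}$ such that, for every complex-valued $V\in\ell^s(\mathbb Z^d)$, if $z\in\mathbb C\setminus[0,4d]$ is an eigenvalue of $H_0+V$, then $$\operatorname{dist}(z,[0,4d])^{s-s_0}\le C_{d,s}\|V\|_{\ell^s}^{\,s}.$$ At the endpoint $s=s_0$, there is a constant $c_d>0$ such that, for $V\in\ell^{s_0}(\mathbb Z^d)$, the condition $\|V\|_{\ell^{s_0}}<c_d$ excludes all eigenvalues of $H_0+V$ in $\mathbb C\setminus[0,4d]$.
   Context: The discrete Laplacian $H_0$ on $\ell^2(\mathbb Z^d)$ is the Fourier multiplier (with $\widehat f(\xi)=\sum_{n}f(n)e^{-2\pi i n\cdot\xi}$ on $\mathbb T^d=(-1/2,1/2]^d$) with symbol $h_0(\xi)=4\sum_{j=1}^d\sin^2(\pi\xi_j)$; its spectrum is $[0,4d]$. $V$ acts on $\ell^2(\mathbb Z^d)$ by multiplication, and eigenvalues are those of the bounded operator $H_0+V$ on $\ell^2(\mathbb Z^d)$. *)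

theory Defs
  imports "HOL-Analysis.Analysis"
begin

text \<open>Functions on \<open>\<int>\<^sup>d\<close> have type \<^typ>\<open>(int, 'd::finite) vec \<Rightarrow> complex\<close>, with \<open>d = CARD('d)\<close>.\<close>

definition ell :: "real \<Rightarrow> (int ^ 'd \<Rightarrow> complex) set" where
  "ell s = {f. (\<lambda>n. norm (f n) powr s) summable_on UNIV}"

definition ell_norm :: "real \<Rightarrow> (int ^ 'd \<Rightarrow> complex) \<Rightarrow> real" where
  "ell_norm s f = (\<Sum>\<^sub>\<infinity>n. norm (f n) powr s) powr (1 / s)"

definition torus :: "(real ^ 'd) set" where
  "torus = {\<xi>. \<forall>j. -1/2 < \<xi> $ j \<and> \<xi> $ j \<le> 1/2}"

definition character :: "int ^ 'd::finite \<Rightarrow> real ^ 'd \<Rightarrow> complex" where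
  "character n \<xi> = exp (2 * pi * \<i> * complex_of_real (\<Sum>j\<in>UNIV. real_of_int (n $ j) * \<xi> $ j))"

definition L2_torus :: "(real ^ 'd::finite \<Rightarrow> complex) set" where
  "L2_torus = {F \<in> borel_measurable lborel. set_integrable lborel torus (\<lambda>\<xi>. (norm (F \<xi>))\<^sup>2)}"

text \<open>
  For \<open>f\<close> in \<open>\<ell>\<^sup>2\<close> the series \<open>\<Sum>n. f n * exp (- 2 \<pi> i n \<bullet> \<xi>)\<close> need not converge pointwise absolutely;
  as usual, its sum is taken in \<open>L\<^sup>2\<close> of the torus. The limit exists by Riesz-Fischer and is unique
  up to a null set, and only its values up to a null set matter below.
\<close>

definition is_fourier_transform :: "(int ^ 'd::finite \<Rightarrow> complex) \<Rightarrow> (real ^ 'd \<Rightarrow> complex) \<Rightarrow> bool" where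
  "is_fourier_transform f F \<longleftrightarrow> F \<in> L2_torus \<and>
     ((\<lambda>A. LINT \<xi>:torus|lborel. (norm (F \<xi> - (\<Sum>n\<in>A. f n * character (- n) \<xi>)))\<^sup>2) \<longlongrightarrow> 0)
       (finite_subsets_at_top UNIV)"

definition fourier :: "(int ^ 'd::finite \<Rightarrow> complex) \<Rightarrow> real ^ 'd \<Rightarrow> complex" where
  "fourier f = (SOME F. is_fourier_transform f F)"

definition inverse_fourier :: "(real ^ 'd::finite \<Rightarrow> complex) \<Rightarrow> int ^ 'd \<Rightarrow> complex" where
  "inverse_fourier F n = (LINT \<xi>:torus|lborel. F \<xi> * character n \<xi>)"

definition fourier_multiplier ::
    "(real ^ 'd::finite \<Rightarrow> complex) \<Rightarrow> (int ^ 'd \<Rightarrow> complex) \<Rightarrow> int ^ 'd \<Rightarrow> complex" where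
  "fourier_multiplier m f = inverse_fourier (\<lambda>\<xi>. m \<xi> * fourier f \<xi>)"

definition laplacian_symbol :: "real ^ 'd::finite \<Rightarrow> real" where
  "laplacian_symbol \<xi> = 4 * (\<Sum>j\<in>UNIV. (sin (pi * \<xi> $ j))\<^sup>2)"

definition discrete_laplacian :: "(int ^ 'd::finite \<Rightarrow> complex) \<Rightarrow> int ^ 'd \<Rightarrow> complex" where
  "discrete_laplacian = fourier_multiplier (\<lambda>\<xi>. complex_of_real (laplacian_symbol \<xi>))"

definition schroedinger ::
    "(int ^ 'd::finite \<Rightarrow> complex) \<Rightarrow> (int ^ 'd \<Rightarrow> complex) \<Rightarrow> int ^ 'd \<Rightarrow> complex" where
  "schroedinger V f n = discrete_laplacian f n + V n * f n"

definition eigenvalue_on_ell2 ::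
    "((int ^ 'd \<Rightarrow> complex) \<Rightarrow> int ^ 'd \<Rightarrow> complex) \<Rightarrow> complex \<Rightarrow> bool" where
  "eigenvalue_on_ell2 T z \<longleftrightarrow> (\<exists>f \<in> ell 2. f \<noteq> (\<lambda>n. 0) \<and> T f = (\<lambda>n. z * f n))"

text \<open>The interval \<open>[0, 4 d]\<close>, as a subset of the complex plane.\<close>

definition spectral_interval :: "'d::finite itself \<Rightarrow> complex set" where
  "spectral_interval _ = complex_of_real ` {0..4 * real CARD('d)}"

end

theory Submission
  imports Defs "HOL-Complex_Analysis.Conformal_Mappings"
begin

text \<open>
  Let \<open>h\<close> be the symbol of \<open>H\<^sub>0\<close>, let \<open>\<delta>\<close> be the distance of \<open>z\<close> from the spectrum, and let \<open>v = |V|\<^sup>1\<^sup>/\<^sup>2\<close>.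
  If \<open>(H\<^sub>0 + V) f = z f\<close>, then \<open>x = v f\<close> is reproduced, up to the phase of \<open>V\<close>, by
  \<open>v (H\<^sub>0 - z)\<^sup>-\<^sup>1 v\<close>, so this operator has norm at least one (\<open>birman_schwinger_principle\<close>).
  Both parts of the theorem therefore follow from the single estimate
  \<open>\<parallel>v (H\<^sub>0 - z)\<^sup>-\<^sup>1 v\<parallel> \<le> C \<parallel>V\<parallel>\<^sub>s \<delta> powr - (1 - s\<^sub>0 / s)\<close> for \<open>s \<ge> s\<^sub>0\<close>
  (\<open>birman_schwinger_form_bound\<close>).

  The estimate is a complex interpolation (\<open>interpolated_form_bound\<close>). Rotate the symbol by a unit
  \<open>\<kappa>\<close> such that \<open>l = \<kappa> (h - z)\<close> has real part at least \<open>\<delta> / 2\<close>, and consider the powers \<open>l powr - w\<close>.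
  For \<open>Re w = 1 - s\<^sub>0 / s\<close> such a power is a bounded multiplier, so the \<open>\<ell>\<^sup>2\<close> norm is under control. For
  \<open>Re w = 1 - s\<^sub>0 / s + s\<^sub>0\<close> its convolution kernel is bounded, and against weights in \<open>\<ell>\<^sup>2\<close> a bounded kernel
  is Hilbert-Schmidt. The exponent \<open>w = 1\<close> lies in between, at the point where the weights have
  become \<open>|V|\<^sup>1\<^sup>/\<^sup>2\<close>.

  Bounding the kernel uses \<open>\<Gamma>(w) l powr - w = \<integral> t powr (w - 1) exp (- t l) dt\<close>
  (\<open>gamma_integral_rotated\<close>), which reduces the matter to an integral over \<open>t > 0\<close> of
  \<open>t powr (s\<^sub>0 - 1)\<close> times the kernel of \<open>exp (- t l)\<close>. That kernel is a product of one-dimensional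
  kernels. If \<open>|Im z| \<ge> \<delta> / 2\<close>, then \<open>\<kappa> = \<plusminus>i\<close> and the factors are Bessel functions
  \<open>J\<^sub>n(2 t)\<close>; otherwise \<open>\<kappa> = \<plusminus>1\<close> and they are heat kernels, which decay like \<open>t\<^sup>-\<^sup>1\<^sup>/\<^sup>2\<close>
  (\<open>rotated_resolvent_kernel\<close>).

  The number \<open>s\<^sub>0 = (d + 2) / 3\<close> comes from the turning point of the Bessel function
  (\<open>bessel_power_time_integral\<close>): \<open>|J\<^sub>n(\<tau>)|\<close> has size \<open>n\<^sup>-\<^sup>1\<^sup>/\<^sup>3\<close> on a window of width \<open>n\<^sup>1\<^sup>/\<^sup>3\<close> around \<open>\<tau> = n\<close>,
  which contributes \<open>n powr (s\<^sub>0 - 1 - d / 3 + 1 / 3) = 1\<close> to \<open>\<integral> \<tau> powr (s\<^sub>0 - 1) |J\<^sub>n(\<tau>)|\<^sup>d d\<tau>\<close>. Away from the window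
  \<open>|J\<^sub>n|\<close> falls off like the power \<open>- 1 / 4\<close> of the distance and for large times like \<open>\<tau>\<^sup>-\<^sup>1\<^sup>/\<^sup>2\<close>; both tails
  are integrable exactly when \<open>d > 4\<close>. The decay of \<open>J\<^sub>n\<close> is van der Corput's lemma.
\<close>

section \<open>Fourier analysis on the torus\<close>

lemma torus_measurable [measurable]: "torus \<in> sets borel"
proof -
  have "torus = (\<Inter>j. {\<xi> :: real ^ 'd. -1/2 < \<xi> $ j} \<inter> {\<xi>. \<xi> $ j \<le> 1/2})"
    by (auto simp: torus_def)
  also have "\<dots> \<in> sets borel"
    by (intro sets.countable_INT'' sets.Int borel_open borel_closed open_Collect_less closed_Collect_le
        continuous_intros) auto
  finally show ?thesis .
qed

abbreviation torus_measure :: "(real ^ 'd::finite) measure" where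
  "torus_measure \<equiv> restrict_space lborel torus"

abbreviation circle_measure :: "real measure" where
  "circle_measure \<equiv> restrict_space lborel {-1/2<..1/2}"

lemma emeasure_circle: "emeasure circle_measure (space circle_measure) = 1"
  by (simp add: emeasure_restrict_space space_restrict_space)

interpretation circle: finite_measure circle_measure
  by standard (simp only: emeasure_circle, simp)

lemma Basis_vec_eq: "(Basis :: (real ^ 'd) set) = (\<lambda>j. axis j 1) ` UNIV"
  by (auto simp: Basis_vec_def)

lemma inj_axis_one: "inj (\<lambda>j. axis j (1::real) :: real ^ 'd)"
  by (auto simp: inj_def axis_eq_axis)

text \<open>
  The torus carries a product measure. This is what splits the \<open>d\<close>-dimensional kernels below into
  one-dimensional ones.
\<close>
lemma torus_product:
  fixes g :: "'d::finite \<Rightarrow> real \<Rightarrow> complex"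
  assumes g: "\<And>j. integrable circle_measure (g j)"
  shows "integrable torus_measure (\<lambda>\<xi>. \<Prod>j\<in>UNIV. g j (\<xi> $ j))" (is ?int)
    and "(LINT \<xi>|torus_measure. (\<Prod>j\<in>UNIV. g j (\<xi> $ j))) = (\<Prod>j\<in>UNIV. (LINT x|circle_measure. g j x))" (is ?eq)
proof -
  interpret product_sigma_finite "\<lambda>_ :: real ^ 'd. lborel :: real measure" ..
  define u :: "real ^ 'd \<Rightarrow> 'd" where "u = inv (\<lambda>j. axis j 1)"
  have u: "u (axis j 1) = j" for j
    unfolding u_def by (rule inv_f_f[OF inj_axis_one])
  define G where "G = (\<lambda>b x. indicator {-1/2<..1/2} x *\<^sub>R g (u b) x)"
  have G: "integrable lborel (G b)" for b
    using g[of "u b"] by (simp add: G_def integrable_restrict_space)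
  have Gm [measurable]: "G b \<in> borel_measurable borel" for b
    using borel_measurable_integrable[OF G[of b]] by simp
  have ind: "indicator torus \<xi> *\<^sub>R (\<Prod>j\<in>UNIV. g j (\<xi> $ j)) = (\<Prod>b\<in>Basis. G b (\<xi> \<bullet> b))" for \<xi> :: "real ^ 'd"
  proof -
    have "(\<Prod>b\<in>Basis. G b (\<xi> \<bullet> b)) = (\<Prod>j\<in>UNIV. G (axis j 1) (\<xi> \<bullet> axis j 1))"
      unfolding Basis_vec_eq by (subst prod.reindex[OF inj_axis_one]) simp
    also have "\<dots> = (\<Prod>j\<in>UNIV. indicator {-1/2<..1/2} (\<xi> $ j) *\<^sub>R g j (\<xi> $ j))"
      by (simp add: G_def u inner_axis)
    also have "\<dots> = indicator torus \<xi> *\<^sub>R (\<Prod>j\<in>UNIV. g j (\<xi> $ j))"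
    proof (cases "\<xi> \<in> torus")
      case False
      then obtain j where "\<not> (-1/2 < \<xi> $ j \<and> \<xi> $ j \<le> 1/2)" by (auto simp: torus_def)
      hence "(\<Prod>j\<in>UNIV. indicator {-1/2<..1/2} (\<xi> $ j) *\<^sub>R g j (\<xi> $ j)) = 0"
        by (intro prod_zero) (auto intro!: exI[of _ j] simp: indicator_def)
      with False show ?thesis by simp
    qed (auto simp: torus_def)
    finally show ?thesis by simp
  qed
  have T: "(\<lambda>f. \<Sum>b\<in>Basis. f b *\<^sub>R b) \<in> measurable (\<Pi>\<^sub>M b\<in>(Basis :: (real ^ 'd) set). lborel) borel"
    by measurable
  have M: "(\<lambda>\<xi> :: real ^ 'd. \<Prod>b\<in>Basis. G b (\<xi> \<bullet> b)) \<in> borel_measurable borel"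
    by measurable
  have comp: "(\<lambda>f. \<Prod>b\<in>Basis. G b ((\<Sum>b\<in>Basis. f b *\<^sub>R b) \<bullet> b)) = (\<lambda>f. \<Prod>b\<in>(Basis :: (real ^ 'd) set). G b (f b))"
    by (auto intro!: prod.cong simp: fun_eq_iff)
  have "integrable (\<Pi>\<^sub>M b\<in>(Basis :: (real ^ 'd) set). lborel) (\<lambda>f. \<Prod>b\<in>Basis. G b (f b))"
    by (intro product_integrable_prod G) auto
  hence "integrable lborel (\<lambda>\<xi> :: real ^ 'd. \<Prod>b\<in>Basis. G b (\<xi> \<bullet> b))"
    by (subst lborel_eq, subst integrable_distr_eq[OF T M]) (simp only: comp)
  thus ?int by (simp add: integrable_restrict_space ind)
  have "(LINT \<xi>|torus_measure. (\<Prod>j\<in>UNIV. g j (\<xi> $ j))) = (LINT \<xi>|lborel. (\<Prod>b\<in>Basis. G b (\<xi> \<bullet> b)))"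
    by (simp add: integral_restrict_space ind)
  also have "\<dots> = (LINT f|(\<Pi>\<^sub>M b\<in>(Basis :: (real ^ 'd) set). lborel). (\<Prod>b\<in>Basis. G b (f b)))"
    by (subst lborel_eq, subst integral_distr[OF T M]) (simp only: comp)
  also have "\<dots> = (\<Prod>b\<in>(Basis :: (real ^ 'd) set). integral\<^sup>L lborel (G b))"
    by (intro product_integral_prod G) auto
  also have "\<dots> = (\<Prod>j\<in>UNIV. integral\<^sup>L lborel (G (axis j 1 :: real ^ 'd)))"
    unfolding Basis_vec_eq by (subst prod.reindex[OF inj_axis_one]) simp
  also have "\<dots> = (\<Prod>j\<in>UNIV. (LINT x|circle_measure. g j x))"
    by (simp add: G_def u integral_restrict_space)
  finally show ?eq .
qed

lemma character_product: "character n \<xi> = (\<Prod>j\<in>UNIV. exp (2 * pi * \<i> * of_int (n $ j) * of_real (\<xi> $ j)))"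
  by (simp add: character_def exp_sum[symmetric] sum_distrib_left mult_ac)

lemma character_add: "character (m + n) \<xi> = character m \<xi> * character n \<xi>"
  by (simp add: character_def exp_add[symmetric] sum.distrib algebra_simps)

lemma character_zero [simp]: "character 0 \<xi> = 1"
  by (simp add: character_def)

lemma norm_character [simp]: "norm (character n \<xi>) = 1"
  by (simp add: character_def)

lemma cnj_character: "cnj (character n \<xi>) = character (- n) \<xi>"
  by (simp add: character_def exp_cnj sum_negf)

lemma continuous_on_character [continuous_intros]:
  "continuous_on A f \<Longrightarrow> continuous_on A (\<lambda>x. character n (f x))"
  unfolding character_def by (intro continuous_intros) auto

lemma character_measurable [measurable]: "character n \<in> borel_measurable borel"
  by (intro borel_measurable_continuous_onI continuous_intros)

lemma circle_continuous_integrable: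
  fixes g :: "real \<Rightarrow> complex"
  assumes g: "continuous_on UNIV g"
  shows "integrable circle_measure g" and "(LINT x|circle_measure. g x) = integral {-1/2..1/2} g"
proof -
  have gI: "continuous_on {-1/2..1/2} g" using g continuous_on_subset by blast
  have "set_integrable lborel {-1/2..1/2} g"
    by (rule borel_integrable_atLeastAtMost') (rule gI)
  hence s: "set_integrable lborel {-1/2<..1/2} g"
    by (rule set_integrable_subset) auto
  thus "integrable circle_measure g"
    by (simp add: set_integrable_def integrable_restrict_space)
  have "(LINT x|circle_measure. g x) = (LINT x:{-1/2<..1/2}|lborel. g x)"
    by (simp add: set_lebesgue_integral_def integral_restrict_space)
  also have "\<dots> = integral {-1/2<..1/2} g"
    by (rule set_borel_integral_eq_integral(2)[OF s])
  also have "\<dots> = integral {-1/2..1/2} g"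
    by (rule integral_spike_set) (auto intro: negligible_subset[of "{-1/2}"])
  finally show "(LINT x|circle_measure. g x) = integral {-1/2..1/2} g" .
qed

lemma circle_exp_integral:
  "(LINT x|circle_measure. exp (2 * pi * \<i> * of_int k * of_real x)) = (if k = 0 then 1 else 0)"
proof -
  have c: "continuous_on UNIV (\<lambda>x. exp (2 * pi * \<i> * of_int k * complex_of_real x))"
    by (intro continuous_intros)
  show ?thesis
  proof (cases "k = 0")
    case True
    thus ?thesis by (subst circle_continuous_integrable(2)[OF c]) simp
  next
    case False
    define c where "c = 2 * complex_of_real pi * \<i> * of_int k"
    have c0: "c \<noteq> 0" using False by (simp add: c_def)
    have "((\<lambda>x. exp (c * complex_of_real x)) has_integral
        (exp (c * of_real (1/2)) / c - exp (c * of_real (-1/2)) / c)) {-1/2..1/2}"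
    proof (rule fundamental_theorem_of_calculus)
      fix x :: real
      have "((\<lambda>z. exp (c * z) / c) has_field_derivative exp (c * of_real x)) (at (of_real x))"
        using c0 by (auto intro!: derivative_eq_intros)
      from has_vector_derivative_real_field[OF this]
      show "((\<lambda>x. exp (c * complex_of_real x) / c) has_vector_derivative exp (c * of_real x)) (at x within {-1/2..1/2})"
        by (rule has_vector_derivative_at_within)
    qed simp
    moreover have "exp (c * of_real (1/2)) = exp (c * of_real (-1/2))"
    proof -
      have "exp (c * of_real (1/2)) = exp (c * of_real (-1/2) + c)" by (simp add: field_simps)
      also have "\<dots> = exp (c * of_real (-1/2)) * exp c" by (rule exp_add)
      also have "exp c = 1"
        using exp_integer_2pi[of "of_int k"] by (simp add: c_def mult_ac)
      finally show ?thesis by simp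
    qed
    ultimately have "integral {-1/2..1/2} (\<lambda>x. exp (c * complex_of_real x)) = 0"
      by (simp add: integral_unique)
    thus ?thesis using False
      by (subst circle_continuous_integrable(2)[OF c]) (simp add: c_def)
  qed
qed

lemma torus_continuous_integrable:
  fixes g :: "real ^ 'd::finite \<Rightarrow> complex"
  assumes g: "continuous_on UNIV g" and b: "\<And>\<xi>. norm (g \<xi>) \<le> B"
  shows "integrable torus_measure g"
proof -
  have "integrable torus_measure (\<lambda>\<xi> :: real ^ 'd. \<Prod>j\<in>(UNIV :: 'd set). (1 :: complex))"
    by (rule torus_product(1)) (rule circle.integrable_const)
  hence "integrable torus_measure (\<lambda>\<xi> :: real ^ 'd. B *\<^sub>R (1 :: complex))" by simp
  moreover have "g \<in> borel_measurable torus_measure"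
    by (intro measurable_restrict_space1) (use g borel_measurable_continuous_onI in auto)
  ultimately show ?thesis
    by (rule Bochner_Integration.integrable_bound) (auto intro!: AE_I2 intro: order_trans[OF b])
qed

lemma character_integrable [simp]: "integrable torus_measure (character n)"
  by (rule torus_continuous_integrable[of _ 1]) (auto intro!: continuous_intros)

lemma character_integral: "(LINT \<xi>|torus_measure. character n \<xi>) = (if n = 0 then 1 else 0)"
proof -
  have "(LINT \<xi>|torus_measure. character n \<xi>) =
      (\<Prod>j\<in>UNIV. (LINT x|circle_measure. exp (2 * pi * \<i> * of_int (n $ j) * of_real x)))"
    unfolding character_product
    by (intro torus_product(2) circle_continuous_integrable(1) continuous_intros)
  also have "\<dots> = (if n = 0 then 1 else 0)"
  proof (cases "n = 0")
    case False
    then obtain j where "n $ j \<noteq> 0" by (auto simp: vec_eq_iff)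
    thus ?thesis using False unfolding circle_exp_integral
      by (auto intro!: prod_zero)
  qed (unfold circle_exp_integral, simp)
  finally show ?thesis .
qed

lemma emeasure_torus: "emeasure torus_measure (space (torus_measure :: (real ^ 'd::finite) measure)) = 1"
proof -
  let ?T = "torus_measure :: (real ^ 'd) measure"
  have "integrable ?T (\<lambda>_. 1 :: real)"
    using integrable_norm[OF character_integrable[of 0]] by simp
  hence "emeasure ?T (space ?T) < \<infinity>"
    by (simp add: integrable_iff_bounded)
  hence fin: "emeasure ?T (space ?T) \<noteq> top" by auto
  have "(LINT \<xi>|?T. (1::complex)) = 1"
    using character_integral[of 0] by simp
  hence "complex_of_real (measure ?T (space ?T)) = 1"
    by (simp add: scaleR_conv_of_real)
  hence "measure ?T (space ?T) = 1"
    by (simp only: of_real_eq_1_iff)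
  with fin show ?thesis
    by (metis emeasure_eq_ennreal_measure ennreal_1)
qed

interpretation torus: finite_measure torus_measure
  by standard (simp only: emeasure_torus, simp)

definition trig_sum :: "(int ^ 'd::finite) set \<Rightarrow> (int ^ 'd \<Rightarrow> complex) \<Rightarrow> real ^ 'd \<Rightarrow> complex" where
  "trig_sum A c \<xi> = (\<Sum>n\<in>A. c n * character n \<xi>)"

abbreviation l2_norm :: "('a \<Rightarrow> complex) \<Rightarrow> 'a set \<Rightarrow> real" where
  "l2_norm c A \<equiv> L2_set (\<lambda>n. norm (c n)) A"

abbreviation L2_dist_sq :: "(real ^ 'd::finite \<Rightarrow> complex) \<Rightarrow> (real ^ 'd \<Rightarrow> complex) \<Rightarrow> real" where
  "L2_dist_sq F G \<equiv> LINT \<xi>|torus_measure. (norm (F \<xi> - G \<xi>))\<^sup>2"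

lemma continuous_on_trig_sum [continuous_intros]: "continuous_on S (trig_sum A c)"
  unfolding trig_sum_def by (intro continuous_intros)

lemma trig_sum_measurable [measurable]: "trig_sum A c \<in> borel_measurable borel"
  by (intro borel_measurable_continuous_onI continuous_intros)

lemma norm_trig_sum_le: "norm (trig_sum A c \<xi>) \<le> (\<Sum>n\<in>A. norm (c n))"
  unfolding trig_sum_def by (rule order_trans[OF norm_sum]) (simp add: norm_mult)

lemma torus_measurableI [measurable (raw)]:
  "f \<in> borel_measurable borel \<Longrightarrow> f \<in> borel_measurable torus_measure"
  by (rule measurable_restrict_space1) simp

lemma parseval_trig_sum:
  assumes "finite A"
  shows "(LINT \<xi>|torus_measure. (norm (trig_sum A c \<xi>))\<^sup>2) = (\<Sum>n\<in>A. (norm (c n))\<^sup>2)"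
    and "integrable torus_measure (\<lambda>\<xi>. (norm (trig_sum A c \<xi>))\<^sup>2)"
proof -
  have eq: "complex_of_real ((norm (trig_sum A c \<xi>))\<^sup>2) = (\<Sum>m\<in>A. \<Sum>n\<in>A. (c m * cnj (c n)) * character (m - n) \<xi>)" for \<xi>
  proof -
    have "complex_of_real ((norm (trig_sum A c \<xi>))\<^sup>2) = trig_sum A c \<xi> * cnj (trig_sum A c \<xi>)"
      by (rule complex_norm_square)
    also have "\<dots> = (\<Sum>m\<in>A. \<Sum>n\<in>A. (c m * character m \<xi>) * (cnj (c n) * character (- n) \<xi>))"
      by (simp add: trig_sum_def sum_product cnj_character)
    also have "\<dots> = (\<Sum>m\<in>A. \<Sum>n\<in>A. (c m * cnj (c n)) * character (m - n) \<xi>)"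
      using character_add[of _ "- _" \<xi>] by (simp add: mult_ac)
    finally show ?thesis .
  qed
  show "integrable torus_measure (\<lambda>\<xi>. (norm (trig_sum A c \<xi>))\<^sup>2)"
  proof (rule torus.integrable_const_bound)
    show "AE \<xi> in torus_measure. norm ((norm (trig_sum A c \<xi>))\<^sup>2) \<le> (\<Sum>n\<in>A. norm (c n))\<^sup>2"
      by (auto intro!: AE_I2 power_mono norm_trig_sum_le)
  qed measurable
  have "complex_of_real (LINT \<xi>|torus_measure. (norm (trig_sum A c \<xi>))\<^sup>2)
     = (LINT \<xi>|torus_measure. (\<Sum>m\<in>A. \<Sum>n\<in>A. (c m * cnj (c n)) * character (m - n) \<xi>))"
    unfolding eq[symmetric] by (rule integral_complex_of_real[symmetric])
  also have "\<dots> = (\<Sum>m\<in>A. \<Sum>n\<in>A. (c m * cnj (c n)) * (if m = n then 1 else 0))"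
    by (simp add: Bochner_Integration.integral_sum character_integral)
  also have "\<dots> = (\<Sum>m\<in>A. c m * cnj (c m))"
    using assms by (simp add: if_distrib sum.If_cases cong: if_cong)
  also have "\<dots> = complex_of_real (\<Sum>n\<in>A. (norm (c n))\<^sup>2)"
    by (simp add: complex_norm_square[symmetric])
  finally show "(LINT \<xi>|torus_measure. (norm (trig_sum A c \<xi>))\<^sup>2) = (\<Sum>n\<in>A. (norm (c n))\<^sup>2)"
    by (simp only: of_real_eq_iff)
qed

lemma cauchy_schwarz_integral:
  fixes f g :: "'a \<Rightarrow> real"
  assumes [measurable]: "f \<in> borel_measurable M" "g \<in> borel_measurable M"
    and f: "integrable M (\<lambda>x. (f x)\<^sup>2)" and g: "integrable M (\<lambda>x. (g x)\<^sup>2)"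
  shows "integrable M (\<lambda>x. f x * g x)"
    and "(LINT x|M. f x * g x) \<le> sqrt (LINT x|M. (f x)\<^sup>2) * sqrt (LINT x|M. (g x)\<^sup>2)"
proof -
  have bd: "\<bar>f x * g x\<bar> \<le> ((f x)\<^sup>2 + (g x)\<^sup>2)" for x
  proof -
    have "0 \<le> \<bar>f x\<bar> * \<bar>g x\<bar>" by simp
    moreover have "2 * \<bar>f x\<bar> * \<bar>g x\<bar> \<le> (f x)\<^sup>2 + (g x)\<^sup>2"
      using sum_squares_bound[of "\<bar>f x\<bar>" "\<bar>g x\<bar>"] by simp
    ultimately show ?thesis unfolding abs_mult by linarith
  qed
  show fg: "integrable M (\<lambda>x. f x * g x)"
    by (rule Bochner_Integration.integrable_bound[OF Bochner_Integration.integrable_add[OF f g]])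
       (use bd in \<open>auto intro!: AE_I2\<close>)
  define a b I where "a = (LINT x|M. (f x)\<^sup>2)" and "b = (LINT x|M. (g x)\<^sup>2)" and "I = (LINT x|M. f x * g x)"
  have ab: "a \<ge> 0" "b \<ge> 0" by (simp_all add: a_def b_def)
  have key: "0 \<le> t\<^sup>2 * a - 2 * t * I + b" for t
  proof -
    have "0 \<le> (LINT x|M. (t * f x - g x)\<^sup>2)" by simp
    also have "(\<lambda>x. (t * f x - g x)\<^sup>2) = (\<lambda>x. t\<^sup>2 * (f x)\<^sup>2 - 2 * t * (f x * g x) + (g x)\<^sup>2)"
      by (simp add: power2_eq_square algebra_simps)
    also have "(LINT x|M. \<dots> x) = t\<^sup>2 * a - 2 * t * I + b"
      using f g fg by (simp add: a_def b_def I_def)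
    finally show ?thesis .
  qed
  have "I\<^sup>2 \<le> a * b"
  proof (cases "a = 0")
    case True
    have "I = 0"
    proof (rule ccontr)
      assume "I \<noteq> 0"
      thus False using key[of "(b + 1) / (2 * I)"] True by simp
    qed
    thus ?thesis using True by simp
  next
    case False
    hence "(I / a)\<^sup>2 * a - 2 * (I / a) * I + b = b - I\<^sup>2 / a"
      by (simp add: power2_eq_square)
    hence "I\<^sup>2 / a \<le> b" using key[of "I / a"] by simp
    thus ?thesis using False ab by (simp add: divide_le_eq mult.commute)
  qed
  hence "\<bar>I\<bar> \<le> sqrt (a * b)" by (metis real_sqrt_abs real_sqrt_le_mono)
  thus "I \<le> sqrt a * sqrt b" by (simp add: real_sqrt_mult)
qed

lemma torus_L1_le_L2:
  fixes g :: "real ^ 'd::finite \<Rightarrow> real"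
  assumes [measurable]: "g \<in> borel_measurable borel" and g: "integrable torus_measure (\<lambda>\<xi>. (g \<xi>)\<^sup>2)"
  shows "integrable torus_measure g"
    and "(LINT \<xi>|torus_measure. g \<xi>) \<le> sqrt (LINT \<xi>|torus_measure. (g \<xi>)\<^sup>2)"
proof -
  have one: "integrable torus_measure (\<lambda>\<xi> :: real ^ 'd. 1\<^sup>2 :: real)" "(LINT \<xi>|(torus_measure :: (real ^ 'd) measure). (1\<^sup>2 :: real)) = 1"
    using emeasure_torus[where 'd = 'd] by (auto simp: measure_def)
  show "integrable torus_measure g"
    using cauchy_schwarz_integral(1)[OF _ _ g one(1)] by simp
  show "(LINT \<xi>|torus_measure. g \<xi>) \<le> sqrt (LINT \<xi>|torus_measure. (g \<xi>)\<^sup>2)"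
    using cauchy_schwarz_integral(2)[OF _ _ g one(1)] one(2) by simp
qed

text \<open>
  The form is the integral of the symbol against two trigonometric sums whose \<open>L\<^sup>2\<close> norms are those of
  \<open>a\<close> and \<open>b\<close>, so only the supremum of the symbol enters.
\<close>
lemma multiplier_form_bound:
  assumes A: "finite A" and B: "finite B"
    and M [measurable]: "M \<in> borel_measurable borel" and S: "\<And>\<xi>. norm (M \<xi>) \<le> S"
  shows "norm (\<Sum>m\<in>A. \<Sum>n\<in>B. a m * (LINT \<xi>|torus_measure. M \<xi> * character (m - n) \<xi>) * b n)
      \<le> S * (l2_norm a A * l2_norm b B)"
proof -
  have S0: "S \<ge> 0" using S[of 0] norm_ge_zero order_trans by blast
  let ?P = "\<lambda>\<xi>. norm (trig_sum A a \<xi>)" and ?Q = "\<lambda>\<xi>. norm (trig_sum B (\<lambda>n. cnj (b n)) \<xi>)"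
  have Mi: "integrable torus_measure (\<lambda>\<xi>. M \<xi> * character n \<xi>)" for n
    by (rule torus.integrable_const_bound[of _ S]) (auto simp: norm_mult intro!: AE_I2 S)
  have "(\<Sum>m\<in>A. \<Sum>n\<in>B. a m * (LINT \<xi>|torus_measure. M \<xi> * character (m - n) \<xi>) * b n) =
     (LINT \<xi>|torus_measure. (\<Sum>m\<in>A. \<Sum>n\<in>B. a m * (M \<xi> * character (m - n) \<xi>) * b n))"
    using Mi by (simp add: Bochner_Integration.integral_sum)
  also have "\<dots> = (LINT \<xi>|torus_measure. M \<xi> * (trig_sum A a \<xi> * cnj (trig_sum B (\<lambda>n. cnj (b n)) \<xi>)))"
  proof (intro Bochner_Integration.integral_cong refl)
    fix \<xi> :: "real ^ 'a"
    have "(\<Sum>m\<in>A. \<Sum>n\<in>B. a m * (M \<xi> * character (m - n) \<xi>) * b n) =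
      M \<xi> * (\<Sum>m\<in>A. \<Sum>n\<in>B. (a m * character m \<xi>) * (b n * character (- n) \<xi>))"
      using character_add[of _ "- _" \<xi>] by (simp add: sum_distrib_left mult_ac)
    thus "(\<Sum>m\<in>A. \<Sum>n\<in>B. a m * (M \<xi> * character (m - n) \<xi>) * b n) =
      M \<xi> * (trig_sum A a \<xi> * cnj (trig_sum B (\<lambda>n. cnj (b n)) \<xi>))"
      by (simp add: trig_sum_def sum_product cnj_character)
  qed
  also have "norm \<dots> \<le> (LINT \<xi>|torus_measure. norm (M \<xi> * (trig_sum A a \<xi> * cnj (trig_sum B (\<lambda>n. cnj (b n)) \<xi>))))"
    by (rule integral_norm_bound)
  also have "\<dots> \<le> (LINT \<xi>|torus_measure. S * (?P \<xi> * ?Q \<xi>))"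
  proof (rule integral_mono')
    show "integrable torus_measure (\<lambda>\<xi>. S * (?P \<xi> * ?Q \<xi>))"
      by (intro integrable_mult_right cauchy_schwarz_integral parseval_trig_sum A B) measurable
  qed (auto simp: norm_mult S0 intro!: mult_right_mono S)
  also have "\<dots> = S * (LINT \<xi>|torus_measure. ?P \<xi> * ?Q \<xi>)" by simp
  also have "\<dots> \<le> S * (sqrt (LINT \<xi>|torus_measure. (?P \<xi>)\<^sup>2) * sqrt (LINT \<xi>|torus_measure. (?Q \<xi>)\<^sup>2))"
    by (intro mult_left_mono cauchy_schwarz_integral parseval_trig_sum A B S0) measurable
  also have "\<dots> = S * (l2_norm a A * l2_norm b B)"
    by (simp add: parseval_trig_sum A B L2_set_def)
  finally show ?thesis .
qed

section \<open>Fourier series of square-summable functions and the discrete Laplacian\<close>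

lemma torus_set_integral:
  fixes g :: "real ^ 'd::finite \<Rightarrow> 'b::{banach, second_countable_topology}"
  shows "(LINT \<xi>:torus|lborel. g \<xi>) = (LINT \<xi>|torus_measure. g \<xi>)"
    and "set_integrable lborel torus g \<longleftrightarrow> integrable torus_measure g"
  by (simp_all add: set_lebesgue_integral_def set_integrable_def integral_restrict_space integrable_restrict_space)

lemma ell_2_iff: "f \<in> ell 2 \<longleftrightarrow> (\<lambda>n. (norm (f n))\<^sup>2) summable_on UNIV"
  by (simp add: ell_def powr_numeral)

definition fourier_sum :: "(int ^ 'd::finite \<Rightarrow> complex) \<Rightarrow> (int ^ 'd) set \<Rightarrow> real ^ 'd \<Rightarrow> complex" where
  "fourier_sum f A \<xi> = (\<Sum>n\<in>A. f n * character (- n) \<xi>)"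

lemma fourier_sum_measurable [measurable]: "fourier_sum f A \<in> borel_measurable borel"
  unfolding fourier_sum_def by measurable

lemma fourier_sum_diff_L2:
  assumes C: "finite C" and D: "finite D"
  shows "integrable torus_measure (\<lambda>\<xi>. (norm (fourier_sum f C \<xi> - fourier_sum f D \<xi>))\<^sup>2)"
    and "(L2_dist_sq (fourier_sum f C) (fourier_sum f D))
          = (\<Sum>n\<in>(C - D) \<union> (D - C). (norm (f n))\<^sup>2)"
proof -
  define c where "c = (\<lambda>n. cnj (f n * (of_bool (n \<in> C) - of_bool (n \<in> D))))"
  have eq: "norm (fourier_sum f C \<xi> - fourier_sum f D \<xi>) = norm (trig_sum (C \<union> D) c \<xi>)" for \<xi>
  proof -
    have 1: "fourier_sum f X \<xi> = (\<Sum>n\<in>C \<union> D. f n * of_bool (n \<in> X) * character (- n) \<xi>)" if "X \<subseteq> C \<union> D" for X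
      unfolding fourier_sum_def using C D that by (intro sum.mono_neutral_cong_left) auto
    have "fourier_sum f C \<xi> - fourier_sum f D \<xi> = cnj (trig_sum (C \<union> D) c \<xi>)"
      by (subst (1 2) 1) (auto simp: trig_sum_def c_def cnj_character algebra_simps sum_subtractf[symmetric] intro!: sum.cong)
    thus ?thesis by simp
  qed
  show "integrable torus_measure (\<lambda>\<xi>. (norm (fourier_sum f C \<xi> - fourier_sum f D \<xi>))\<^sup>2)"
    unfolding eq using C D by (intro parseval_trig_sum) auto
  have "(L2_dist_sq (fourier_sum f C) (fourier_sum f D)) = (\<Sum>n\<in>C \<union> D. (norm (c n))\<^sup>2)"
    unfolding eq using C D by (intro parseval_trig_sum) auto
  also have "\<dots> = (\<Sum>n\<in>(C - D) \<union> (D - C). (norm (f n))\<^sup>2)"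
    using C D by (intro sum.mono_neutral_cong_right) (auto simp: c_def)
  finally show "(L2_dist_sq (fourier_sum f C) (fourier_sum f D))
          = (\<Sum>n\<in>(C - D) \<union> (D - C). (norm (f n))\<^sup>2)" .
qed

lemma summable_tail_sums:
  fixes g :: "'a \<Rightarrow> real"
  assumes g: "g summable_on UNIV" and g0: "\<And>n. 0 \<le> g n" and e: "e > 0"
  obtains A where "finite A" "\<And>B. finite B \<Longrightarrow> A \<inter> B = {} \<Longrightarrow> sum g B \<le> e"
proof -
  have "eventually (\<lambda>A. dist (sum g A) (infsum g UNIV) < e) (finite_subsets_at_top UNIV)"
    using has_sum_infsum[OF g] e by (auto simp: has_sum_def tendsto_iff)
  then obtain A where A: "finite A" "dist (sum g A) (infsum g UNIV) < e"
    by (auto simp: eventually_finite_subsets_at_top)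
  show thesis
  proof (rule that[OF A(1)])
    fix B :: "'a set" assume B: "finite B" "A \<inter> B = {}"
    have "sum g A + sum g B = sum g (A \<union> B)" using A B by (simp add: sum.union_disjoint)
    also have "\<dots> \<le> infsum g UNIV"
      using A B g g0 by (intro finite_sum_le_infsum) auto
    finally show "sum g B \<le> e" using A(2) by (simp add: dist_real_def)
  qed
qed

text \<open>
  The Riesz-Fischer theorem. Choose finite sets \<open>E k\<close> outside of which \<open>|f|\<^sup>2\<close> has mass at most \<open>4\<^sup>-\<^sup>k\<close>.
  Along these sets the increments of the partial sums have \<open>L\<^sup>1\<close> norm at most \<open>2\<^sup>-\<^sup>k\<close>, so the partial sums converge
  almost everywhere, and Fatou's lemma bounds the \<open>L\<^sup>2\<close> distance of the limit from any partial sum.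
\<close>
lemma fourier_transform_exists:
  fixes f :: "int ^ 'd::finite \<Rightarrow> complex"
  assumes f: "f \<in> ell 2"
  shows "\<exists>F. is_fourier_transform f F"
proof -
  let ?g = "\<lambda>n. (norm (f n))\<^sup>2"
  let ?S = "fourier_sum f"
  have g: "?g summable_on UNIV" using f by (simp add: ell_2_iff)
  have "\<exists>A. finite A \<and> (\<forall>B. finite B \<longrightarrow> A \<inter> B = {} \<longrightarrow> sum ?g B \<le> (1/4) ^ k)" for k :: nat
    by (rule summable_tail_sums[OF g, of "(1/4) ^ k"]) auto
  then obtain A where A: "\<And>k. finite (A k)" "\<And>k B. finite B \<Longrightarrow> A k \<inter> B = {} \<Longrightarrow> sum ?g B \<le> (1/4) ^ k"
    by metis
  define E where "E = (\<lambda>k::nat. \<Union>i\<le>k. A i)"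
  have finE: "finite (E k)" for k using A(1) by (auto simp: E_def)
  have monoE: "j \<le> k \<Longrightarrow> E j \<subseteq> E k" for j k by (fastforce simp: E_def)
  have tailE: "sum ?g B \<le> (1/4) ^ k" if "finite B" "E k \<inter> B = {}" for k B
    using A(2)[of B k] that by (auto simp: E_def)
  define \<Delta> where "\<Delta> = (\<lambda>k \<xi>. norm (?S (E (Suc k)) \<xi> - ?S (E k) \<xi>))"
  have \<Delta>m [measurable]: "\<Delta> k \<in> borel_measurable borel" for k
    unfolding \<Delta>_def by measurable
  have \<Delta>int: "integrable torus_measure (\<Delta> k)" "(LINT \<xi>|torus_measure. \<Delta> k \<xi>) \<le> (1/2) ^ k" for k
  proof -
    have sq: "integrable torus_measure (\<lambda>\<xi>. (\<Delta> k \<xi>)\<^sup>2)" "(LINT \<xi>|torus_measure. (\<Delta> k \<xi>)\<^sup>2) \<le> (1/4) ^ k"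
      unfolding \<Delta>_def using monoE[of k "Suc k"]
      by (auto simp: fourier_sum_diff_L2 finE intro!: tailE)
    show "integrable torus_measure (\<Delta> k)"
      by (rule torus_L1_le_L2(1)[OF _ sq(1)]) measurable
    have "(LINT \<xi>|torus_measure. \<Delta> k \<xi>) \<le> sqrt (LINT \<xi>|torus_measure. (\<Delta> k \<xi>)\<^sup>2)"
      by (rule torus_L1_le_L2(2)[OF _ sq(1)]) measurable
    also have "\<dots> \<le> sqrt ((1/4) ^ k)" using sq(2) by simp
    also have "\<dots> = (1/2) ^ k" by (simp add: real_sqrt_power real_sqrt_divide)
    finally show "(LINT \<xi>|torus_measure. \<Delta> k \<xi>) \<le> (1/2) ^ k" .
  qed
  have "(\<integral>\<^sup>+\<xi>. (\<Sum>k. ennreal (\<Delta> k \<xi>)) \<partial>torus_measure) = (\<Sum>k. \<integral>\<^sup>+\<xi>. ennreal (\<Delta> k \<xi>) \<partial>torus_measure)"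
    by (intro nn_integral_suminf) measurable
  also have "\<dots> \<le> (\<Sum>k. ennreal ((1/2) ^ k))"
  proof (intro suminf_le summableI)
    show "(\<integral>\<^sup>+\<xi>. ennreal (\<Delta> k \<xi>) \<partial>torus_measure) \<le> ennreal ((1/2) ^ k)" for k
      using \<Delta>int[of k] by (subst nn_integral_eq_integral) (auto simp: \<Delta>_def ennreal_leI)
  qed
  also have "\<dots> < \<infinity>"
    by (simp add: ennreal_suminf_neq_top less_top[symmetric] summable_geometric del: ennreal_power)
  finally have "(\<integral>\<^sup>+\<xi>. (\<Sum>k. ennreal (\<Delta> k \<xi>)) \<partial>torus_measure) \<noteq> \<infinity>" by simp
  hence "AE \<xi> in torus_measure. (\<Sum>k. ennreal (\<Delta> k \<xi>)) \<noteq> \<infinity>"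
    by (intro nn_integral_PInf_AE) measurable
  hence conv: "AE \<xi> in torus_measure. convergent (\<lambda>k. ?S (E k) \<xi>)"
  proof (eventually_elim)
    case (elim \<xi>)
    hence "summable (\<lambda>k. \<Delta> k \<xi>)"
      by (intro summable_suminf_not_top) (auto simp: \<Delta>_def)
    hence "summable (\<lambda>k. ?S (E (Suc k)) \<xi> - ?S (E k) \<xi>)"
      unfolding \<Delta>_def by (rule summable_norm_cancel)
    hence "convergent (\<lambda>n. \<Sum>k<n. ?S (E (Suc k)) \<xi> - ?S (E k) \<xi>)"
      by (simp add: summable_iff_convergent)
    hence "convergent (\<lambda>n. ?S (E n) \<xi> - ?S (E 0) \<xi>)"
      using sum_lessThan_telescope[of "\<lambda>k. ?S (E k) \<xi>"] by simp
    from convergent_add[OF this convergent_const[of "?S (E 0) \<xi>"]] show ?case by simp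
  qed
  define F where "F = (\<lambda>\<xi>. lim (\<lambda>k. ?S (E k) \<xi>))"
  have Fm [measurable]: "F \<in> borel_measurable borel"
    unfolding F_def by measurable
  have lim: "AE \<xi> in torus_measure. (\<lambda>k. ?S (E k) \<xi>) \<longlonglongrightarrow> F \<xi>"
    using conv by eventually_elim (simp add: F_def convergent_LIMSEQ_iff)
  \<comment> \<open>With \<open>C\<close> empty this shows that \<open>F\<close> is square integrable, with \<open>C\<close> containing \<open>E j\<close> it gives the rate of approximation.\<close>
  have fatou: "integrable torus_measure (\<lambda>\<xi>. (norm (F \<xi> - ?S C \<xi>))\<^sup>2) \<and>
       (L2_dist_sq F (?S C)) \<le> b"
    if C: "finite C" and b: "\<And>k. k \<ge> j \<Longrightarrow> sum ?g ((E k - C) \<union> (C - E k)) \<le> b" for C b j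
  proof -
    have b0: "b \<ge> 0" using b[of j] sum_nonneg[of "(E j - C) \<union> (C - E j)" ?g] by simp
    have "(\<integral>\<^sup>+\<xi>. ennreal ((norm (F \<xi> - ?S C \<xi>))\<^sup>2) \<partial>torus_measure)
       = (\<integral>\<^sup>+\<xi>. liminf (\<lambda>k. ennreal ((norm (?S (E k) \<xi> - ?S C \<xi>))\<^sup>2)) \<partial>torus_measure)"
    proof (rule nn_integral_cong_AE, use lim in eventually_elim)
      case (elim \<xi>)
      have "(\<lambda>k. ennreal ((norm (?S (E k) \<xi> - ?S C \<xi>))\<^sup>2)) \<longlonglongrightarrow> ennreal ((norm (F \<xi> - ?S C \<xi>))\<^sup>2)"
        by (intro tendsto_intros elim)
      from lim_imp_Liminf[OF sequentially_bot this] show ?case by (rule sym)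
    qed
    also have "\<dots> \<le> liminf (\<lambda>k. \<integral>\<^sup>+\<xi>. ennreal ((norm (?S (E k) \<xi> - ?S C \<xi>))\<^sup>2) \<partial>torus_measure)"
      by (intro nn_integral_liminf) measurable
    also have "\<dots> \<le> limsup (\<lambda>k. \<integral>\<^sup>+\<xi>. ennreal ((norm (?S (E k) \<xi> - ?S C \<xi>))\<^sup>2) \<partial>torus_measure)"
      by (intro Liminf_le_Limsup) simp
    also have "\<dots> \<le> ennreal b"
    proof (rule Limsup_bounded, rule eventually_sequentiallyI)
      fix k assume "j \<le> k"
      thus "(\<integral>\<^sup>+\<xi>. ennreal ((norm (?S (E k) \<xi> - ?S C \<xi>))\<^sup>2) \<partial>torus_measure) \<le> ennreal b"
        using b[of k] fourier_sum_diff_L2[OF finE[of k] C, of f]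
        by (subst nn_integral_eq_integral) (auto simp: ennreal_leI)
    qed
    finally have le: "(\<integral>\<^sup>+\<xi>. ennreal ((norm (F \<xi> - ?S C \<xi>))\<^sup>2) \<partial>torus_measure) \<le> ennreal b" .
    have int: "integrable torus_measure (\<lambda>\<xi>. (norm (F \<xi> - ?S C \<xi>))\<^sup>2)"
      using le by (intro integrableI_bounded) (auto simp: less_top[symmetric] top_unique)
    with le show ?thesis using b0
      by (subst (asm) nn_integral_eq_integral) auto
  qed
  have L2: "integrable torus_measure (\<lambda>\<xi>. (norm (F \<xi>))\<^sup>2)"
  proof -
    have "sum ?g ((E k - {}) \<union> ({} - E k)) \<le> infsum ?g UNIV" for k
      using g finE by (intro finite_sum_le_infsum) auto
    from fatou[where C = "{}", OF _ this] show ?thesis by (simp add: fourier_sum_def)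
  qed
  have "((\<lambda>A. L2_dist_sq F (?S A)) \<longlongrightarrow> 0) (finite_subsets_at_top UNIV)"
  proof (rule tendstoI)
    fix e :: real assume "e > 0"
    then obtain j where j: "(1/4) ^ j < e"
      using real_arch_pow_inv[of e "1/4"] by auto
    have "dist (L2_dist_sq F (?S C)) 0 < e" if "finite C" "E j \<subseteq> C" for C
    proof -
      have "sum ?g ((E k - C) \<union> (C - E k)) \<le> (1/4) ^ j" if "k \<ge> j" for k
        using monoE[OF that] \<open>E j \<subseteq> C\<close> \<open>finite C\<close> finE by (intro tailE) auto
      from fatou[where j = j, OF that(1) this] j show ?thesis
        by (simp add: dist_real_def)
    qed
    thus "eventually (\<lambda>C. dist (L2_dist_sq F (?S C)) 0 < e) (finite_subsets_at_top UNIV)"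
      unfolding eventually_finite_subsets_at_top using finE[of j] by blast
  qed
  with L2 have "is_fourier_transform f F"
    by (simp add: is_fourier_transform_def L2_torus_def torus_set_integral fourier_sum_def)
  thus ?thesis by blast
qed

abbreviation difference_laplacian :: "(int ^ 'd::finite \<Rightarrow> complex) \<Rightarrow> int ^ 'd \<Rightarrow> complex" where
  "difference_laplacian f n \<equiv> (\<Sum>j\<in>UNIV. 2 * f n - f (n + axis j 1) - f (n - axis j 1))"

lemma laplacian_symbol_eq:
  "complex_of_real (laplacian_symbol \<xi>) =
     (\<Sum>j\<in>UNIV. 2 - character (axis j 1) \<xi> - character (- axis j 1) (\<xi> :: real ^ 'd::finite))"
proof -
  have ax: "(\<Sum>i\<in>UNIV. real_of_int (axis j 1 $ i) * \<xi> $ i) = \<xi> $ j" for j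
    by (simp add: axis_def if_distrib if_distribR sum.If_cases cong: if_cong)
  have "2 - character (axis j 1) \<xi> - character (- axis j 1) \<xi> = complex_of_real (4 * (sin (pi * \<xi> $ j))\<^sup>2)" for j
  proof -
    have 1: "character (axis j 1) \<xi> = cis (2 * (pi * \<xi> $ j))"
      unfolding character_def ax by (simp add: cis_conv_exp mult_ac)
    have 2: "character (- axis j 1) \<xi> = cis (- (2 * (pi * \<xi> $ j)))"
      unfolding cnj_character[symmetric] 1 by (simp add: cis_cnj)
    show ?thesis
      unfolding 1 2 by (simp add: complex_eq_iff cos_double_sin)
  qed
  thus ?thesis
    by (simp add: laplacian_symbol_def sum_distrib_left)
qed

lemma laplacian_symbol_bounds:
  "0 \<le> laplacian_symbol \<xi>" "laplacian_symbol (\<xi> :: real ^ 'd::finite) \<le> 4 * real CARD('d)"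
proof -
  have "(\<Sum>j\<in>UNIV. (sin (pi * \<xi> $ j))\<^sup>2) \<le> (\<Sum>j\<in>(UNIV :: 'd set). 1)"
    by (intro sum_mono) (simp add: abs_square_le_1)
  thus "laplacian_symbol \<xi> \<le> 4 * real CARD('d)" by (simp add: laplacian_symbol_def)
  show "0 \<le> laplacian_symbol \<xi>" by (auto simp: laplacian_symbol_def intro!: sum_nonneg)
qed

lemma continuous_on_laplacian_symbol [continuous_intros]:
  fixes g :: "'a::t2_space \<Rightarrow> real ^ 'd::finite"
  shows "continuous_on S g \<Longrightarrow> continuous_on S (\<lambda>x. laplacian_symbol (g x))"
  unfolding laplacian_symbol_def
  by (intro continuous_intros continuous_on_component)

lemma laplacian_symbol_measurable [measurable]: "laplacian_symbol \<in> borel_measurable borel"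
  by (intro borel_measurable_continuous_onI continuous_intros)

lemma laplacian_symbol_coefficient:
  fixes n k :: "int ^ 'd::finite"
  shows "(LINT \<xi>|torus_measure. complex_of_real (laplacian_symbol \<xi>) * character (n - k) \<xi>) =
      (\<Sum>j\<in>UNIV. 2 * of_bool (k = n) - of_bool (k = n + axis j 1) - of_bool (k = n - axis j 1))"
proof -
  have "(LINT \<xi>|torus_measure. complex_of_real (laplacian_symbol \<xi>) * character (n - k) \<xi>) =
    (LINT \<xi>|torus_measure. (\<Sum>j\<in>UNIV. 2 * character (n - k) \<xi> - character (axis j 1 + (n - k)) \<xi> - character (- axis j 1 + (n - k)) \<xi>))"
    by (simp only: laplacian_symbol_eq sum_distrib_right left_diff_distrib character_add)
  also have "\<dots> = (\<Sum>j\<in>UNIV. 2 * (LINT \<xi>|torus_measure. character (n - k) \<xi>)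
      - (LINT \<xi>|torus_measure. character (axis j 1 + (n - k)) \<xi>) - (LINT \<xi>|torus_measure. character (- axis j 1 + (n - k)) \<xi>))"
    by (subst Bochner_Integration.integral_sum) auto
  also have "\<dots> = (\<Sum>j\<in>UNIV. 2 * of_bool (k = n) - of_bool (k = n + axis j 1) - of_bool (k = n - axis j 1))"
    unfolding character_integral
    by (intro sum.cong refl arg_cong2[where f = minus] arg_cong2[where f = times]) (auto simp: algebra_simps)
  finally show ?thesis .
qed

text \<open>
  The symbol is bounded, so the inverse transform may be taken along the \<open>L\<^sup>2\<close> convergent partial sums of
  the Fourier series of \<open>f\<close>. For these it is a finite computation with the coefficients of the symbol,
  whose value no longer changes once the partial sum contains \<open>n\<close> and its neighbours.
\<close>
lemma discrete_laplacian_difference: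
  fixes f :: "int ^ 'd::finite \<Rightarrow> complex"
  assumes f: "f \<in> ell 2"
  shows "discrete_laplacian f n = (difference_laplacian f n)"
proof -
  define F where "F = fourier f"
  define h where "h = (\<lambda>\<xi> :: real ^ 'd. complex_of_real (laplacian_symbol \<xi>))"
  define D where "D = 4 * real CARD('d)"
  have hm [measurable]: "h \<in> borel_measurable borel" unfolding h_def by measurable
  have hD: "norm (h \<xi>) \<le> D" for \<xi>
    using laplacian_symbol_bounds[of \<xi>] by (simp add: h_def D_def)
  have hD0: "norm (h \<xi>) \<le> \<bar>D\<bar>" for \<xi> using hD[of \<xi>] by linarith
  have "is_fourier_transform f F"
    unfolding F_def fourier_def using fourier_transform_exists[OF f] by (rule someI_ex)
  hence Fm [measurable]: "F \<in> borel_measurable borel"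
    and FL: "integrable torus_measure (\<lambda>\<xi>. (norm (F \<xi>))\<^sup>2)"
    and lim: "((\<lambda>A. L2_dist_sq F (fourier_sum f A)) \<longlongrightarrow> 0) (finite_subsets_at_top UNIV)"
    by (simp_all add: is_fourier_transform_def L2_torus_def torus_set_integral fourier_sum_def)
  have Fi: "integrable torus_measure F"
    using torus_L1_le_L2(1)[OF _ FL] integrable_norm_iff[of F torus_measure] by simp
  have Si: "integrable torus_measure (fourier_sum f A)" for A
    unfolding fourier_sum_def by (intro Bochner_Integration.integrable_sum integrable_mult_right) simp
  define a where "a = (\<lambda>A. LINT \<xi>|torus_measure. h \<xi> * fourier_sum f A \<xi> * character n \<xi>)"
  have int: "integrable torus_measure (\<lambda>\<xi>. h \<xi> * G \<xi> * character n \<xi>)" if "integrable torus_measure G" for G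
  proof -
    have "integrable torus_measure (\<lambda>\<xi>. D *\<^sub>R G \<xi>)" using that by simp
    thus ?thesis
      by (rule Bochner_Integration.integrable_bound)
         (use borel_measurable_integrable[OF that] hD0 in \<open>auto simp: norm_mult intro!: AE_I2 mult_right_mono\<close>)
  qed
  have L: "discrete_laplacian f n = (LINT \<xi>|torus_measure. h \<xi> * F \<xi> * character n \<xi>)"
    by (simp add: discrete_laplacian_def fourier_multiplier_def inverse_fourier_def torus_set_integral F_def h_def)
  have err: "norm (a A - discrete_laplacian f n) \<le> D * sqrt (L2_dist_sq F (fourier_sum f A))" for A
  proof -
    have I: "integrable torus_measure (\<lambda>\<xi>. (norm (F \<xi> - fourier_sum f A \<xi>))\<^sup>2)"
    proof (rule Bochner_Integration.integrable_bound)
      show "integrable torus_measure (\<lambda>\<xi>. 2 * (norm (F \<xi>))\<^sup>2 + 2 * (\<Sum>n\<in>A. norm (f n))\<^sup>2)"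
        using FL by auto
      have "(norm (F \<xi> - fourier_sum f A \<xi>))\<^sup>2 \<le> 2 * (norm (F \<xi>))\<^sup>2 + 2 * (\<Sum>n\<in>A. norm (f n))\<^sup>2" for \<xi>
      proof -
        have "norm (fourier_sum f A \<xi>) \<le> (\<Sum>n\<in>A. norm (f n))"
          unfolding fourier_sum_def by (rule order_trans[OF norm_sum]) (simp add: norm_mult)
        hence "norm (F \<xi> - fourier_sum f A \<xi>) \<le> norm (F \<xi>) + (\<Sum>n\<in>A. norm (f n))"
          using norm_triangle_ineq4[of "F \<xi>" "fourier_sum f A \<xi>"] by linarith
        hence "(norm (F \<xi> - fourier_sum f A \<xi>))\<^sup>2 \<le> (norm (F \<xi>) + (\<Sum>n\<in>A. norm (f n)))\<^sup>2"
          by (intro power_mono) auto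
        also have "\<dots> \<le> 2 * (norm (F \<xi>))\<^sup>2 + 2 * (\<Sum>n\<in>A. norm (f n))\<^sup>2"
          using sum_squares_bound[of "norm (F \<xi>)" "\<Sum>n\<in>A. norm (f n)"] by (simp add: power2_sum)
        finally show ?thesis .
      qed
      thus "AE \<xi> in torus_measure. norm ((norm (F \<xi> - fourier_sum f A \<xi>))\<^sup>2) \<le> norm (2 * (norm (F \<xi>))\<^sup>2 + 2 * (\<Sum>n\<in>A. norm (f n))\<^sup>2)"
        by (auto intro!: AE_I2)
    qed measurable
    have "a A - discrete_laplacian f n = (LINT \<xi>|torus_measure. h \<xi> * fourier_sum f A \<xi> * character n \<xi> - h \<xi> * F \<xi> * character n \<xi>)"
      unfolding a_def L by (intro Bochner_Integration.integral_diff[symmetric] int Si Fi)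
    also have "norm \<dots> \<le> (LINT \<xi>|torus_measure. norm (h \<xi> * fourier_sum f A \<xi> * character n \<xi> - h \<xi> * F \<xi> * character n \<xi>))"
      by (rule integral_norm_bound)
    also have "\<dots> \<le> (LINT \<xi>|torus_measure. D * norm (F \<xi> - fourier_sum f A \<xi>))"
    proof (rule integral_mono')
      show "integrable torus_measure (\<lambda>\<xi>. D * norm (F \<xi> - fourier_sum f A \<xi>))"
        using Fi Si by auto
      fix \<xi> :: "real ^ 'd"
      have "norm (h \<xi> * fourier_sum f A \<xi> * character n \<xi> - h \<xi> * F \<xi> * character n \<xi>)
         = norm (h \<xi>) * norm (fourier_sum f A \<xi> - F \<xi>)"
        by (simp add: norm_mult flip: right_diff_distrib left_diff_distrib)
      also have "\<dots> \<le> D * norm (F \<xi> - fourier_sum f A \<xi>)"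
        unfolding norm_minus_commute[of "F \<xi>"] by (intro mult_right_mono hD) auto
      finally show "norm (h \<xi> * fourier_sum f A \<xi> * character n \<xi> - h \<xi> * F \<xi> * character n \<xi>)
        \<le> D * norm (F \<xi> - fourier_sum f A \<xi>)" .
    qed (auto simp: D_def)
    also have "\<dots> \<le> D * sqrt (L2_dist_sq F (fourier_sum f A))"
      using torus_L1_le_L2(2)[OF _ I] by (simp add: D_def)
    finally show ?thesis .
  qed
  have "((\<lambda>A. D * sqrt (L2_dist_sq F (fourier_sum f A))) \<longlongrightarrow> D * sqrt 0) (finite_subsets_at_top UNIV)"
    by (intro tendsto_intros lim)
  hence lim0: "((\<lambda>A. D * sqrt (L2_dist_sq F (fourier_sum f A))) \<longlongrightarrow> 0) (finite_subsets_at_top UNIV)"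
    by simp
  have "((\<lambda>A. a A - discrete_laplacian f n) \<longlongrightarrow> 0) (finite_subsets_at_top UNIV)"
    by (rule Lim_null_comparison[OF _ lim0]) (simp add: err)
  hence lim_a: "(a \<longlongrightarrow> discrete_laplacian f n) (finite_subsets_at_top UNIV)"
    by (simp add: LIM_zero_iff)
  define X where "X = insert n ((\<lambda>j. n + axis j 1) ` UNIV \<union> (\<lambda>j. n - axis j 1) ` (UNIV :: 'd set))"
  have a_eq: "a A = (difference_laplacian f n)" if A: "finite A" "X \<subseteq> A" for A
  proof -
    have "a A = (LINT \<xi>|torus_measure. (\<Sum>k\<in>A. f k * (h \<xi> * character (n - k) \<xi>)))"
      unfolding a_def fourier_sum_def
      using character_add[of n "- _"] by (simp add: sum_distrib_left sum_distrib_right mult_ac)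
    also have "\<dots> = (\<Sum>k\<in>A. f k * (LINT \<xi>|torus_measure. h \<xi> * character (n - k) \<xi>))"
    proof -
      have "integrable torus_measure (\<lambda>\<xi>. h \<xi> * character k \<xi>)" for k
        by (rule torus.integrable_const_bound[of _ D]) (auto simp: norm_mult intro!: AE_I2 hD)
      thus ?thesis by (subst Bochner_Integration.integral_sum) auto
    qed
    also have "\<dots> = (\<Sum>k\<in>A. \<Sum>j\<in>UNIV. f k * (2 * of_bool (k = n) - of_bool (k = n + axis j 1) - of_bool (k = n - axis j 1)))"
      by (simp only: h_def laplacian_symbol_coefficient sum_distrib_left)
    also have "\<dots> = (\<Sum>j\<in>UNIV. \<Sum>k\<in>A. f k * (2 * of_bool (k = n) - of_bool (k = n + axis j 1) - of_bool (k = n - axis j 1)))"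
      by (rule sum.swap)
    also have "\<dots> = (difference_laplacian f n)"
    proof (rule sum.cong[OF refl])
      fix j :: 'd
      have pick: "(\<Sum>k\<in>A. f k * of_bool (k = m)) = f m" if "m \<in> A" for m
        using A(1) that by (simp add: of_bool_def if_distrib sum.delta cong: if_cong)
      have "n \<in> A" "n + axis j 1 \<in> A" "n - axis j 1 \<in> A" using A(2) by (auto simp: X_def)
      hence "(\<Sum>k\<in>A. 2 * (f k * of_bool (k = n)) - f k * of_bool (k = n + axis j 1) - f k * of_bool (k = n - axis j 1))
         = 2 * f n - f (n + axis j 1) - f (n - axis j 1)"
        by (simp add: sum_subtractf sum_distrib_left[symmetric] pick)
      thus "(\<Sum>k\<in>A. f k * (2 * of_bool (k = n) - of_bool (k = n + axis j 1) - of_bool (k = n - axis j 1)))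
         = 2 * f n - f (n + axis j 1) - f (n - axis j 1)"
        by (simp add: algebra_simps)
    qed
    finally show ?thesis .
  qed
  have "eventually (\<lambda>A. a A = (difference_laplacian f n)) (finite_subsets_at_top UNIV)"
    unfolding eventually_finite_subsets_at_top using a_eq by (intro exI[of _ X]) (auto simp: X_def)
  hence "(a \<longlongrightarrow> (difference_laplacian f n)) (finite_subsets_at_top UNIV)"
    by (rule tendsto_eventually)
  with lim_a show ?thesis
    by (intro tendsto_unique[of "finite_subsets_at_top UNIV"]) auto
qed

section \<open>Decay of Bessel integrals and their time integrals\<close>

text \<open>
  The function \<open>exp (i \<phi>)\<close> is the derivative of \<open>G = exp (i \<phi>) / (i \<phi>')\<close> up to an error \<open>H\<close> of modulus
  \<open>\<phi>'' / \<phi>'\<^sup>2\<close>. As \<open>\<phi>''\<close> has a sign, this modulus is itself the derivative of \<open>- 1 / \<phi>'\<close>, so the integral of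
  the error is bounded by boundary values as well.
\<close>
lemma van_der_corput_first_derivative:
  fixes \<phi> \<phi>' \<phi>'' :: "real \<Rightarrow> real"
  assumes ab: "a \<le> b" and m: "m > 0"
    and d1: "\<And>x. (\<phi> has_real_derivative \<phi>' x) (at x)"
    and d2: "\<And>x. (\<phi>' has_real_derivative \<phi>'' x) (at x)"
    and c2: "continuous_on {a..b} \<phi>''"
    and pos: "\<And>x. x \<in> {a..b} \<Longrightarrow> \<phi>'' x \<ge> 0"
    and low: "\<And>x. x \<in> {a..b} \<Longrightarrow> \<bar>\<phi>' x\<bar> \<ge> m"
  shows "norm (integral {a..b} (\<lambda>x. exp (\<i> * complex_of_real (\<phi> x)))) \<le> 4 / m"
proof -
  define e where "e = (\<lambda>x. exp (\<i> * complex_of_real (\<phi> x)))"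
  define G where "G = (\<lambda>x. e x / (\<i> * complex_of_real (\<phi>' x)))"
  define H where "H = (\<lambda>x. \<i> * e x * complex_of_real (\<phi>'' x / (\<phi>' x)\<^sup>2))"
  have nz: "\<phi>' x \<noteq> 0" if "x \<in> {a..b}" for x
    using low[OF that] m by auto
  have c0: "continuous_on {a..b} \<phi>" "continuous_on {a..b} \<phi>'"
    using d1 d2 by (auto intro!: continuous_at_imp_continuous_on DERIV_isCont)
  have ne: "norm (e x) = 1" for x
    by (simp add: e_def)
  have cg: "continuous_on {a..b} (\<lambda>x. \<phi>'' x / (\<phi>' x)\<^sup>2)"
    using c0 c2 nz by (auto intro!: continuous_intros)
  have ce: "continuous_on {a..b} e"
    unfolding e_def using c0 by (auto intro!: continuous_intros)
  have cH: "continuous_on {a..b} H"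
    unfolding H_def by (intro continuous_intros ce cg)
  have De: "(e has_vector_derivative \<i> * complex_of_real (\<phi>' x) * e x) (at x)" for x
  proof -
    have "((\<lambda>x. complex_of_real (\<phi> x)) has_vector_derivative complex_of_real (\<phi>' x)) (at x)"
      by (intro has_vector_derivative_of_real d1)
    moreover have "((\<lambda>w. exp (\<i> * w)) has_field_derivative \<i> * exp (\<i> * complex_of_real (\<phi> x)))
        (at (complex_of_real (\<phi> x)))"
      by (auto intro!: derivative_eq_intros)
    ultimately show ?thesis
      using field_vector_diff_chain_at by (fastforce simp: o_def e_def mult_ac)
  qed
  have Di: "((\<lambda>x. complex_of_real (1 / \<phi>' x)) has_vector_derivative
        complex_of_real (- \<phi>'' x / (\<phi>' x)\<^sup>2)) (at x within {a..b})" if "x \<in> {a..b}" for x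
    by (rule has_vector_derivative_of_real)
       (use nz[OF that] in \<open>auto intro!: derivative_eq_intros DERIV_subset[OF d2] simp: power2_eq_square field_simps\<close>)
  have DG: "(G has_vector_derivative (e x + H x)) (at x within {a..b})" if "x \<in> {a..b}" for x
  proof -
    have "((\<lambda>x. (- \<i> * e x) * complex_of_real (1 / \<phi>' x)) has_vector_derivative
       ((- \<i> * e x) * complex_of_real (- \<phi>'' x / (\<phi>' x)\<^sup>2) +
        (- \<i> * (\<i> * complex_of_real (\<phi>' x) * e x)) * complex_of_real (1 / \<phi>' x))) (at x within {a..b})"
      by (intro has_vector_derivative_mult has_vector_derivative_mult_right
          has_vector_derivative_at_within[OF De] Di that)
    moreover have "(\<lambda>x. (- \<i> * e x) * complex_of_real (1 / \<phi>' x)) = G"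
      by (auto simp: G_def fun_eq_iff divide_simps algebra_simps)
    moreover have "((- \<i> * e x) * complex_of_real (- \<phi>'' x / (\<phi>' x)\<^sup>2) +
        (- \<i> * (\<i> * complex_of_real (\<phi>' x) * e x)) * complex_of_real (1 / \<phi>' x)) = e x + H x"
      using nz[OF that] by (simp add: H_def field_simps)
    ultimately show ?thesis by simp
  qed
  have "((\<lambda>x. e x + H x) has_integral (G b - G a)) {a..b}"
    by (rule fundamental_theorem_of_calculus[OF ab]) (use DG in auto)
  moreover have "(H has_integral integral {a..b} H) {a..b}"
    using cH integrable_continuous_interval by blast
  ultimately have "((\<lambda>x. (e x + H x) - H x) has_integral (G b - G a) - integral {a..b} H) {a..b}"
    by (rule has_integral_diff)
  hence I: "integral {a..b} e = G b - G a - integral {a..b} H"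
    by (simp add: integral_unique)
  have "((\<lambda>x. \<phi>'' x / (\<phi>' x)\<^sup>2) has_integral (- 1 / \<phi>' b - (- 1 / \<phi>' a))) {a..b}"
  proof (rule fundamental_theorem_of_calculus[OF ab])
    fix x assume x: "x \<in> {a..b}"
    show "((\<lambda>x. - 1 / \<phi>' x) has_vector_derivative \<phi>'' x / (\<phi>' x)\<^sup>2) (at x within {a..b})"
      unfolding has_real_derivative_iff_has_vector_derivative[symmetric]
      using nz[OF x] by (auto intro!: derivative_eq_intros DERIV_subset[OF d2] simp: power2_eq_square field_simps)
  qed
  hence J: "integral {a..b} (\<lambda>x. \<phi>'' x / (\<phi>' x)\<^sup>2) = 1 / \<phi>' a - 1 / \<phi>' b"
    by (simp add: integral_unique)
  have "norm (integral {a..b} H) \<le> integral {a..b} (\<lambda>x. \<phi>'' x / (\<phi>' x)\<^sup>2)"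
    by (rule integral_norm_bound_integral)
       (use cH cg pos in \<open>auto intro!: integrable_continuous_interval simp: H_def norm_mult norm_divide ne norm_power\<close>)
  also have "\<dots> \<le> \<bar>1 / \<phi>' a\<bar> + \<bar>1 / \<phi>' b\<bar>"
    unfolding J by linarith
  finally have "norm (integral {a..b} H) \<le> \<bar>1 / \<phi>' a\<bar> + \<bar>1 / \<phi>' b\<bar>" .
  moreover have "norm (G x) = \<bar>1 / \<phi>' x\<bar>" for x
    by (simp add: G_def norm_divide norm_mult ne)
  ultimately have *: "norm (integral {a..b} e) \<le> 2 * \<bar>1 / \<phi>' a\<bar> + 2 * \<bar>1 / \<phi>' b\<bar>"
    unfolding I using norm_triangle_ineq4[of "G b - G a" "integral {a..b} H"]
      norm_triangle_ineq4[of "G b" "G a"] by simp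
  have "\<bar>1 / \<phi>' x\<bar> \<le> 1 / m" if "x \<in> {a..b}" for x
    using low[OF that] m by (simp add: frac_le)
  from this[of a] this[of b] have "\<bar>1 / \<phi>' a\<bar> \<le> 1 / m" "\<bar>1 / \<phi>' b\<bar> \<le> 1 / m"
    using ab by auto
  with * have "norm (integral {a..b} e) \<le> 4 / m"
    by simp
  thus ?thesis by (simp add: e_def)
qed

text \<open>
  For integer \<open>\<nu>\<close> the real part is \<open>\<pi> J\<^sub>\<nu>(\<tau>)\<close>. The full exponential is kept because van der Corput's lemma
  is phrased for it.
\<close>
definition bessel_integral :: "real \<Rightarrow> real \<Rightarrow> complex" where
  "bessel_integral \<nu> \<tau> = integral {0..pi} (\<lambda>\<alpha>. exp (\<i> * complex_of_real (\<nu> * \<alpha> - \<tau> * sin \<alpha>)))"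

lemma bessel_piece_bound:
  assumes "0 \<le> a" "a \<le> b" "b \<le> pi" "m > 0" "\<tau> \<ge> 0"
    and "\<And>\<alpha>. \<alpha> \<in> {a..b} \<Longrightarrow> \<bar>\<nu> - \<tau> * cos \<alpha>\<bar> \<ge> m"
  shows "norm (integral {a..b} (\<lambda>\<alpha>. exp (\<i> * complex_of_real (\<nu> * \<alpha> - \<tau> * sin \<alpha>)))) \<le> 4 / m"
proof (rule van_der_corput_first_derivative[where \<phi>' = "\<lambda>\<alpha>. \<nu> - \<tau> * cos \<alpha>" and \<phi>'' = "\<lambda>\<alpha>. \<tau> * sin \<alpha>"])
  show "0 \<le> \<tau> * sin x" if "x \<in> {a..b}" for x
    using assms that by (auto intro!: mult_nonneg_nonneg sin_ge_zero)
qed (use assms in \<open>auto intro!: derivative_eq_intros continuous_intros\<close>)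

lemma bessel_integrand_integrable:
  "(\<lambda>\<alpha>. exp (\<i> * complex_of_real (\<nu> * \<alpha> - \<tau> * sin \<alpha>))) integrable_on {a..b}"
  by (intro integrable_continuous_interval continuous_intros)

lemma bessel_piece_trivial:
  assumes "a \<le> b"
  shows "norm (integral {a..b} (\<lambda>\<alpha>. exp (\<i> * complex_of_real (\<nu> * \<alpha> - \<tau> * sin \<alpha>)))) \<le> b - a"
proof -
  have "continuous_on {a..b} (\<lambda>\<alpha>. exp (\<i> * complex_of_real (\<nu> * \<alpha> - \<tau> * sin \<alpha>)))"
    by (intro continuous_intros)
  from integral_bound[OF assms this, of 1] show ?thesis by (simp only: norm_exp_i_times) simp
qed

lemma bessel_integral_le_pi: "norm (bessel_integral \<nu> \<tau>) \<le> pi"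
  using bessel_piece_trivial[of 0 pi] by (simp add: bessel_integral_def)

text \<open>
  A \<open>\<delta>\<close>-neighbourhood of \<open>\<theta>\<close> is estimated by its length, the rest by van der Corput's lemma. The
  lower bound on the phase derivative is stated with \<open>\<alpha>\<^sup>2 - \<theta>\<^sup>2\<close> because the stationary point \<open>\<theta>\<close> merges with
  the endpoint \<open>0\<close>, where the second derivative of the phase vanishes, as \<open>\<nu> / \<tau>\<close> tends to \<open>1\<close>; the two
  alternatives in \<open>max \<theta> \<delta>\<close> are the nondegenerate and the degenerate case.
\<close>
lemma bessel_integral_split_bound:
  assumes \<tau>: "\<tau> > 0" and \<theta>: "\<theta> \<in> {0..pi}" and \<delta>: "\<delta> > 0"
    and low: "\<And>\<alpha>. \<alpha> \<in> {0..pi} \<Longrightarrow> \<bar>\<nu> - \<tau> * cos \<alpha>\<bar> \<ge> \<tau> * \<bar>\<alpha>\<^sup>2 - \<theta>\<^sup>2\<bar> / 32"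
  shows "norm (bessel_integral \<nu> \<tau>) \<le> 2 * \<delta> + 256 / (\<tau> * \<delta> * max \<theta> \<delta>)"
proof -
  let ?f = "\<lambda>\<alpha>. exp (\<i> * complex_of_real (\<nu> * \<alpha> - \<tau> * sin \<alpha>))"
  define m where "m = \<tau> * \<delta> * max \<theta> \<delta> / 32"
  define a where "a = max 0 (\<theta> - \<delta>)"
  define b where "b = min pi (\<theta> + \<delta>)"
  have m: "m > 0" using \<tau> \<delta> by (simp add: m_def)
  have ab: "0 \<le> a" "a \<le> b" "b \<le> pi" "b - a \<le> 2 * \<delta>"
    using \<theta> \<delta> by (auto simp: a_def b_def)
  have far: "\<bar>\<nu> - \<tau> * cos \<alpha>\<bar> \<ge> m" if "\<alpha> \<in> {0..pi}" "\<bar>\<alpha> - \<theta>\<bar> \<ge> \<delta>" for \<alpha>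
  proof -
    have "max \<theta> \<delta> \<le> \<alpha> + \<theta>" using that \<theta> by auto
    hence "\<delta> * max \<theta> \<delta> \<le> \<bar>\<alpha> - \<theta>\<bar> * (\<alpha> + \<theta>)"
      using that \<delta> \<theta> by (intro mult_mono) auto
    also have "\<dots> = \<bar>\<alpha>\<^sup>2 - \<theta>\<^sup>2\<bar>"
      using that \<theta> by (simp add: power2_eq_square square_diff_square_factored abs_mult mult.commute)
    finally have "\<tau> * (\<delta> * max \<theta> \<delta>) / 32 \<le> \<tau> * \<bar>\<alpha>\<^sup>2 - \<theta>\<^sup>2\<bar> / 32"
      using \<tau> by simp
    thus ?thesis using low[OF that(1)] by (simp add: m_def)
  qed
  have "bessel_integral \<nu> \<tau> = integral {0..a} ?f + integral {a..b} ?f + integral {b..pi} ?f"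
    unfolding bessel_integral_def
    using ab bessel_integrand_integrable
    by (simp add: Henstock_Kurzweil_Integration.integral_combine)
  moreover have "norm (integral {0..a} ?f) \<le> 4 / m"
  proof (cases "a = 0")
    case False
    thus ?thesis using ab m \<tau> \<theta> by (intro bessel_piece_bound far) (auto simp: a_def)
  qed (use m in auto)
  moreover have "norm (integral {b..pi} ?f) \<le> 4 / m"
  proof (cases "b = pi")
    case False
    thus ?thesis using ab m \<tau> \<theta> by (intro bessel_piece_bound far) (auto simp: b_def)
  qed (use m in auto)
  moreover have "norm (integral {a..b} ?f) \<le> b - a"
    by (rule bessel_piece_trivial) (rule ab)
  ultimately have "norm (bessel_integral \<nu> \<tau>) \<le> 4 / m + (b - a) + 4 / m"
    by (smt (verit) norm_triangle_ineq)
  also have "\<dots> \<le> 2 * \<delta> + 8 / m" using ab by simp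
  also have "8 / m = 256 / (\<tau> * \<delta> * max \<theta> \<delta>)" by (simp add: m_def)
  finally show ?thesis .
qed

lemma sin_ge_quarter:
  assumes "0 \<le> x" "x \<le> 3 * pi / 4"
  shows "sin x \<ge> x / 4"
proof -
  have "convex_on {0..pi} (\<lambda>x. - sin x)"
    by (rule f''_ge0_imp_convex[where f' = "\<lambda>x. - cos x" and f'' = sin])
       (auto intro!: derivative_eq_intros sin_ge_zero)
  from convex_onD[OF this, of "x / (3 * pi / 4)" 0 "3 * pi / 4"]
  have "sin x \<ge> x / (3 * pi / 4) * sin (3 * pi / 4)"
    using assms by (simp add: field_simps)
  also have "sin (3 * pi / 4) = sin (pi - pi / 4)"
    by (rule arg_cong[where f = sin]) (simp add: field_simps)
  also have "\<dots> = sqrt 2 / 2" by (simp only: sin_pi_minus sin_45)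
  finally have 1: "x / (3 * pi / 4) * (sqrt 2 / 2) \<le> sin x" .
  have "sqrt 2 \<ge> 1.4" by (rule real_le_rsqrt) (simp add: power2_eq_square)
  moreover have "pi \<le> 3.5" using pi_approx by simp
  ultimately have "3 * pi / 4 / 4 \<le> sqrt 2 / 2" by simp
  hence "x / (3 * pi / 4) * (3 * pi / 4 / 4) \<le> x / (3 * pi / 4) * (sqrt 2 / 2)"
    using assms by (intro mult_left_mono) auto
  with 1 show ?thesis by simp
qed

lemma cos_diff_lower:
  assumes \<theta>: "0 \<le> \<theta>" "\<theta> \<le> pi / 2" and \<alpha>: "0 \<le> \<alpha>" "\<alpha> \<le> pi"
  shows "\<bar>cos \<theta> - cos \<alpha>\<bar> \<ge> \<bar>\<alpha>\<^sup>2 - \<theta>\<^sup>2\<bar> / 32"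
proof -
  have 1: "sin ((\<theta> + \<alpha>) / 2) \<ge> (\<theta> + \<alpha>) / 2 / 4"
    using assms by (intro sin_ge_quarter) auto
  define y where "y = \<bar>\<alpha> - \<theta>\<bar>"
  have "\<bar>\<alpha> - \<theta>\<bar> \<le> pi" using assms by linarith
  hence "y \<le> pi" by (simp add: y_def)
  hence "y / 2 \<le> 3 * pi / 4" using pi_gt_zero by linarith
  moreover have "0 \<le> y / 2" by (simp add: y_def)
  ultimately have "sin (\<bar>\<alpha> - \<theta>\<bar> / 2) \<ge> \<bar>\<alpha> - \<theta>\<bar> / 2 / 4"
    unfolding y_def by (intro sin_ge_quarter)
  moreover have "\<bar>sin ((\<alpha> - \<theta>) / 2)\<bar> \<ge> sin (\<bar>\<alpha> - \<theta>\<bar> / 2)"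
  proof (cases "\<alpha> \<ge> \<theta>")
    case False
    hence "\<bar>\<alpha> - \<theta>\<bar> / 2 = - ((\<alpha> - \<theta>) / 2)" by (simp add: field_simps)
    thus ?thesis by (simp only: sin_minus)
  qed auto
  ultimately have 2: "\<bar>sin ((\<alpha> - \<theta>) / 2)\<bar> \<ge> \<bar>\<alpha> - \<theta>\<bar> / 8" by linarith
  have "\<bar>\<alpha>\<^sup>2 - \<theta>\<^sup>2\<bar> = (\<theta> + \<alpha>) * \<bar>\<alpha> - \<theta>\<bar>"
    using assms by (simp add: square_diff_square_factored power2_eq_square abs_mult add.commute mult.commute)
  hence "\<bar>\<alpha>\<^sup>2 - \<theta>\<^sup>2\<bar> / 32 = 2 * (((\<theta> + \<alpha>) / 8) * (\<bar>\<alpha> - \<theta>\<bar> / 8))" by simp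
  also have "\<dots> \<le> 2 * (\<bar>sin ((\<theta> + \<alpha>) / 2)\<bar> * \<bar>sin ((\<alpha> - \<theta>) / 2)\<bar>)"
    using 1 2 assms by (intro mult_left_mono mult_mono) auto
  also have "\<dots> = \<bar>cos \<theta> - cos \<alpha>\<bar>"
    by (simp add: cos_diff_cos abs_mult)
  finally show ?thesis .
qed

text \<open>
  For \<open>\<nu> \<le> \<tau>\<close> the phase is stationary at \<open>\<theta> = arccos (\<nu> / \<tau>)\<close>. For \<open>\<nu> > \<tau>\<close> it has no stationary point, and the
  point \<open>0\<close>, where its derivative is smallest, takes that role.
\<close>
lemma bessel_phase_turning_point:
  assumes "0 \<le> \<nu>" "0 < \<tau>"
  obtains \<theta> where "\<theta> \<in> {0..pi}"
    and "\<And>\<alpha>. \<alpha> \<in> {0..pi} \<Longrightarrow> \<bar>\<nu> - \<tau> * cos \<alpha>\<bar> \<ge> \<tau> * \<bar>\<alpha>\<^sup>2 - \<theta>\<^sup>2\<bar> / 32"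
    and "\<nu> \<le> \<tau> \<Longrightarrow> sqrt (\<tau>\<^sup>2 - \<nu>\<^sup>2) \<le> \<tau> * \<theta>"
proof (cases "\<nu> \<le> \<tau>")
  case True
  define \<theta> where "\<theta> = arccos (\<nu> / \<tau>)"
  have r: "0 \<le> \<nu> / \<tau>" "\<nu> / \<tau> \<le> 1" using True assms by auto
  have \<theta>: "0 \<le> \<theta>" "\<theta> \<le> pi / 2" "cos \<theta> = \<nu> / \<tau>"
    using r arccos_le_pi2[OF r] by (auto simp: \<theta>_def arccos_lbound)
  show thesis
  proof (rule that[of \<theta>])
    fix \<alpha> assume "\<alpha> \<in> {0..pi}"
    hence "\<tau> * (\<bar>\<alpha>\<^sup>2 - \<theta>\<^sup>2\<bar> / 32) \<le> \<tau> * \<bar>cos \<theta> - cos \<alpha>\<bar>"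
      using assms \<theta> by (intro mult_left_mono cos_diff_lower) auto
    also have "\<dots> = \<bar>\<tau> * (cos \<theta> - cos \<alpha>)\<bar>" using assms by (simp add: abs_mult)
    also have "\<tau> * (cos \<theta> - cos \<alpha>) = \<nu> - \<tau> * cos \<alpha>" using assms \<theta> by (simp add: algebra_simps)
    finally show "\<bar>\<nu> - \<tau> * cos \<alpha>\<bar> \<ge> \<tau> * \<bar>\<alpha>\<^sup>2 - \<theta>\<^sup>2\<bar> / 32" by simp
  next
    have "sqrt (\<tau>\<^sup>2 - \<nu>\<^sup>2) = \<tau> * sqrt (1 - (\<nu> / \<tau>)\<^sup>2)"
    proof -
      have "\<tau>\<^sup>2 - \<nu>\<^sup>2 = \<tau>\<^sup>2 * (1 - (\<nu> / \<tau>)\<^sup>2)" using assms by (simp add: power_divide field_simps)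
      thus ?thesis using assms by (simp add: real_sqrt_mult)
    qed
    also have "sqrt (1 - (\<nu> / \<tau>)\<^sup>2) = sin \<theta>"
      using \<theta> by (subst sin_cos_sqrt) (auto intro: sin_ge_zero)
    also have "\<tau> * sin \<theta> \<le> \<tau> * \<theta>"
      using assms \<theta> by (intro mult_left_mono sin_x_le_x) auto
    finally show "sqrt (\<tau>\<^sup>2 - \<nu>\<^sup>2) \<le> \<tau> * \<theta>" .
  qed (use \<theta> in auto)
next
  case False
  show thesis
  proof (rule that[of 0])
    fix \<alpha> assume \<alpha>: "\<alpha> \<in> {0..pi}"
    have "\<tau> * (\<bar>\<alpha>\<^sup>2 - 0\<^sup>2\<bar> / 32) \<le> \<tau> * \<bar>cos 0 - cos \<alpha>\<bar>"
      using assms \<alpha> by (intro mult_left_mono cos_diff_lower) auto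
    also have "\<dots> = \<tau> - \<tau> * cos \<alpha>" by (simp add: algebra_simps)
    also have "\<dots> \<le> \<bar>\<nu> - \<tau> * cos \<alpha>\<bar>" using False by linarith
    finally show "\<bar>\<nu> - \<tau> * cos \<alpha>\<bar> \<ge> \<tau> * \<bar>\<alpha>\<^sup>2 - 0\<^sup>2\<bar> / 32" by simp
  qed (use False in auto)
qed

text \<open>
  The choice \<open>\<delta> = \<tau>\<^sup>-\<^sup>1\<^sup>/\<^sup>3\<close> balances the two terms of the split bound in the degenerate case.
\<close>
lemma bessel_integral_cube_root_decay:
  assumes "0 \<le> \<nu>" "0 < \<tau>"
  shows "norm (bessel_integral \<nu> \<tau>) \<le> 258 * \<tau> powr (- 1 / 3)"
proof -
  obtain \<theta> where \<theta>: "\<theta> \<in> {0..pi}"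
    and low: "\<And>\<alpha>. \<alpha> \<in> {0..pi} \<Longrightarrow> \<bar>\<nu> - \<tau> * cos \<alpha>\<bar> \<ge> \<tau> * \<bar>\<alpha>\<^sup>2 - \<theta>\<^sup>2\<bar> / 32"
    using bessel_phase_turning_point[OF assms] by metis
  define \<delta> where "\<delta> = \<tau> powr (- 1 / 3)"
  have \<delta>: "\<delta> > 0" using assms by (simp add: \<delta>_def)
  have "\<tau> * (\<delta> * (\<delta> * \<delta>)) = 1"
    using assms by (simp add: \<delta>_def powr_mult_base flip: powr_add)
  hence cube: "1 / (\<tau> * \<delta> * \<delta>) = \<delta>"
    using assms \<delta> by (simp add: field_simps)
  have "norm (bessel_integral \<nu> \<tau>) \<le> 2 * \<delta> + 256 / (\<tau> * \<delta> * max \<theta> \<delta>)"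
    by (rule bessel_integral_split_bound[OF assms(2) \<theta> \<delta> low])
  also have "256 / (\<tau> * \<delta> * max \<theta> \<delta>) \<le> 256 / (\<tau> * \<delta> * \<delta>)"
    using assms \<delta> by (intro divide_left_mono mult_left_mono mult_pos_pos) auto
  also have "\<dots> = 256 * \<delta>" using cube by simp
  finally show ?thesis by (simp add: \<delta>_def)
qed

text \<open>
  Here the stationary point satisfies \<open>\<tau> \<theta> \<ge> (\<tau>\<^sup>2 - \<nu>\<^sup>2)\<^sup>1\<^sup>/\<^sup>2\<close>, and \<open>\<delta> = (\<tau>\<^sup>2 - \<nu>\<^sup>2)\<^sup>-\<^sup>1\<^sup>/\<^sup>4\<close> balances the
  two terms of the split bound in the nondegenerate case.
\<close>
lemma bessel_integral_oscillatory_decay: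
  assumes "0 \<le> \<nu>" "\<nu> < \<tau>"
  shows "norm (bessel_integral \<nu> \<tau>) \<le> 258 * (\<tau>\<^sup>2 - \<nu>\<^sup>2) powr (- 1 / 4)"
proof -
  have \<tau>: "\<tau> > 0" using assms by simp
  obtain \<theta> where \<theta>: "\<theta> \<in> {0..pi}"
    and low: "\<And>\<alpha>. \<alpha> \<in> {0..pi} \<Longrightarrow> \<bar>\<nu> - \<tau> * cos \<alpha>\<bar> \<ge> \<tau> * \<bar>\<alpha>\<^sup>2 - \<theta>\<^sup>2\<bar> / 32"
    and sq: "sqrt (\<tau>\<^sup>2 - \<nu>\<^sup>2) \<le> \<tau> * \<theta>"
    using bessel_phase_turning_point[OF assms(1) \<tau>] assms by (metis less_imp_le)
  define q where "q = \<tau>\<^sup>2 - \<nu>\<^sup>2"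
  have q: "q > 0" using assms by (simp add: q_def power_strict_mono)
  define \<delta> where "\<delta> = q powr (- 1 / 4)"
  have \<delta>: "\<delta> > 0" using q by (simp add: \<delta>_def)
  have "sqrt q * (\<delta> * \<delta>) = 1"
    using q by (simp add: \<delta>_def powr_half_sqrt[symmetric] flip: powr_add)
  hence sd: "1 / (\<delta> * sqrt q) = \<delta>"
    using q \<delta> by (simp add: field_simps)
  have "\<delta> * sqrt q \<le> \<delta> * (\<tau> * max \<theta> \<delta>)"
    using sq \<delta> \<tau> by (intro mult_left_mono) (auto simp: q_def intro: order_trans[OF _ mult_left_mono])
  hence le: "\<delta> * sqrt q \<le> \<tau> * \<delta> * max \<theta> \<delta>" by (simp add: mult_ac)
  have "norm (bessel_integral \<nu> \<tau>) \<le> 2 * \<delta> + 256 / (\<tau> * \<delta> * max \<theta> \<delta>)"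
    by (rule bessel_integral_split_bound[OF \<tau> \<theta> \<delta> low])
  also have "256 / (\<tau> * \<delta> * max \<theta> \<delta>) \<le> 256 / (\<delta> * sqrt q)"
    using \<tau> \<delta> q by (intro divide_left_mono le mult_pos_pos) auto
  also have "\<dots> = 256 * \<delta>" using sd by simp
  finally show ?thesis by (simp add: \<delta>_def q_def)
qed

lemma bessel_integral_nonstationary_decay:
  assumes "0 \<le> \<tau>" "\<tau> < \<nu>"
  shows "norm (bessel_integral \<nu> \<tau>) \<le> 4 / (\<nu> - \<tau>)"
  unfolding bessel_integral_def
proof (rule bessel_piece_bound)
  fix \<alpha> assume "\<alpha> \<in> {0..pi}"
  have "\<tau> * cos \<alpha> \<le> \<tau> * 1" using assms by (intro mult_left_mono) auto
  thus "\<nu> - \<tau> \<le> \<bar>\<nu> - \<tau> * cos \<alpha>\<bar>" using assms by linarith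
qed (use assms in auto)

text \<open>
  The three decay estimates merge into one in the variable \<open>u = |\<tau> - \<nu>| / r\<close>, the distance from the
  turning point in units of the width \<open>r = \<nu>\<^sup>1\<^sup>/\<^sup>3\<close> of the transition region: the cube root bound serves for
  \<open>u \<le> 1\<close>, and the other two on either side of it.
\<close>
lemma bessel_integral_transition_decay:
  assumes \<nu>: "1 \<le> \<nu>" and \<tau>: "\<nu> / 2 \<le> \<tau>"
  defines "r \<equiv> \<nu> powr (1 / 3)"
  shows "norm (bessel_integral \<nu> \<tau>) \<le> 1100 / r * (1 + \<bar>\<tau> - \<nu>\<bar> / r) powr (- 1 / 4)"
proof -
  have r: "r > 0" "r ^ 3 = \<nu>" using \<nu> by (auto simp: r_def powr_power)
  define u where "u = \<bar>\<tau> - \<nu>\<bar> / r"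
  have u0: "u \<ge> 0" using r by (simp add: u_def)
  have lowu: "1 / (1 + u) \<le> (1 + u) powr (- 1 / 4)"
  proof -
    have "(1 + u) powr (-1) \<le> (1 + u) powr (- 1 / 4)" using u0 by (intro powr_mono) auto
    thus ?thesis using u0 by (simp add: powr_minus_divide)
  qed
  have "norm (bessel_integral \<nu> \<tau>) \<le> 1100 / r * (1 + u) powr (- 1 / 4)"
  proof (cases "u \<le> 1")
    case True
    have "norm (bessel_integral \<nu> \<tau>) \<le> 258 * \<tau> powr (- 1 / 3)"
      using \<nu> \<tau> by (intro bessel_integral_cube_root_decay) auto
    also have "\<tau> powr (- 1 / 3) \<le> (\<nu> / 8) powr (- 1 / 3)"
      using \<nu> \<tau> by (intro powr_mono2') auto
    also have "(\<nu> / 8) powr (- 1 / 3) = 2 / r"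
    proof -
      have "(8::real) powr (1 / 3) = 2" using powr_powr[of 2 3 "1/3"] by simp
      thus ?thesis using \<nu> by (simp add: r_def powr_divide powr_minus_divide)
    qed
    also have "258 * (2 / r) = 516 / r * (2 * (1 / 2))" by simp
    also have "\<dots> \<le> 516 / r * (2 * (1 + u) powr (- 1 / 4))"
    proof -
      have "1 / 2 \<le> 1 / (1 + u)" using True u0 by (intro divide_left_mono) auto
      hence "1 / 2 \<le> (1 + u) powr (- 1 / 4)" using lowu by linarith
      thus ?thesis using r by (intro mult_left_mono) auto
    qed
    also have "\<dots> \<le> 1100 / r * (1 + u) powr (- 1 / 4)"
      using r by (simp add: divide_right_mono)
    finally show ?thesis by simp
  next
    case False
    hence u1: "u > 1" by simp
    have ur: "\<bar>\<tau> - \<nu>\<bar> = u * r" using r by (simp add: u_def)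
    show ?thesis
    proof (cases "\<tau> < \<nu>")
      case True
      have "norm (bessel_integral \<nu> \<tau>) \<le> 4 / (\<nu> - \<tau>)"
        using True \<nu> \<tau> by (intro bessel_integral_nonstationary_decay) auto
      also have "\<nu> - \<tau> = u * r" using True ur by simp
      also have "4 / (u * r) = 4 / r * (1 / u)" by simp
      also have "\<dots> \<le> 4 / r * (2 * (1 + u) powr (- 1 / 4))"
      proof -
        have "1 / u \<le> 2 * (1 / (1 + u))" using u1 by (simp add: field_simps)
        also have "\<dots> \<le> 2 * (1 + u) powr (- 1 / 4)" using lowu by simp
        finally show ?thesis using r by (intro mult_left_mono) auto
      qed
      also have "\<dots> \<le> 1100 / r * (1 + u) powr (- 1 / 4)"
        using r by (simp add: divide_right_mono)
      finally show ?thesis .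
    next
      case False
      with u1 ur r have gt: "\<tau> > \<nu>" by (smt (verit) mult_pos_pos)
      have "\<tau> - \<nu> = u * r" using gt ur by simp
      hence "\<nu> * (\<tau> - \<nu>) = r ^ 3 * (u * r)" using r by simp
      hence e: "\<nu> * (\<tau> - \<nu>) = r ^ 4 * u" by (simp add: power_def numeral_eq_Suc mult_ac)
      have "\<nu> * (\<tau> - \<nu>) \<le> (\<tau> + \<nu>) * (\<tau> - \<nu>)" using gt \<nu> by (intro mult_right_mono) auto
      hence "\<nu> * (\<tau> - \<nu>) \<le> \<tau>\<^sup>2 - \<nu>\<^sup>2" by (simp add: power2_eq_square algebra_simps)
      hence e2: "r ^ 4 * u \<le> \<tau>\<^sup>2 - \<nu>\<^sup>2" by (simp only: e)
      have "norm (bessel_integral \<nu> \<tau>) \<le> 258 * (\<tau>\<^sup>2 - \<nu>\<^sup>2) powr (- 1 / 4)"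
        using gt \<nu> by (intro bessel_integral_oscillatory_decay) auto
      also have "(\<tau>\<^sup>2 - \<nu>\<^sup>2) powr (- 1 / 4) \<le> (r ^ 4 * u) powr (- 1 / 4)"
        using r u1 e2 by (intro powr_mono2') auto
      also have "(r ^ 4 * u) powr (- 1 / 4) = 1 / r * u powr (- 1 / 4)"
      proof -
        have "(r ^ 4) powr (- 1 / 4) = r powr (-1)"
          using r powr_powr[of r 4 "- 1 / 4"] by (simp add: powr_numeral)
        thus ?thesis using r u1 by (simp add: powr_mult powr_minus_divide)
      qed
      also have "u powr (- 1 / 4) \<le> 2 * (1 + u) powr (- 1 / 4)"
      proof -
        have "u powr (- 1 / 4) \<le> ((1 + u) / 2) powr (- 1 / 4)"
          using u1 by (intro powr_mono2') auto
        also have "\<dots> = 2 powr (1 / 4) * (1 + u) powr (- 1 / 4)"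
          using u1 by (simp add: powr_divide powr_minus_divide)
        also have "\<dots> \<le> 2 powr 1 * (1 + u) powr (- 1 / 4)"
          by (intro mult_right_mono powr_mono) auto
        finally show ?thesis by simp
      qed
      finally have "norm (bessel_integral \<nu> \<tau>) \<le> 258 * (1 / r * (2 * (1 + u) powr (- 1 / 4)))"
        using r by (simp add: divide_right_mono)
      also have "\<dots> \<le> 1100 / r * (1 + u) powr (- 1 / 4)"
        using r by (simp add: divide_right_mono)
      finally show ?thesis .
    qed
  qed
  thus ?thesis by (simp add: u_def)
qed

lemma nn_integral_inverse_power_tail:
  "(\<integral>\<^sup>+x\<in>{0..}. ennreal ((1 + x) powr (- 5 / 4)) \<partial>lborel) = 4"
proof -
  have "(\<integral>\<^sup>+x\<in>{0..}. ennreal ((1 + x) powr (- 5 / 4)) \<partial>lborel)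
     = ennreal (0 - (- 4 * (1 + 0) powr (- 1 / 4)))"
  proof (rule nn_integral_FTC_atLeast)
    have "((\<lambda>x::real. - 4 * (1 + x) powr (- 1 / 4)) \<longlongrightarrow> - 4 * 0) at_top"
      by (intro tendsto_intros tendsto_neg_powr filterlim_tendsto_add_at_top[OF tendsto_const] filterlim_ident) auto
    thus "((\<lambda>x::real. - 4 * (1 + x) powr (- 1 / 4)) \<longlongrightarrow> 0) at_top"
      by (simp only: mult_zero_right)
  qed (auto intro!: derivative_eq_intros)
  thus ?thesis by simp
qed

lemma nn_integral_inverse_power_line:
  "(\<integral>\<^sup>+x. ennreal ((1 + \<bar>x\<bar>) powr (- 5 / 4)) \<partial>lborel) \<le> 8"
proof -
  let ?f = "\<lambda>x. ennreal ((1 + x) powr (- 5 / 4)) * indicator {0..} x"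
  have "(\<integral>\<^sup>+x. ennreal ((1 + \<bar>x\<bar>) powr (- 5 / 4)) \<partial>lborel) \<le> (\<integral>\<^sup>+x. ?f x + ?f (0 + (-1) * x) \<partial>lborel)"
    by (intro nn_integral_mono) (auto simp: indicator_def)
  also have "\<dots> = (\<integral>\<^sup>+x. ?f x \<partial>lborel) + (\<integral>\<^sup>+x. ?f (0 + (-1) * x) \<partial>lborel)"
    by (rule nn_integral_add) measurable
  also have "(\<integral>\<^sup>+x. ?f (0 + (-1) * x) \<partial>lborel) = (\<integral>\<^sup>+x. ?f x \<partial>lborel)"
    by (subst (2) nn_integral_real_affine[where c = "-1" and t = 0]) auto
  finally show ?thesis unfolding nn_integral_inverse_power_tail by simp
qed

lemma nn_integral_transition_window:
  assumes r: "r > 0"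
  shows "(\<integral>\<^sup>+\<tau>. ennreal (1 / r * (1 + \<bar>\<tau> - \<nu>\<bar> / r) powr (- 5 / 4)) \<partial>lborel) \<le> 8"
proof -
  have "(\<integral>\<^sup>+\<tau>. ennreal (1 / r * (1 + \<bar>\<tau> - \<nu>\<bar> / r) powr (- 5 / 4)) \<partial>lborel)
     = ennreal r * (\<integral>\<^sup>+x. ennreal (1 / r * (1 + \<bar>(\<nu> + r * x) - \<nu>\<bar> / r) powr (- 5 / 4)) \<partial>lborel)"
    using r by (subst nn_integral_real_affine[where c = r and t = \<nu>]) auto
  also have "\<dots> = (\<integral>\<^sup>+x. ennreal r * ennreal (1 / r * (1 + \<bar>(\<nu> + r * x) - \<nu>\<bar> / r) powr (- 5 / 4)) \<partial>lborel)"
    by (rule nn_integral_cmult[symmetric]) measurable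
  also have "\<dots> = (\<integral>\<^sup>+x. ennreal ((1 + \<bar>x\<bar>) powr (- 5 / 4)) \<partial>lborel)"
    using r by (intro nn_integral_cong) (simp add: ennreal_mult[symmetric] abs_mult)
  finally show ?thesis using nn_integral_inverse_power_line by simp
qed

lemma nn_integral_long_time:
  "(\<integral>\<^sup>+\<tau>\<in>{1..}. ennreal (\<tau> powr (- 7 / 6)) \<partial>lborel) = 6"
proof -
  have "(\<integral>\<^sup>+\<tau>\<in>{1..}. ennreal (\<tau> powr (- 7 / 6)) \<partial>lborel) = ennreal (0 - (- 6 * 1 powr (- 1 / 6)))"
  proof (rule nn_integral_FTC_atLeast[where F = "\<lambda>x. - 6 * x powr (- 1 / 6)"])
    have "((\<lambda>x::real. - 6 * x powr (- 1 / 6)) \<longlongrightarrow> - 6 * 0) at_top"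
      by (intro tendsto_intros tendsto_neg_powr filterlim_ident) auto
    thus "((\<lambda>x::real. - 6 * x powr (- 1 / 6)) \<longlongrightarrow> 0) at_top"
      by (simp only: mult_zero_right)
  qed (auto intro!: derivative_eq_intros)
  thus ?thesis by simp
qed

lemma bessel_integral_measurable [measurable]: "bessel_integral \<nu> \<in> borel_measurable borel"
proof -
  have "continuous_on UNIV (bessel_integral \<nu>)"
  proof -
    have "continuous_on UNIV (\<lambda>\<tau>. integral (cbox 0 pi) (\<lambda>\<alpha>. exp (\<i> * complex_of_real (\<nu> * \<alpha> - \<tau> * sin \<alpha>))))"
      by (rule integral_continuous_on_param) (auto intro!: continuous_intros simp: case_prod_beta)
    thus ?thesis by (simp add: bessel_integral_def[abs_def])
  qed
  thus ?thesis by (rule borel_measurable_continuous_onI)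
qed

text \<open>
  The four terms dominate the times \<open>\<tau> \<le> 1\<close>, the times before, after and around the turning point
  \<open>\<tau> = k\<close>. Each has an integral that is bounded in \<open>k\<close>. The exponent \<open>p\<close> is the one for which
  \<open>k powr p / r ^ d\<close> is the reciprocal of the width \<open>r\<close> of the transition region. The exponents \<open>- 7 / 6\<close> and \<open>- 5 / 4\<close> are
  \<open>p - d / 2\<close> and \<open>- d / 4\<close> at \<open>d = 5\<close>, and being below \<open>- 1\<close> they make the tails integrable.
\<close>
lemma bessel_power_pointwise:
  fixes d k :: nat and \<tau> :: real
  assumes d: "d \<ge> 5" and \<tau>: "\<tau> > 0"
  defines "p \<equiv> (real d - 1) / 3" and "r \<equiv> real k powr (1 / 3)"
  shows "\<tau> powr p * norm (bessel_integral (real k) \<tau>) ^ d \<le>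
      pi ^ d * indicator {0..1} \<tau>
    + (if k = 0 then 0 else 8 ^ d / real k * indicator {0..real k} \<tau>)
    + 516 ^ d * (\<tau> powr (- 7 / 6) * indicator {1..} \<tau>)
    + (if k = 0 then 0 else 2 powr p * 1100 ^ d * (1 / r * (1 + \<bar>\<tau> - real k\<bar> / r) powr (- 5 / 4)))"
    (is "?L \<le> ?a + ?b + ?c + ?e")
proof -
  let ?E = "norm (bessel_integral (real k) \<tau>)"
  have p: "p > 0" using d by (simp add: p_def)
  have nn: "?a \<ge> 0" "?b \<ge> 0" "?c \<ge> 0" "?e \<ge> 0" by (auto simp: r_def)
  consider "\<tau> \<le> 1 \<and> 2 * real k \<le> \<tau>" | "k \<ge> 1 \<and> \<tau> < real k / 2" | "\<tau> > 1 \<and> 2 * real k \<le> \<tau>"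
    | "k \<ge> 1 \<and> real k / 2 \<le> \<tau> \<and> \<tau> \<le> 2 * real k"
    using \<tau> by (cases "k = 0") force+
  thus ?thesis
  proof cases
    case 1
    have "\<tau> powr p * ?E ^ d \<le> 1 * pi ^ d"
    proof (intro mult_mono power_mono bessel_integral_le_pi)
      have "\<tau> powr p \<le> 1 powr p" using 1 \<tau> p by (intro powr_mono2) auto
      thus "\<tau> powr p \<le> 1" by simp
    qed auto
    also have "\<dots> = ?a" using 1 \<tau> by simp
    finally show ?thesis using nn by linarith
  next
    case 2
    have E: "?E \<le> 8 / real k"
    proof -
      have "?E \<le> 4 / (real k - \<tau>)" using 2 \<tau> by (intro bessel_integral_nonstationary_decay) auto
      also have "\<dots> \<le> 4 / (real k / 2)" using 2 by (intro divide_left_mono mult_pos_pos) auto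
      finally show ?thesis by simp
    qed
    have "\<tau> powr p * ?E ^ d \<le> real k powr p * (8 / real k) ^ d"
      using 2 \<tau> p E by (intro mult_mono power_mono powr_mono2) auto
    also have "\<dots> = 8 ^ d * real k powr (p - real d)"
      using 2 by (simp add: power_divide powr_diff powr_realpow)
    also have "\<dots> \<le> 8 ^ d * real k powr (- 1)"
      using 2 d by (intro mult_left_mono powr_mono) (auto simp: p_def field_simps)
    also have "\<dots> = ?b" using 2 \<tau> by (simp add: powr_minus_divide)
    finally show ?thesis using nn by linarith
  next
    case 3
    have k4: "\<tau>\<^sup>2 - (real k)\<^sup>2 \<ge> (\<tau> / 2)\<^sup>2"
    proof -
      have "(real k)\<^sup>2 \<le> (\<tau> / 2)\<^sup>2" using 3 by (intro power_mono) auto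
      moreover have "2 * (\<tau> / 2)\<^sup>2 \<le> \<tau>\<^sup>2" by (simp add: power2_eq_square)
      ultimately show ?thesis by linarith
    qed
    have "?E \<le> 258 * (\<tau>\<^sup>2 - (real k)\<^sup>2) powr (- 1 / 4)"
      using 3 by (intro bessel_integral_oscillatory_decay) auto
    also have "(\<tau>\<^sup>2 - (real k)\<^sup>2) powr (- 1 / 4) \<le> ((\<tau> / 2)\<^sup>2) powr (- 1 / 4)"
      using k4 \<tau> by (intro powr_mono2') auto
    also have "((\<tau> / 2)\<^sup>2) powr (- 1 / 4) = (\<tau> / 2) powr (- 1 / 2)"
      using \<tau> powr_powr[of "\<tau> / 2" 2 "- 1 / 4"] by (simp add: powr_numeral)
    also have "\<dots> = 2 powr (1 / 2) * \<tau> powr (- 1 / 2)"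
      using \<tau> by (simp add: powr_divide powr_minus_divide)
    also have "\<dots> \<le> 2 powr 1 * \<tau> powr (- 1 / 2)"
      by (intro mult_right_mono powr_mono) auto
    finally have E: "?E \<le> 516 * \<tau> powr (- 1 / 2)" by simp
    have "\<tau> powr p * ?E ^ d \<le> \<tau> powr p * (516 * \<tau> powr (- 1 / 2)) ^ d"
      using E by (intro mult_left_mono power_mono) auto
    also have "\<dots> = 516 ^ d * \<tau> powr (p - real d / 2)"
      using \<tau> by (simp add: power_mult_distrib powr_power powr_add[symmetric])
    also have "\<dots> \<le> 516 ^ d * \<tau> powr (- 7 / 6)"
      using 3 d by (intro mult_left_mono powr_mono) (auto simp: p_def field_simps)
    also have "\<dots> = ?c" using 3 by simp
    finally show ?thesis using nn by linarith
  next
    case 4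
    define X where "X = (1 + \<bar>\<tau> - real k\<bar> / r) powr (- 1 / 4)"
    have r: "r > 0" "r powr 3 = real k" using 4 by (auto simp: r_def powr_powr)
    have base: "1 + \<bar>\<tau> - real k\<bar> / r \<ge> 1" using r by simp
    have "?E \<le> 1100 / r * X"
      using bessel_integral_transition_decay[of "real k" \<tau>] 4 by (simp add: X_def r_def)
    hence "\<tau> powr p * ?E ^ d \<le> (2 * real k) powr p * (1100 / r * X) ^ d"
      using 4 \<tau> p by (intro mult_mono power_mono powr_mono2) auto
    also have "\<dots> = 2 powr p * 1100 ^ d * (real k powr p / r ^ d * X ^ d)"
      by (simp add: powr_mult power_mult_distrib power_divide)
    also have "real k powr p / r ^ d = 1 / r"
    proof -
      have "real k powr p = r powr (3 * p)" unfolding r(2)[symmetric] by (rule powr_powr)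
      also have "3 * p = real d - 1" by (simp add: p_def)
      finally have "real k powr p = r powr (real d - 1)" .
      thus ?thesis using r by (simp add: powr_diff powr_realpow)
    qed
    also have "2 powr p * 1100 ^ d * (1 / r * X ^ d) \<le> 2 powr p * 1100 ^ d * (1 / r * (1 + \<bar>\<tau> - real k\<bar> / r) powr (- 5 / 4))"
    proof -
      have "X ^ d = (1 + \<bar>\<tau> - real k\<bar> / r) powr (- (real d / 4))"
        using base by (simp add: X_def powr_power)
      also have "\<dots> \<le> (1 + \<bar>\<tau> - real k\<bar> / r) powr (- 5 / 4)"
        using base d by (intro powr_mono) auto
      finally show ?thesis using r by (intro mult_left_mono) auto
    qed
    also have "\<dots> = ?e" using 4 by simp
    finally show ?thesis using nn by linarith
  qed
qed

theorem bessel_power_time_integral: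
  fixes d :: nat
  assumes d: "d \<ge> 5"
  shows "\<exists>B\<ge>0. \<forall>k::nat. (\<integral>\<^sup>+\<tau>\<in>{0<..}. ennreal (\<tau> powr ((real d - 1) / 3) * norm (bessel_integral (real k) \<tau>) ^ d) \<partial>lborel) \<le> ennreal B"
proof -
  define p where "p = (real d - 1) / 3"
  define B where "B = pi ^ d + 8 ^ d + 516 ^ d * 6 + 2 powr p * 1100 ^ d * 8"
  have "(\<integral>\<^sup>+\<tau>\<in>{0<..}. ennreal (\<tau> powr p * norm (bessel_integral (real k) \<tau>) ^ d) \<partial>lborel) \<le> ennreal B" for k :: nat
  proof -
    define r where "r = real k powr (1 / 3)"
    define a where "a = (\<lambda>\<tau>. ennreal (pi ^ d) * indicator {0..1::real} \<tau>)"
    define b where "b = (\<lambda>\<tau>. ennreal (if k = 0 then 0 else 8 ^ d / real k) * indicator {0..real k} \<tau>)"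
    define c where "c = (\<lambda>\<tau>. ennreal (516 ^ d) * (ennreal (\<tau> powr (- 7 / 6)) * indicator {1..} \<tau>))"
    define e where "e = (\<lambda>\<tau>. ennreal (if k = 0 then 0 else 2 powr p * 1100 ^ d) * ennreal (1 / r * (1 + \<bar>\<tau> - real k\<bar> / r) powr (- 5 / 4)))"
    have [measurable]: "a \<in> borel_measurable borel" "b \<in> borel_measurable borel" "c \<in> borel_measurable borel" "e \<in> borel_measurable borel"
      unfolding a_def b_def c_def e_def by measurable
    have "(\<integral>\<^sup>+\<tau>\<in>{0<..}. ennreal (\<tau> powr p * norm (bessel_integral (real k) \<tau>) ^ d) \<partial>lborel)
       \<le> (\<integral>\<^sup>+\<tau>. a \<tau> + b \<tau> + c \<tau> + e \<tau> \<partial>lborel)"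
    proof (rule nn_integral_mono)
      fix \<tau> :: real
      show "ennreal (\<tau> powr p * norm (bessel_integral (real k) \<tau>) ^ d) * indicator {0<..} \<tau> \<le> a \<tau> + b \<tau> + c \<tau> + e \<tau>"
      proof (cases "\<tau> > 0")
        case True
        let ?a = "pi ^ d * indicator {0..1} \<tau>"
        let ?b = "if k = 0 then 0 else 8 ^ d / real k * indicator {0..real k} \<tau>"
        let ?c = "516 ^ d * (\<tau> powr (- 7 / 6) * indicator {1..} \<tau>)"
        let ?e = "if k = 0 then 0 else 2 powr p * 1100 ^ d * (1 / r * (1 + \<bar>\<tau> - real k\<bar> / r) powr (- 5 / 4))"
        have "ennreal (\<tau> powr p * norm (bessel_integral (real k) \<tau>) ^ d) \<le> ennreal (?a + ?b + ?c + ?e)"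
          unfolding p_def r_def by (intro ennreal_leI bessel_power_pointwise d True)
        also have "\<dots> = ennreal ?a + ennreal ?b + ennreal ?c + ennreal ?e"
          by (simp add: r_def)
        also have "ennreal ?a = a \<tau>" by (simp add: a_def indicator_def)
        also have "ennreal ?b = b \<tau>" by (simp add: b_def indicator_def)
        also have "ennreal ?c = c \<tau>" by (simp add: c_def indicator_def ennreal_mult)
        also have "ennreal ?e = e \<tau>" by (cases "k = 0") (simp_all add: e_def r_def ennreal_mult[symmetric])
        finally show ?thesis using True by simp
      qed auto
    qed
    also have "\<dots> = (\<integral>\<^sup>+\<tau>. a \<tau> \<partial>lborel) + (\<integral>\<^sup>+\<tau>. b \<tau> \<partial>lborel) + (\<integral>\<^sup>+\<tau>. c \<tau> \<partial>lborel) + (\<integral>\<^sup>+\<tau>. e \<tau> \<partial>lborel)"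
      by (simp add: nn_integral_add)
    also have "\<dots> \<le> ennreal (pi ^ d) + ennreal (8 ^ d) + ennreal (516 ^ d * 6) + ennreal (2 powr p * 1100 ^ d * 8)"
    proof (intro add_mono)
      show "(\<integral>\<^sup>+\<tau>. a \<tau> \<partial>lborel) \<le> ennreal (pi ^ d)"
        by (simp add: a_def nn_integral_cmult_indicator)
      show "(\<integral>\<^sup>+\<tau>. b \<tau> \<partial>lborel) \<le> ennreal (8 ^ d)"
        unfolding b_def by (subst nn_integral_cmult_indicator) (auto simp: ennreal_mult[symmetric])
      show "(\<integral>\<^sup>+\<tau>. c \<tau> \<partial>lborel) \<le> ennreal (516 ^ d * 6)"
        unfolding c_def by (subst nn_integral_cmult, measurable, unfold nn_integral_long_time) (simp add: ennreal_mult)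
      have "(\<integral>\<^sup>+\<tau>. e \<tau> \<partial>lborel) = ennreal (if k = 0 then 0 else 2 powr p * 1100 ^ d) *
         (\<integral>\<^sup>+\<tau>. ennreal (1 / r * (1 + \<bar>\<tau> - real k\<bar> / r) powr (- 5 / 4)) \<partial>lborel)"
        unfolding e_def by (rule nn_integral_cmult) measurable
      also have "\<dots> \<le> ennreal (2 powr p * 1100 ^ d) * 8"
      proof (cases "k = 0")
        case False
        hence "r > 0" by (simp add: r_def)
        from nn_integral_transition_window[OF this, of "real k"] show ?thesis
          using False by (auto intro!: mult_left_mono)
      qed auto
      also have "\<dots> = ennreal (2 powr p * 1100 ^ d * 8)" by (simp add: ennreal_mult)
      finally show "(\<integral>\<^sup>+\<tau>. e \<tau> \<partial>lborel) \<le> ennreal (2 powr p * 1100 ^ d * 8)" .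
    qed
    also have "\<dots> = ennreal B" by (simp add: B_def)
    finally show ?thesis .
  qed
  moreover have "B \<ge> 0" by (simp add: B_def)
  ultimately show ?thesis unfolding p_def by blast
qed

section \<open>Complex powers through the Gamma integral\<close>

lemma gamma_integral_scaled:
  assumes w: "Re w > 0" and a: "(a::real) > 0"
  shows "set_integrable lborel {0<..} (\<lambda>t. of_real t powr (w - 1) * exp (- (of_real (a * t))))" (is ?int)
    and "(LINT t:{0<..}|lborel. of_real t powr (w - 1) * exp (- (of_real (a * t)))) = Gamma w * of_real a powr (- w)"
proof -
  define G where "G = (\<lambda>t::real. indicator {0<..} t *\<^sub>R (complex_of_real t powr (w - 1) * exp (- of_real t)))"
  have cont: "continuous_on {0<..} (\<lambda>t::real. complex_of_real t powr (w - 1) * exp (- of_real (b * t)))" for b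
    by (intro continuous_intros) auto
  have int: "set_integrable lborel {0<..} (\<lambda>t. complex_of_real t powr (w - 1) * exp (- (of_real (b * t))))"
    if "b > 0" for b :: real
  proof -
    have "set_integrable lebesgue {0<..} (\<lambda>t. complex_of_real t powr (w - 1) / of_real (exp (b * t)))"
      by (rule absolutely_integrable_Gamma_integral[OF w that])
    hence "set_integrable lebesgue {0<..} (\<lambda>t. complex_of_real t powr (w - 1) * exp (- (of_real (b * t))))"
      by (simp add: exp_minus divide_inverse flip: exp_of_real)
    moreover have "(\<lambda>t. indicator {0<..} t *\<^sub>R (complex_of_real t powr (w - 1) * exp (- (of_real (b * t)))))
      \<in> borel_measurable lborel"
      using borel_measurable_continuous_on_indicator[OF _ cont] by simp
    ultimately show ?thesis
      unfolding set_integrable_def by (simp add: integrable_completion)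
  qed
  show ?int by (rule int[OF a])
  have "(LINT t:{0<..}|lborel. complex_of_real t powr (w - 1) * exp (- of_real t))
      = integral {0<..} (\<lambda>t. complex_of_real t powr (w - 1) * exp (- of_real t))"
    using int[of 1] by (intro set_borel_integral_eq_integral) simp
  also have "\<dots> = integral {0..} (\<lambda>t. complex_of_real t powr (w - 1) * exp (- of_real t))"
    by (rule integral_spike_set) (auto intro: negligible_subset[of "{0}"])
  also have "\<dots> = Gamma w"
    using Gamma_integral_complex[OF w]
    by (intro integral_unique) (simp add: exp_minus divide_inverse flip: exp_of_real)
  finally have G1: "integral\<^sup>L lborel G = Gamma w"
    by (simp add: G_def set_lebesgue_integral_def)
  have "integral\<^sup>L lborel G = \<bar>a\<bar> *\<^sub>R (\<integral>t. G (0 + a * t) \<partial>lborel)"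
    using a by (intro lborel_integral_real_affine) auto
  also have "(\<lambda>t. G (0 + a * t)) = (\<lambda>t. of_real a powr (w - 1) *
       (indicator {0<..} t *\<^sub>R (complex_of_real t powr (w - 1) * exp (- (of_real (a * t))))))"
    using a by (auto simp: G_def fun_eq_iff indicator_def powr_times_real zero_less_mult_iff)
  also have "(\<integral>t. \<dots> t \<partial>lborel) = of_real a powr (w - 1) *
       (LINT t:{0<..}|lborel. complex_of_real t powr (w - 1) * exp (- (of_real (a * t))))"
    by (simp only: set_lebesgue_integral_def integral_mult_right_zero)
  finally have "Gamma w = of_real a * of_real a powr (w - 1) *
       (LINT t:{0<..}|lborel. complex_of_real t powr (w - 1) * exp (- (of_real (a * t))))"
    using a by (simp add: G1 scaleR_conv_of_real mult_ac)
  also have "of_real a * of_real a powr (w - 1) = complex_of_real a powr w"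
    using a by (simp add: powr_diff)
  finally show "(LINT t:{0<..}|lborel. of_real t powr (w - 1) * exp (- (of_real (a * t)))) = Gamma w * of_real a powr (- w)"
    using a by (simp add: powr_minus field_simps)
qed

lemma gamma_integral_real_absolute:
  assumes "\<sigma> > 0" "(a::real) > 0"
  shows "set_integrable lborel {0<..} (\<lambda>t. t powr (\<sigma> - 1) * exp (- (a * t)))"
proof -
  have "set_integrable lborel {0<..} (\<lambda>t. norm (complex_of_real t powr (of_real \<sigma> - 1) * exp (- (of_real (a * t)))))"
    using assms by (intro set_integrable_norm gamma_integral_scaled(1)) auto
  also have "?this \<longleftrightarrow> ?thesis"
    by (intro set_integrable_cong) (auto simp: norm_mult norm_powr_real_powr)
  finally show ?thesis .
qed

text \<open>
  The right half-plane is the union of the discs \<open>|l - a| < a\<close>. Expanding the exponential around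
  \<open>exp (- a t)\<close> and integrating term by term turns the real formula at \<open>a\<close> into the binomial series of
  \<open>(1 + (l - a) / a) powr - w\<close>.
\<close>
lemma gamma_integral_rotated:
  assumes w: "Re w > 0" and l: "Re l > 0"
  shows "set_integrable lborel {0<..} (\<lambda>t. of_real t powr (w - 1) * exp (- (of_real t * l)))" (is ?int)
    and "(LINT t:{0<..}|lborel. of_real t powr (w - 1) * exp (- (of_real t * l))) = Gamma w * l powr (- w)" (is ?eq)
proof -
  \<comment> \<open>Any \<open>a > |l|\<^sup>2 / (2 Re l)\<close> gives a disc \<open>|l - a| < a\<close> that contains \<open>l\<close>.\<close>
  define a where "a = (norm l)\<^sup>2 / Re l"
  define \<nu> where "\<nu> = of_real a - l"
  have l0: "l \<noteq> 0" using l by auto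
  have a: "a > 0" using l l0 by (simp add: a_def)
  have mu: "norm \<nu> < a"
  proof -
    have "(norm \<nu>)\<^sup>2 = (a - Re l)\<^sup>2 + (Im l)\<^sup>2"
      by (simp add: \<nu>_def cmod_power2)
    also have "\<dots> = a\<^sup>2 + ((norm l)\<^sup>2 - 2 * a * Re l)"
      using cmod_power2[of l] by (simp add: power2_eq_square algebra_simps)
    also have "(norm l)\<^sup>2 - 2 * a * Re l = - (norm l)\<^sup>2" using l by (simp add: a_def)
    also have "a\<^sup>2 + - (norm l)\<^sup>2 < a\<^sup>2" using l0 by simp
    finally show ?thesis using a by (simp add: power2_less_imp_less)
  qed
  define f where "f = (\<lambda>k t. indicator {0<..} t *\<^sub>R (of_real t powr (w - 1) * exp (- (of_real (a * t))) * ((\<nu> * of_real t) ^ k / fact k)))"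
  have f_eq: "f k = (\<lambda>t. (\<nu> ^ k / fact k) *
      (indicator {0<..} t *\<^sub>R (of_real t powr ((w + of_nat k) - 1) * exp (- (of_real (a * t))))))" for k
  proof
    fix t :: real
    have "of_real t powr (w + of_nat k - 1) = complex_of_real t powr (w - 1) * of_real t ^ k" if "t > 0"
      using that powr_add[of "complex_of_real t" "w - 1" "of_nat k"] by (simp add: powr_nat algebra_simps)
    thus "f k t = (\<nu> ^ k / fact k) *
      (indicator {0<..} t *\<^sub>R (of_real t powr ((w + of_nat k) - 1) * exp (- (of_real (a * t)))))"
      by (cases "t > 0") (simp_all add: f_def power_mult_distrib)
  qed
  have wk: "Re (w + of_nat k) > 0" for k using w by simp
  have fint: "integrable lborel (f k)" for k
    unfolding f_eq
    using gamma_integral_scaled(1)[OF wk[of k] a] unfolding set_integrable_def by (rule integrable_mult_right)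
  have fval: "integral\<^sup>L lborel (f k) = (\<nu> ^ k / fact k) * (Gamma (w + of_nat k) * of_real a powr (- (w + of_nat k)))" for k
    unfolding f_eq
    using gamma_integral_scaled(2)[OF wk[of k] a]
    by (simp only: set_lebesgue_integral_def integral_mult_right_zero)
  have nf: "(\<lambda>k. norm (f k t)) sums (indicator {0<..} t * (t powr (Re w - 1) * exp (- ((a - norm \<nu>) * t))))" for t
  proof (cases "t > 0")
    case True
    have "(\<lambda>k. t powr (Re w - 1) * exp (- (a * t)) * ((norm \<nu> * t) ^ k / fact k)) sums
      (t powr (Re w - 1) * exp (- (a * t)) * exp (norm \<nu> * t))"
      using exp_converges[of "norm \<nu> * t"] by (intro sums_mult) (simp add: field_simps scaleR_conv_of_real)
    also have "t powr (Re w - 1) * exp (- (a * t)) * exp (norm \<nu> * t) = t powr (Re w - 1) * exp (- ((a - norm \<nu>) * t))"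
      by (simp add: exp_add[symmetric] algebra_simps)
    also have "(\<lambda>k. t powr (Re w - 1) * exp (- (a * t)) * ((norm \<nu> * t) ^ k / fact k)) = (\<lambda>k. norm (f k t))"
      using True by (simp add: f_def norm_mult norm_divide norm_power norm_powr_real_powr fun_eq_iff)
    finally show ?thesis using True by simp
  qed (auto simp: f_def)
  have f_sums: "(\<lambda>k. f k t) sums (indicator {0<..} t *\<^sub>R (of_real t powr (w - 1) * exp (- (of_real t * l))))" for t
  proof -
    have "(\<lambda>k. indicator {0<..} t *\<^sub>R (of_real t powr (w - 1) * exp (- (of_real (a * t))) * ((\<nu> * of_real t) ^ k / fact k)))
      sums (indicator {0<..} t *\<^sub>R (of_real t powr (w - 1) * exp (- (of_real (a * t))) * exp (\<nu> * of_real t)))"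
      using exp_converges[of "\<nu> * of_real t"]
      by (intro sums_scaleR_right sums_mult) (simp add: field_simps scaleR_conv_of_real)
    also have "of_real t powr (w - 1) * exp (- (of_real (a * t))) * exp (\<nu> * of_real t) =
       complex_of_real t powr (w - 1) * exp (- (of_real t * l))"
      by (simp add: \<nu>_def exp_add[symmetric] algebra_simps)
    finally show ?thesis by (simp add: f_def)
  qed
  define g where "g = (\<lambda>t::real. indicator {0<..} t * (t powr (Re w - 1) * exp (- ((a - norm \<nu>) * t))))"
  have gint: "integrable lborel g"
    using gamma_integral_real_absolute[of "Re w" "a - norm \<nu>"] w mu by (simp add: g_def set_integrable_def)
  have summ1: "AE t in lborel. summable (\<lambda>k. norm (f k t))"
    using nf by (auto simp: sums_iff)
  have summ2: "summable (\<lambda>k. \<integral>t. norm (f k t) \<partial>lborel)"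
  proof (rule bounded_imp_summable)
    show "0 \<le> (\<integral>t. norm (f k t) \<partial>lborel)" for k by simp
    show "(\<Sum>k\<le>n. \<integral>t. norm (f k t) \<partial>lborel) \<le> integral\<^sup>L lborel g" for n
    proof -
      have "(\<Sum>k\<le>n. \<integral>t. norm (f k t) \<partial>lborel) = (\<integral>t. (\<Sum>k\<le>n. norm (f k t)) \<partial>lborel)"
        using fint by (intro Bochner_Integration.integral_sum[symmetric]) auto
      also have "\<dots> \<le> integral\<^sup>L lborel g"
      proof (rule integral_mono)
        fix t :: real
        have "(\<Sum>k\<le>n. norm (f k t)) \<le> (\<Sum>k. norm (f k t))"
          using nf[of t] by (intro sum_le_suminf) (auto simp: sums_iff)
        thus "(\<Sum>k\<le>n. norm (f k t)) \<le> g t"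
          using nf[of t] by (simp add: g_def sums_iff)
      qed (use fint gint in auto)
      finally show ?thesis .
    qed
  qed
  have suminf_f: "(\<Sum>k. f k t) = indicator {0<..} t *\<^sub>R (of_real t powr (w - 1) * exp (- (of_real t * l)))" for t
    using f_sums sums_iff by blast
  show ?int
    using integrable_suminf[OF fint summ1 summ2] by (simp add: suminf_f set_integrable_def)
  have S: "(\<lambda>k. integral\<^sup>L lborel (f k)) sums (LINT t:{0<..}|lborel. of_real t powr (w - 1) * exp (- (of_real t * l)))"
    using sums_integral[OF fint summ1 summ2] by (simp add: suminf_f set_lebesgue_integral_def)
  have wn: "w \<notin> \<int>\<^sub>\<le>\<^sub>0" using w by (auto elim!: nonpos_Ints_cases)
  have coef: "integral\<^sup>L lborel (f k) = Gamma w * of_real a powr (- w) * (((- w) gchoose k) * (- \<nu> / of_real a) ^ k)" for k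
  proof -
    have 1: "Gamma (w + of_nat k) = Gamma w * pochhammer w k"
      using wn by (simp add: pochhammer_Gamma Gamma_eq_zero_iff)
    have 2: "of_real a powr (- (w + of_nat k)) = of_real a powr (- w) / complex_of_real a ^ k"
      using a by (simp add: powr_diff powr_nat)
    show ?thesis
      unfolding fval 1 2 gbinomial_pochhammer
      by (cases "even k") (simp_all add: power_divide field_simps)
  qed
  have "(\<lambda>k. integral\<^sup>L lborel (f k)) sums (Gamma w * of_real a powr (- w) * (1 + - \<nu> / of_real a) powr (- w))"
    unfolding coef using mu a
    by (intro sums_mult gen_binomial_complex) (simp add: norm_divide)
  moreover have "of_real a powr (- w) * (1 + - \<nu> / of_real a) powr (- w) = l powr (- w)"
  proof -
    define q where "q = 1 + - \<nu> / of_real a"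
    have l: "l = of_real a * q" using a by (simp add: q_def \<nu>_def field_simps)
    hence q: "q \<noteq> 0" using l0 by auto
    have "Ln l = of_real (ln a) + Ln q"
      unfolding l using a q Ln_of_real[OF a] by (simp add: Ln_times_of_real)
    thus ?thesis
      unfolding q_def[symmetric]
      using a q l0 Ln_of_real[OF a] by (simp add: powr_def exp_add[symmetric] algebra_simps)
  qed
  ultimately show ?eq
    using S sums_unique2 by (metis mult.assoc)
qed

text \<open>
  Compare Euler's products for \<open>\<sigma> + i y\<close> and \<open>\<sigma>\<close> factor by factor, using
  \<open>|\<sigma> + k + i y| \<le> (\<sigma> + k) exp (y\<^sup>2 / (2 (k + 1)\<^sup>2))\<close>. Gaussian growth is far from sharp, but it is what the
  three-lines theorem below tolerates.
\<close>
lemma norm_rGamma_le: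
  assumes s: "\<sigma> \<ge> 1"
  shows "norm (rGamma (Complex \<sigma> y)) \<le> rGamma \<sigma> * exp (y\<^sup>2)"
proof (rule LIMSEQ_le)
  show "(\<lambda>n. norm (rGamma_series (Complex \<sigma> y) n)) \<longlonglongrightarrow> norm (rGamma (Complex \<sigma> y))"
    by (intro tendsto_norm rGamma_series_LIMSEQ)
  show "(\<lambda>n. rGamma_series \<sigma> n * exp (y\<^sup>2)) \<longlonglongrightarrow> rGamma \<sigma> * exp (y\<^sup>2)"
    by (intro tendsto_intros rGamma_series_LIMSEQ)
  have key: "norm (pochhammer (Complex \<sigma> y) n) \<le> pochhammer \<sigma> n * exp (y\<^sup>2 / 2 * (\<Sum>k<n. 1 / (real k + 1)\<^sup>2))" for n
  proof (induction n)
    case (Suc n)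
    have "norm (Complex \<sigma> y + of_nat n) = sqrt ((\<sigma> + n)\<^sup>2 + y\<^sup>2)"
      by (simp add: cmod_def)
    also have "\<dots> \<le> (\<sigma> + n) * exp (y\<^sup>2 / 2 * (1 / (real n + 1)\<^sup>2))"
    proof (rule real_le_lsqrt)
      have "y\<^sup>2 / (\<sigma> + n)\<^sup>2 \<le> y\<^sup>2 / (real n + 1)\<^sup>2"
        using s by (intro divide_left_mono power_mono mult_pos_pos) auto
      hence "1 + y\<^sup>2 / (\<sigma> + n)\<^sup>2 \<le> exp (y\<^sup>2 / (real n + 1)\<^sup>2)"
        using exp_ge_add_one_self[of "y\<^sup>2 / (real n + 1)\<^sup>2"] by linarith
      hence "(\<sigma> + n)\<^sup>2 * (1 + y\<^sup>2 / (\<sigma> + n)\<^sup>2) \<le> (\<sigma> + n)\<^sup>2 * exp (y\<^sup>2 / (real n + 1)\<^sup>2)"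
        by (intro mult_left_mono) auto
      moreover have "(\<sigma> + n)\<^sup>2 * (1 + y\<^sup>2 / (\<sigma> + n)\<^sup>2) = (\<sigma> + n)\<^sup>2 + y\<^sup>2"
        using s by (simp add: distrib_left add_pos_nonneg less_imp_neq[symmetric])
      moreover have "((\<sigma> + n) * exp (y\<^sup>2 / 2 * (1 / (real n + 1)\<^sup>2)))\<^sup>2 = (\<sigma> + n)\<^sup>2 * exp (y\<^sup>2 / (real n + 1)\<^sup>2)"
        unfolding power_mult_distrib
        using exp_of_nat_mult[of 2 "y\<^sup>2 / 2 * (1 / (real n + 1)\<^sup>2)"] by simp
      ultimately show "(\<sigma> + n)\<^sup>2 + y\<^sup>2 \<le> ((\<sigma> + n) * exp (y\<^sup>2 / 2 * (1 / (real n + 1)\<^sup>2)))\<^sup>2" by simp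
    qed (use s in auto)
    finally have "norm (Complex \<sigma> y + of_nat n) \<le> (\<sigma> + n) * exp (y\<^sup>2 / 2 * (1 / (real n + 1)\<^sup>2))" .
    hence "norm (pochhammer (Complex \<sigma> y) n) * norm (Complex \<sigma> y + of_nat n) \<le>
       (pochhammer \<sigma> n * exp (y\<^sup>2 / 2 * (\<Sum>k<n. 1 / (real k + 1)\<^sup>2))) * ((\<sigma> + n) * exp (y\<^sup>2 / 2 * (1 / (real n + 1)\<^sup>2)))"
      using s by (intro mult_mono Suc.IH) (auto intro!: mult_nonneg_nonneg pochhammer_nonneg)
    also have "\<dots> = pochhammer \<sigma> (Suc n) * exp (y\<^sup>2 / 2 * (\<Sum>k<Suc n. 1 / (real k + 1)\<^sup>2))"
      by (simp only: pochhammer_Suc sum.lessThan_Suc distrib_left[of "y\<^sup>2 / 2"] exp_add mult_ac)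
    finally show ?case by (simp only: pochhammer_Suc norm_mult)
  qed auto
  have S: "(\<Sum>k<n. 1 / (real k + 1)\<^sup>2) \<le> 2" for n
  proof -
    have "(\<Sum>k<Suc n. 1 / (real k + 1)\<^sup>2) \<le> 2 - 1 / (real n + 1)" for n
    proof (induction n)
      case (Suc n)
      have "1 / (real n + 2)\<^sup>2 \<le> 1 / ((real n + 1) * (real n + 2))"
        by (intro divide_left_mono mult_pos_pos) (auto simp: power2_eq_square)
      also have "\<dots> = 1 / (real n + 1) - 1 / (real n + 2)"
        by (simp add: divide_simps)
      finally show ?case using Suc by (simp add: add_ac)
    qed auto
    from this[of "n - 1"] have "n > 0 \<Longrightarrow> ?thesis"
      by (cases n) (auto intro: order_trans)
    thus ?thesis by (cases n) auto
  qed
  show "\<exists>N. \<forall>n\<ge>N. norm (rGamma_series (Complex \<sigma> y) n) \<le> rGamma_series \<sigma> n * exp (y\<^sup>2)"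
  proof (intro exI allI impI)
    fix n :: nat assume "n \<ge> 1"
    have "norm (pochhammer (Complex \<sigma> y) (n + 1)) \<le> pochhammer \<sigma> (n + 1) * exp (y\<^sup>2 / 2 * (\<Sum>k<n+1. 1 / (real k + 1)\<^sup>2))"
      by (rule key)
    also have "\<dots> \<le> pochhammer \<sigma> (n + 1) * exp (y\<^sup>2)"
      using S[of "n + 1"] s mult_left_mono[OF S[of "n+1"], of "y\<^sup>2 / 2"]
      by (intro mult_left_mono pochhammer_nonneg) auto
    finally have *: "norm (pochhammer (Complex \<sigma> y) (n + 1)) \<le> pochhammer \<sigma> (n + 1) * exp (y\<^sup>2)" .
    have "norm (rGamma_series (Complex \<sigma> y) n) = norm (pochhammer (Complex \<sigma> y) (n + 1)) / (fact n * exp (\<sigma> * ln (real n)))"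
      by (simp add: rGamma_series_def norm_divide norm_mult)
    also have "\<dots> \<le> (pochhammer \<sigma> (n + 1) * exp (y\<^sup>2)) / (fact n * exp (\<sigma> * ln (real n)))"
      using * by (intro divide_right_mono) auto
    also have "\<dots> = rGamma_series \<sigma> n * exp (y\<^sup>2)"
      by (simp add: rGamma_series_def)
    finally show "norm (rGamma_series (Complex \<sigma> y) n) \<le> rGamma_series \<sigma> n * exp (y\<^sup>2)" .
  qed
qed

section \<open>A three-lines theorem\<close>

text \<open>
  The factor \<open>exp ((c + 1) z\<^sup>2)\<close> has modulus \<open>exp ((c + 1) (x\<^sup>2 - y\<^sup>2))\<close>. It turns the admitted growth into decay
  along the strip, at the price of a constant, so that the maximum principle applies on a rectangle
  of sufficient height.
\<close>
lemma three_lines_gaussian_growth: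
  fixes f :: "complex \<Rightarrow> complex"
  assumes hol: "f holomorphic_on UNIV" and M: "M > 0" and c: "c \<ge> 0" and K: "K \<ge> 0"
    and left: "\<And>y. norm (f (Complex 0 y)) \<le> M * exp (c * y\<^sup>2)"
    and right: "\<And>y. norm (f (Complex 1 y)) \<le> M * exp (c * y\<^sup>2)"
    and growth: "\<And>x y. 0 \<le> x \<Longrightarrow> x \<le> 1 \<Longrightarrow> norm (f (Complex x y)) \<le> K * exp (c * y\<^sup>2)"
    and t: "0 \<le> t" "t \<le> 1"
  shows "norm (f (of_real t)) \<le> M * exp (c + 1)"
proof -
  define g where "g = (\<lambda>z. f z * exp (of_real (c + 1) * z\<^sup>2))"
  \<comment> \<open>At this height \<open>K exp (- Y\<^sup>2) \<le> M\<close>.\<close>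
  define Y where "Y = sqrt (\<bar>ln ((K + 1) / M)\<bar>) + 1"
  define R where "R = cbox (Complex 0 (-Y)) (Complex 1 Y)"
  have Y: "Y > 0" "Y\<^sup>2 \<ge> ln ((K + 1) / M)"
  proof -
    have "ln ((K + 1) / M) \<le> (sqrt \<bar>ln ((K + 1) / M)\<bar>)\<^sup>2" by simp
    also have "\<dots> \<le> Y\<^sup>2" unfolding Y_def by (intro power_mono) auto
    finally show "Y\<^sup>2 \<ge> ln ((K + 1) / M)" .
  qed (simp add: Y_def add_nonneg_pos)
  have ng: "norm (g (Complex x y)) = norm (f (Complex x y)) * exp ((c + 1) * x\<^sup>2) * exp (- (c + 1) * y\<^sup>2)" for x y
    by (simp add: g_def norm_mult power2_eq_square exp_add[symmetric] algebra_simps)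
  have exp_split: "exp (c * y\<^sup>2) * exp (- (c + 1) * y\<^sup>2) = exp (- y\<^sup>2)" for y :: real
    by (simp add: exp_add[symmetric] algebra_simps)
  have side: "norm (g (Complex x y)) \<le> M * exp (c + 1)"
    if "x = 0 \<or> x = 1" for x y
  proof -
    have "norm (f (Complex x y)) \<le> M * exp (c * y\<^sup>2)" using that left right by auto
    hence "norm (g (Complex x y)) \<le> (M * exp (c * y\<^sup>2)) * exp (c + 1) * exp (- (c + 1) * y\<^sup>2)"
      unfolding ng using that c M by (intro mult_right_mono mult_mono) auto
    also have "\<dots> = M * exp (c + 1) * exp (- y\<^sup>2)"
      using exp_split[of y] by (simp add: mult_ac)
    also have "\<dots> \<le> M * exp (c + 1) * 1" using M by (intro mult_left_mono) auto
    finally show ?thesis by simp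
  qed
  have top: "norm (g (Complex x y)) \<le> M * exp (c + 1)" if "0 \<le> x" "x \<le> 1" "\<bar>y\<bar> = Y" for x y
  proof -
    have x2: "x\<^sup>2 \<le> 1" using that by (simp add: power_le_one)
    have "(c + 1) * x\<^sup>2 \<le> c + 1" using mult_left_mono[OF x2, of "c + 1"] c by simp
    hence "norm (g (Complex x y)) \<le> (K * exp (c * y\<^sup>2)) * exp (c + 1) * exp (- (c + 1) * y\<^sup>2)"
      unfolding ng using that growth[OF that(1,2), of y] K by (intro mult_right_mono mult_mono) auto
    also have "\<dots> = exp (c + 1) * (K * exp (- y\<^sup>2))"
      using exp_split[of y] by (simp add: mult_ac)
    also have "K * exp (- y\<^sup>2) \<le> M"
    proof -
      have "exp (- y\<^sup>2) \<le> exp (- ln ((K + 1) / M))"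
        using Y(2) that(3) by (metis exp_le_cancel_iff neg_le_iff_le power2_abs)
      also have "\<dots> = M / (K + 1)" using M K by (simp add: exp_minus)
      finally have "K * exp (- y\<^sup>2) \<le> K * (M / (K + 1))" using K by (rule mult_left_mono)
      also have "\<dots> \<le> M" using K M by (simp add: field_simps)
      finally show ?thesis .
    qed
    finally show ?thesis by (simp add: mult_ac)
  qed
  have "norm (g (of_real t)) \<le> M * exp (c + 1)"
  proof (rule maximum_modulus_frontier[of g R])
    show "g holomorphic_on interior R"
      unfolding g_def by (intro holomorphic_intros holomorphic_on_subset[OF hol]) auto
    show "continuous_on (closure R) g"
      unfolding g_def
      by (intro continuous_intros holomorphic_on_imp_continuous_on holomorphic_on_subset[OF hol]) auto
    show "bounded R" by (simp add: R_def)
    show "of_real t \<in> R" using t Y by (auto simp: R_def in_cbox_complex_iff)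
    fix z assume "z \<in> frontier R"
    hence z: "z \<in> R" "z \<notin> box (Complex 0 (-Y)) (Complex 1 Y)"
      by (auto simp: R_def frontier_cbox)
    define x y where "x = Re z" and "y = Im z"
    have zxy: "z = Complex x y" by (simp add: x_def y_def)
    from z have "0 \<le> x" "x \<le> 1" "-Y \<le> y" "y \<le> Y" "x = 0 \<or> x = 1 \<or> \<bar>y\<bar> = Y"
      by (auto simp: R_def in_cbox_complex_iff in_box_complex_iff x_def y_def)
    thus "norm (g z) \<le> M * exp (c + 1)"
      unfolding zxy using side top by blast
  qed
  moreover have "norm (f (of_real t)) \<le> norm (g (of_real t))"
    using ng[of t 0] c by (simp add: complex_of_real_def[symmetric] Complex_eq mult_left_le mult_le_cancel_left1)
  ultimately show ?thesis by linarith
qed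

section \<open>Interpolation of complex powers of a multiplier\<close>

definition multiplier_kernel :: "(real ^ 'd::finite \<Rightarrow> complex) \<Rightarrow> int ^ 'd \<Rightarrow> complex" where
  "multiplier_kernel m n = (LINT \<xi>|torus_measure. m \<xi> * character n \<xi>)"

abbreviation weighted_form :: "(int ^ 'd \<Rightarrow> complex) \<Rightarrow> (int ^ 'd \<Rightarrow> real) \<Rightarrow> (int ^ 'd) set \<Rightarrow> (int ^ 'd) set
    \<Rightarrow> (int ^ 'd \<Rightarrow> complex) \<Rightarrow> (int ^ 'd \<Rightarrow> complex) \<Rightarrow> complex" where
  "weighted_form K v A B a b \<equiv> (\<Sum>m\<in>A. \<Sum>n\<in>B. a m * of_real (v m) * K (m - n) * of_real (v n) * b n)"

lemma multiplier_kernel_le: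
  fixes m :: "real ^ 'd::finite \<Rightarrow> complex"
  assumes [measurable]: "m \<in> borel_measurable borel" and b: "\<And>\<xi>. norm (m \<xi>) \<le> S"
  shows "norm (multiplier_kernel m n) \<le> S"
proof -
  have "norm (multiplier_kernel m n) \<le> (LINT \<xi>|torus_measure. norm (m \<xi> * character n \<xi>))"
    unfolding multiplier_kernel_def by (rule integral_norm_bound)
  also have "\<dots> \<le> (LINT \<xi>|(torus_measure :: (real ^ 'd) measure). S)"
    by (intro integral_mono' torus.integrable_const) (auto simp: norm_mult b intro: order_trans[OF norm_ge_zero b])
  also have "\<dots> = S" using emeasure_torus[where 'd = 'd] by (simp add: measure_def)
  finally show ?thesis .
qed

text \<open>
  Insert the Gamma integral for \<open>l powr - w\<close> and exchange it with the integral over the torus: the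
  kernel of the power is a superposition of the kernels of \<open>exp (- t l)\<close>.
\<close>
lemma power_kernel_from_semigroup:
  fixes l :: "real ^ 'd::finite \<Rightarrow> complex"
  assumes l [measurable]: "l \<in> borel_measurable borel" and e: "e > 0" and re: "\<And>\<xi>. Re (l \<xi>) \<ge> e"
    and w: "Re w > 0" and P [measurable]: "P \<in> borel_measurable borel"
    and q: "\<And>t. t > 0 \<Longrightarrow> norm (multiplier_kernel (\<lambda>\<xi>. exp (- (of_real t * l \<xi>))) n) \<le> exp (- (t * e)) * P t"
    and B: "(\<integral>\<^sup>+t\<in>{0<..}. ennreal (t powr (Re w - 1) * (exp (- (t * e)) * P t)) \<partial>lborel) \<le> ennreal B" "B \<ge> 0"
  shows "norm (multiplier_kernel (\<lambda>\<xi>. l \<xi> powr (- w)) n) \<le> norm (rGamma w) * B"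
proof -
  let ?T = "torus_measure :: (real ^ 'd) measure"
  let ?k = "\<lambda>t \<xi>. indicator {0<..} t *\<^sub>R (of_real t powr (w - 1) * exp (- (of_real t * l \<xi>)))"
  have G: "Gamma w \<noteq> 0" using w by (auto simp: Gamma_eq_zero_iff elim!: nonpos_Ints_cases)
  interpret pair_sigma_finite ?T lborel
    by (intro pair_sigma_finite.intro torus.sigma_finite_measure_axioms lborel.sigma_finite_measure_axioms)
  have [measurable]: "l \<in> borel_measurable ?T" "character n \<in> borel_measurable ?T"
    by measurable
  have meas: "(\<lambda>(\<xi>, t). ?k t \<xi> * character n \<xi>) \<in> borel_measurable (?T \<Otimes>\<^sub>M lborel)"
    unfolding case_prod_beta by measurable
  let ?g = "\<lambda>t. indicator {0<..} t *\<^sub>R (t powr (Re w - 1) * exp (- (e * t)))"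
  have g: "integrable lborel ?g"
    using gamma_integral_real_absolute[OF w e] by (simp add: set_integrable_def)
  have int: "integrable (?T \<Otimes>\<^sub>M lborel) (\<lambda>(\<xi>, t). ?k t \<xi> * character n \<xi>)"
  proof (rule integrableI_bounded[OF meas])
    have "(\<integral>\<^sup>+p. ennreal (norm (case p of (\<xi>, t) \<Rightarrow> ?k t \<xi> * character n \<xi>)) \<partial>(?T \<Otimes>\<^sub>M lborel))
       = (\<integral>\<^sup>+\<xi>. \<integral>\<^sup>+t. ennreal (norm (?k t \<xi> * character n \<xi>)) \<partial>lborel \<partial>?T)"
      using meas by (subst lborel.nn_integral_fst[symmetric]) auto
    also have "\<dots> \<le> (\<integral>\<^sup>+\<xi>. \<integral>\<^sup>+t. ennreal (?g t) \<partial>lborel \<partial>?T)"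
    proof (intro nn_integral_mono ennreal_leI)
      fix \<xi> :: "real ^ 'd" and t :: real
      show "norm (?k t \<xi> * character n \<xi>) \<le> ?g t"
      proof (cases "t > 0")
        case True
        hence "e * t \<le> t * Re (l \<xi>)" using re[of \<xi>] by simp
        thus ?thesis using True
          by (auto simp: norm_mult norm_powr_real_powr intro!: mult_left_mono)
      qed auto
    qed
    also have "\<dots> = ennreal (integral\<^sup>L lborel ?g)"
    proof -
      have "(\<integral>\<^sup>+t. ennreal (?g t) \<partial>lborel) = ennreal (integral\<^sup>L lborel ?g)"
        by (rule nn_integral_eq_integral[OF g]) auto
      thus ?thesis using emeasure_torus[where 'd = 'd] by simp
    qed
    also have "\<dots> < \<infinity>" by simp
    finally show "(\<integral>\<^sup>+p. ennreal (norm (case p of (\<xi>, t) \<Rightarrow> ?k t \<xi> * character n \<xi>)) \<partial>(?T \<Otimes>\<^sub>M lborel)) < \<infinity>" .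
  qed
  have "Gamma w * multiplier_kernel (\<lambda>\<xi>. l \<xi> powr (- w)) n = (LINT \<xi>|?T. (LINT t|lborel. ?k t \<xi> * character n \<xi>))"
  proof -
    have "(LINT t|lborel. ?k t \<xi> * character n \<xi>) = Gamma w * (l \<xi> powr (- w) * character n \<xi>)" for \<xi>
      using gamma_integral_rotated(2)[OF w less_le_trans[OF e re[of \<xi>]]]
      by (simp only: set_lebesgue_integral_def integral_mult_left_zero) simp
    thus ?thesis by (simp add: multiplier_kernel_def)
  qed
  also have "\<dots> = (LINT t|lborel. (LINT \<xi>|?T. ?k t \<xi> * character n \<xi>))"
    by (rule Fubini_integral[symmetric]) (rule int)
  also have "\<dots> = (LINT t|lborel. indicator {0<..} t *\<^sub>R (of_real t powr (w - 1) * multiplier_kernel (\<lambda>\<xi>. exp (- (of_real t * l \<xi>))) n))"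
    by (simp add: multiplier_kernel_def mult.assoc)
  finally have eq: "Gamma w * multiplier_kernel (\<lambda>\<xi>. l \<xi> powr (- w)) n = \<dots>" .
  have int2: "integrable lborel (\<lambda>t. indicator {0<..} t *\<^sub>R (of_real t powr (w - 1) * multiplier_kernel (\<lambda>\<xi>. exp (- (of_real t * l \<xi>))) n))"
    using integrable_snd[OF int] by (simp add: multiplier_kernel_def mult.assoc)
  have "ennreal (norm (Gamma w * multiplier_kernel (\<lambda>\<xi>. l \<xi> powr (- w)) n))
     \<le> (\<integral>\<^sup>+t. norm (indicator {0<..} t *\<^sub>R (of_real t powr (w - 1) * multiplier_kernel (\<lambda>\<xi>. exp (- (of_real t * l \<xi>))) n)) \<partial>lborel)"
    unfolding eq by (rule integral_norm_bound_ennreal[OF int2])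
  also have "\<dots> \<le> (\<integral>\<^sup>+t\<in>{0<..}. ennreal (t powr (Re w - 1) * (exp (- (t * e)) * P t)) \<partial>lborel)"
  proof (rule nn_integral_mono)
    fix t :: real
    show "ennreal (norm (indicator {0<..} t *\<^sub>R (of_real t powr (w - 1) * multiplier_kernel (\<lambda>\<xi>. exp (- (of_real t * l \<xi>))) n)))
       \<le> ennreal (t powr (Re w - 1) * (exp (- (t * e)) * P t)) * indicator {0<..} t"
    proof (cases "t > 0")
      case True
      thus ?thesis using q[OF True]
        by (auto simp: norm_mult norm_powr_real_powr intro!: mult_left_mono ennreal_leI)
    qed auto
  qed
  also have "\<dots> \<le> ennreal B" by (rule B(1))
  finally have "norm (Gamma w * multiplier_kernel (\<lambda>\<xi>. l \<xi> powr (- w)) n) \<le> B"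
    using B(2) by simp
  hence "norm (Gamma w) * norm (multiplier_kernel (\<lambda>\<xi>. l \<xi> powr (- w)) n) \<le> B"
    by (simp add: norm_mult)
  hence "norm (rGamma w) * (norm (Gamma w) * norm (multiplier_kernel (\<lambda>\<xi>. l \<xi> powr (- w)) n)) \<le> norm (rGamma w) * B"
    by (rule mult_left_mono) simp
  moreover have "norm (rGamma w) * norm (Gamma w) = 1"
    using G by (simp add: rGamma_inverse_Gamma norm_inverse)
  ultimately show ?thesis by (simp add: mult.assoc[symmetric])
qed

text \<open>
  Closing up the half-open torus changes it by a null set. On the closed cube one can differentiate
  under the integral sign.
\<close>
lemma multiplier_kernel_cbox:
  fixes m :: "real ^ 'd::finite \<Rightarrow> complex"
  assumes c: "continuous_on UNIV m" and b: "\<And>\<xi>. norm (m \<xi>) \<le> S"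
  shows "multiplier_kernel m n = integral (cbox (\<chi> i. -1/2) (\<chi> i. 1/2)) (\<lambda>\<xi>. m \<xi> * character n \<xi>)"
proof -
  let ?C = "cbox (\<chi> i. -1/2) (\<chi> i. 1/2) :: (real ^ 'd) set" and ?O = "box (\<chi> i. -1/2) (\<chi> i. 1/2) :: (real ^ 'd) set"
  have "integrable torus_measure (\<lambda>\<xi>. m \<xi> * character n \<xi>)"
    by (rule torus_continuous_integrable[of _ S]) (auto intro!: continuous_intros c simp: norm_mult b)
  hence "set_integrable lborel torus (\<lambda>\<xi>. m \<xi> * character n \<xi>)"
    by (simp add: set_integrable_def integrable_restrict_space)
  hence "multiplier_kernel m n = integral torus (\<lambda>\<xi>. m \<xi> * character n \<xi>)"
    by (simp add: set_borel_integral_eq_integral(2)[symmetric] multiplier_kernel_def set_lebesgue_integral_def integral_restrict_space)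
  also have "\<dots> = integral ?C (\<lambda>\<xi>. m \<xi> * character n \<xi>)"
  proof (rule integral_spike_set)
    have neg: "negligible (?C - ?O)" by (rule negligible_frontier_interval)
    have "torus \<subseteq> ?C" "?O \<subseteq> torus"
      by (auto simp: torus_def mem_box_cart less_imp_le)
    thus "negligible {x \<in> torus - ?C. m x * character n x \<noteq> 0}" "negligible {x \<in> ?C - torus. m x * character n x \<noteq> 0}"
      by (auto intro!: negligible_subset[OF neg])
  qed
  finally show ?thesis .
qed

lemma multiplier_kernel_powr_holomorphic:
  fixes l :: "real ^ 'd::finite \<Rightarrow> complex"
  assumes l: "continuous_on UNIV l" and re: "\<And>\<xi>. Re (l \<xi>) > 0"
    and b: "\<And>\<zeta> \<xi>. norm (l \<xi> powr (- (of_real \<eta> + of_real \<sigma> * \<zeta>))) \<le> S \<zeta>"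
  shows "(\<lambda>\<zeta>. multiplier_kernel (\<lambda>\<xi>. l \<xi> powr (- (of_real \<eta> + of_real \<sigma> * \<zeta>))) n) holomorphic_on UNIV"
proof -
  let ?a = "(\<chi> i. -1/2) :: real ^ 'd" and ?b = "(\<chi> i. 1/2) :: real ^ 'd"
  define f where "f = (\<lambda>\<zeta> \<xi>. exp (- (of_real \<eta> + of_real \<sigma> * \<zeta>) * Ln (l \<xi>)) * character n \<xi>)"
  have nz: "l \<xi> \<noteq> 0" "l \<xi> \<notin> \<real>\<^sub>\<le>\<^sub>0" for \<xi>
    using re[of \<xi>] by (auto simp: complex_nonpos_Reals_iff)
  have powr: "l \<xi> powr (- (of_real \<eta> + of_real \<sigma> * \<zeta>)) = exp (- (of_real \<eta> + of_real \<sigma> * \<zeta>) * Ln (l \<xi>))" for \<xi> \<zeta>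
    using nz by (simp add: powr_def)
  have cont: "continuous_on UNIV (\<lambda>\<xi>. l \<xi> powr (- (of_real \<eta> + of_real \<sigma> * \<zeta>)))" for \<zeta>
    unfolding powr using nz by (intro continuous_intros l) auto
  have eq: "multiplier_kernel (\<lambda>\<xi>. l \<xi> powr (- (of_real \<eta> + of_real \<sigma> * \<zeta>))) n = integral (cbox ?a ?b) (f \<zeta>)" for \<zeta>
    unfolding f_def powr[symmetric] by (rule multiplier_kernel_cbox[OF cont b])
  have "(\<lambda>\<zeta>. integral (cbox ?a ?b) (f \<zeta>)) holomorphic_on UNIV"
  proof (rule leibniz_rule_holomorphic)
    show "((\<lambda>\<zeta>. f \<zeta> \<xi>) has_field_derivative - of_real \<sigma> * Ln (l \<xi>) * f \<zeta> \<xi>) (at \<zeta> within UNIV)" for \<zeta> \<xi>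
      unfolding f_def by (auto intro!: derivative_eq_intros simp: algebra_simps)
    show "f \<zeta> integrable_on cbox ?a ?b" for \<zeta>
      unfolding f_def
      by (intro integrable_continuous continuous_intros continuous_on_subset[OF l]) (use nz in auto)
    have "continuous_on (UNIV \<times> cbox ?a ?b) (\<lambda>x. l (snd x))"
      by (rule continuous_on_compose2[OF l]) (auto intro!: continuous_intros)
    hence "continuous_on (UNIV \<times> cbox ?a ?b) (\<lambda>x. - of_real \<sigma> * Ln (l (snd x)) * f (fst x) (snd x))"
      unfolding f_def using nz by (intro continuous_intros) auto
    thus "continuous_on (UNIV \<times> cbox ?a ?b) (\<lambda>(\<zeta>, \<xi>). - of_real \<sigma> * Ln (l \<xi>) * f \<zeta> \<xi>)"
      by (simp add: case_prod_beta)
  qed auto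
  thus ?thesis by (simp only: eq)
qed

lemma norm_powr_right_half_plane:
  assumes "Re z > 0"
  shows "norm (z powr (- w)) \<le> norm z powr (- Re w) * exp (pi * \<bar>Im w\<bar>)"
proof -
  have z: "z \<noteq> 0" using assms by auto
  have "norm (z powr (- w)) = exp (- Re w * ln (norm z) + Im w * Im (Ln z))"
    using z by (simp add: powr_def algebra_simps)
  also have "\<dots> = norm z powr (- Re w) * exp (Im w * Im (Ln z))"
    using z by (simp add: powr_def flip: exp_add)
  also have "\<dots> \<le> norm z powr (- Re w) * exp (pi * \<bar>Im w\<bar>)"
  proof -
    have "\<bar>Im (Ln z)\<bar> \<le> pi" using z mpi_less_Im_Ln[of z] Im_Ln_le_pi[of z] by linarith
    hence "\<bar>Im w\<bar> * \<bar>Im (Ln z)\<bar> \<le> \<bar>Im w\<bar> * pi" by (intro mult_left_mono) auto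
    hence "Im w * Im (Ln z) \<le> pi * \<bar>Im w\<bar>" by (metis abs_le_D1 abs_mult mult.commute)
    thus ?thesis by (intro mult_left_mono) auto
  qed
  finally show ?thesis .
qed

lemma of_real_powr_holomorphic: "(\<lambda>\<zeta>. complex_of_real x powr \<zeta>) holomorphic_on A"
  by (cases "x = 0") (auto simp: powr_def intro!: holomorphic_intros)

text \<open>
  Stein interpolation for the family \<open>W\<^sup>\<zeta> l powr - (\<eta> + s\<^sub>0 \<zeta>) W\<^sup>\<zeta>\<close> in the strip \<open>0 \<le> Re \<zeta> \<le> 1\<close>.
  For \<open>Re \<zeta> = 0\<close> the weights have modulus at most one and the power is a multiplier of size \<open>\<delta> powr - \<eta>\<close>. For
  \<open>Re \<zeta> = 1\<close> the kernel is bounded by a multiple of \<open>\<delta> powr - \<eta>\<close>: the factor \<open>exp (- t \<delta> / 2)\<close> absorbs the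
  additional power \<open>t powr \<eta>\<close>. Two applications of Cauchy-Schwarz with \<open>\<Sum> W\<^sup>2 \<le> 1\<close> then bound the form, and because of
  this normalisation a single constant serves both boundary lines. At \<open>\<zeta> = 1 / s\<close> the power is the first one,
  since \<open>\<eta> + s\<^sub>0 / s = 1\<close>.
\<close>
lemma interpolated_form_bound:
  fixes l :: "real ^ 'd::finite \<Rightarrow> complex" and a b :: "int ^ 'd \<Rightarrow> complex" and W :: "int ^ 'd \<Rightarrow> real"
  assumes l: "continuous_on UNIV l" and \<delta>: "\<delta> > 0" and re: "\<And>\<xi>. Re (l \<xi>) \<ge> \<delta> / 2"
    and low: "\<And>\<xi>. norm (l \<xi>) \<ge> \<delta>" and up: "\<And>\<xi>. norm (l \<xi>) \<le> \<Lambda>"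
    and s0: "s0 \<ge> 1" and s: "s \<ge> s0" and Bd: "Bd \<ge> 0"
    and P: "\<And>n. P n \<in> borel_measurable borel" "\<And>n t. t > 0 \<Longrightarrow> P n t \<ge> 0"
    and q: "\<And>n t. t > 0 \<Longrightarrow> norm (multiplier_kernel (\<lambda>\<xi>. exp (- (of_real t * l \<xi>))) n) \<le> exp (- (t * (\<delta> / 2))) * P n t"
    and PB: "\<And>n. (\<integral>\<^sup>+t\<in>{0<..}. ennreal (t powr (s0 - 1) * P n t) \<partial>lborel) \<le> ennreal Bd"
    and A: "finite A" and B: "finite B" and W: "\<And>n. W n \<ge> 0"
    and WA: "(\<Sum>n\<in>A. (W n)\<^sup>2) \<le> 1" and WB: "(\<Sum>n\<in>B. (W n)\<^sup>2) \<le> 1"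
  defines "\<eta> \<equiv> 1 - s0 / s"
  shows "norm (weighted_form (multiplier_kernel (\<lambda>\<xi>. 1 / l \<xi>)) (\<lambda>n. W n powr (1 / s)) A B a b)
     \<le> (exp (s0\<^sup>2 + 2) * (exp ((s0 * pi)\<^sup>2) + 2 * rGamma (s0 + \<eta>) * Bd)) * \<delta> powr (- \<eta>)
        * (l2_norm a A * l2_norm b B)"
proof -
  let ?a = "l2_norm a A" and ?b = "l2_norm b B"
  have sp: "s > 0" using s0 s by simp
  have \<eta>: "0 \<le> \<eta>" "\<eta> < 1" using s0 s by (auto simp: \<eta>_def field_simps)
  define w where "w = (\<lambda>\<zeta>::complex. of_real \<eta> + of_real s0 * \<zeta>)"
  have wC: "Re (w (Complex x y)) = \<eta> + s0 * x" "Im (w (Complex x y)) = s0 * y" for x y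
    by (simp_all add: w_def)
  define K where "K = (\<lambda>\<zeta>. multiplier_kernel (\<lambda>\<xi>. l \<xi> powr (- w \<zeta>)))"
  define p where "p = (\<lambda>\<zeta> n. complex_of_real (W n) powr \<zeta>)"
  define \<Phi> where "\<Phi> = (\<lambda>\<zeta>. \<Sum>m\<in>A. \<Sum>n\<in>B. (a m * p \<zeta> m) * K \<zeta> (m - n) * (p \<zeta> n * b n))"
  have re0: "Re (l \<xi>) > 0" for \<xi> using re[of \<xi>] \<delta> by linarith
  have nz: "l \<xi> \<noteq> 0" for \<xi> using re0[of \<xi>] by auto
  have lm [measurable]: "l \<in> borel_measurable borel"
    using l by (rule borel_measurable_continuous_onI)
  have pm: "(\<lambda>\<xi>. l \<xi> powr (- w \<zeta>)) \<in> borel_measurable borel" for \<zeta>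
    by measurable
  define L where "L = \<bar>ln \<delta>\<bar> + \<bar>ln \<Lambda>\<bar>"
  have lnL: "\<bar>ln (norm (l \<xi>))\<bar> \<le> L" for \<xi>
  proof -
    have "ln \<delta> \<le> ln (norm (l \<xi>))" "ln (norm (l \<xi>)) \<le> ln \<Lambda>"
      using low[of \<xi>] up[of \<xi>] \<delta> by (auto intro!: ln_mono)
    thus ?thesis by (auto simp: L_def)
  qed
  \<comment> \<open>The growth constant inside the strip does not enter the conclusion of the three-lines theorem, so a crude bound suffices.\<close>
  have crude: "norm (l \<xi> powr (- v)) \<le> exp (\<bar>Re v\<bar> * L + pi * \<bar>Im v\<bar>)" for \<xi> v
  proof -
    have "norm (l \<xi>) powr (- Re v) = exp (- Re v * ln (norm (l \<xi>)))" using nz by (simp add: powr_def)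
    also have "- Re v * ln (norm (l \<xi>)) \<le> \<bar>Re v\<bar> * L"
    proof -
      have "\<bar>Re v\<bar> * \<bar>ln (norm (l \<xi>))\<bar> \<le> \<bar>Re v\<bar> * L" by (intro mult_left_mono lnL) auto
      thus ?thesis by (metis abs_le_D1 abs_minus_cancel abs_mult)
    qed
    finally have "norm (l \<xi>) powr (- Re v) * exp (pi * \<bar>Im v\<bar>) \<le> exp (\<bar>Re v\<bar> * L) * exp (pi * \<bar>Im v\<bar>)"
      by (intro mult_right_mono) auto
    also have "\<dots> = exp (\<bar>Re v\<bar> * L + pi * \<bar>Im v\<bar>)" by (simp add: exp_add)
    finally show ?thesis
      using norm_powr_right_half_plane[OF re0[of \<xi>], of v] by linarith
  qed
  have np: "norm (p (Complex x y) n) \<le> W n powr x" for x y n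
    using W[of n] by (simp add: p_def norm_powr_real_powr)
  have W1: "W n \<le> 1" if "n \<in> A \<or> n \<in> B" for n
  proof -
    have "(W n)\<^sup>2 \<le> (\<Sum>n\<in>A. (W n)\<^sup>2) \<or> (W n)\<^sup>2 \<le> (\<Sum>n\<in>B. (W n)\<^sup>2)"
      using that A B by (metis (no_types, lifting) member_le_sum zero_le_power2)
    hence "(W n)\<^sup>2 \<le> 1\<^sup>2" using WA WB by auto
    thus ?thesis by (rule power2_le_imp_le) simp
  qed
  have np1: "norm (p (Complex x y) n) \<le> 1" if "n \<in> A \<or> n \<in> B" "x \<ge> 0" for x y n
  proof -
    have "W n powr x \<le> 1 powr x" using W1[OF that(1)] W that(2) by (intro powr_mono2) auto
    thus ?thesis using np[of x y n] by simp
  qed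
  have expsq: "pi * \<bar>s0 * y\<bar> \<le> (s0 * pi)\<^sup>2 + y\<^sup>2" for y
  proof -
    define X where "X = s0 * pi * \<bar>y\<bar>"
    have "2 * X \<le> (s0 * pi)\<^sup>2 + y\<^sup>2"
      using sum_squares_bound[of "s0 * pi" "\<bar>y\<bar>"] by (simp add: X_def mult.assoc)
    moreover have "0 \<le> X" using s0 by (simp add: X_def)
    ultimately have "X \<le> (s0 * pi)\<^sup>2 + y\<^sup>2" by linarith
    thus ?thesis using s0 by (simp add: X_def abs_mult mult_ac)
  qed
  define c where "c = s0\<^sup>2 + 1"
  have c1: "c \<ge> 1" by (simp add: c_def)
  have expc: "exp (y\<^sup>2) \<le> exp (c * y\<^sup>2)" for y :: real
    using mult_right_mono[OF c1, of "y\<^sup>2"] by simp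
  define R where "R = exp ((s0 * pi)\<^sup>2) + 2 * rGamma (s0 + \<eta>) * Bd"
  define M where "M = R * \<delta> powr (- \<eta>) * (?a * ?b)"
  have rG: "rGamma (s0 + \<eta>) \<ge> 0"
    using s0 \<eta> Gamma_real_pos[of "s0 + \<eta>"] by (simp add: rGamma_inverse_Gamma)
  have R: "R \<ge> exp ((s0 * pi)\<^sup>2)" "R \<ge> 2 * rGamma (s0 + \<eta>) * Bd" "R > 0"
    using rG Bd by (auto simp: R_def intro: add_pos_nonneg)
  show ?thesis
  proof (cases "?a * ?b = 0")
    case True
    hence "(\<forall>m\<in>A. a m = 0) \<or> (\<forall>n\<in>B. b n = 0)"
      using A B by (auto simp: L2_set_eq_0_iff)
    hence "(weighted_form (multiplier_kernel (\<lambda>\<xi>. 1 / l \<xi>)) (\<lambda>n. W n powr (1 / s)) A B a b) = 0"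
      by (auto intro!: sum.neutral)
    thus ?thesis using True by auto
  next
    case False
    hence ab: "?a * ?b > 0"
      by (metis L2_set_nonneg less_eq_real_def mult_nonneg_nonneg)
    have M: "M > 0" using ab R \<delta> by (simp add: M_def)
    define Kg where "Kg = exp ((s0 + 1) * L + (s0 * pi)\<^sup>2) * (\<Sum>m\<in>A. \<Sum>n\<in>B. norm (a m) * norm (b n))"
    have "norm (\<Phi> (of_real (1 / s))) \<le> M * exp (c + 1)"
    proof (rule three_lines_gaussian_growth)
      show "\<Phi> holomorphic_on UNIV"
        unfolding \<Phi>_def p_def K_def w_def
        by (intro holomorphic_intros of_real_powr_holomorphic
              multiplier_kernel_powr_holomorphic[OF l re0 crude])
      show "M > 0" by fact
      show "c \<ge> 0" using c1 by simp
      show "Kg \<ge> 0" by (auto simp: Kg_def intro!: mult_nonneg_nonneg sum_nonneg)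
      show "0 \<le> 1 / s" "1 / s \<le> 1" using s s0 by auto
    next
      fix y :: real
      define \<zeta> where "\<zeta> = Complex 0 y"
      have Sup: "norm (l \<xi> powr (- w \<zeta>)) \<le> \<delta> powr (- \<eta>) * (exp ((s0 * pi)\<^sup>2) * exp (y\<^sup>2))" for \<xi>
      proof -
        have "norm (l \<xi> powr (- w \<zeta>)) \<le> norm (l \<xi>) powr (- \<eta>) * exp (pi * \<bar>s0 * y\<bar>)"
          using norm_powr_right_half_plane[OF re0, of \<xi> "w \<zeta>"] by (simp add: wC \<zeta>_def)
        also have "\<dots> \<le> \<delta> powr (- \<eta>) * exp ((s0 * pi)\<^sup>2 + y\<^sup>2)"
          using \<delta> \<eta> low expsq by (intro mult_mono powr_mono2') auto
        finally show ?thesis by (simp add: exp_add)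
      qed
      have "norm (\<Phi> \<zeta>) \<le> \<delta> powr (- \<eta>) * (exp ((s0 * pi)\<^sup>2) * exp (y\<^sup>2)) *
         (L2_set (\<lambda>m. norm (a m * p \<zeta> m)) A * L2_set (\<lambda>n. norm (p \<zeta> n * b n)) B)"
        unfolding \<Phi>_def K_def multiplier_kernel_def
        by (rule multiplier_form_bound[OF A B pm Sup])
      also have "\<dots> \<le> \<delta> powr (- \<eta>) * (R * exp (c * y\<^sup>2)) * (?a * ?b)"
      proof (intro mult_mono L2_set_mono R expc)
        show "norm (a m * p \<zeta> m) \<le> norm (a m)" if "m \<in> A" for m
          using np1[of m 0 y] that by (simp add: norm_mult mult_left_le \<zeta>_def)
        show "norm (p \<zeta> m * b m) \<le> norm (b m)" if "m \<in> B" for m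
          using np1[of m 0 y] that by (simp add: norm_mult mult_left_le_one_le \<zeta>_def)
      qed (use R in \<open>auto intro!: mult_nonneg_nonneg\<close>)
      also have "\<dots> = M * exp (c * y\<^sup>2)" by (simp add: M_def)
      finally show "norm (\<Phi> (Complex 0 y)) \<le> M * exp (c * y\<^sup>2)" by (simp add: \<zeta>_def)
    next
      fix y :: real
      define \<zeta> where "\<zeta> = Complex 1 y"
      have wz: "w \<zeta> = Complex (s0 + \<eta>) (s0 * y)"
        by (simp add: complex_eq_iff w_def \<zeta>_def)
      have PBn: "(\<integral>\<^sup>+t\<in>{0<..}. ennreal (t powr (Re (w \<zeta>) - 1) * (exp (- (t * (\<delta> / 2))) * P n t)) \<partial>lborel)
          \<le> ennreal (2 * \<delta> powr (- \<eta>) * Bd)" for n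
      proof -
        note P(1)[measurable]
        have pt: "t powr (s0 + \<eta> - 1) * (exp (- (t * (\<delta> / 2))) * P n t) \<le> 2 * \<delta> powr (- \<eta>) * (t powr (s0 - 1) * P n t)" if "t > 0" for t
        proof -
          define x where "x = t * (\<delta> / 2)"
          have x: "x > 0" using that \<delta> by (simp add: x_def)
          have "x powr \<eta> \<le> exp x"
          proof (cases "x \<le> 1")
            case True
            have "x powr \<eta> \<le> 1 powr \<eta>" using True x \<eta> by (intro powr_mono2) auto
            also have "1 powr \<eta> \<le> exp x" using x by simp
            finally show ?thesis .
          next
            case False
            have "x powr \<eta> \<le> x powr 1" using False \<eta> by (intro powr_mono) auto
            also have "x powr 1 = x" using x by simp
            also have "x \<le> exp x" using exp_ge_add_one_self[of x] by linarith
            finally show ?thesis .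
          qed
          hence 1: "x powr \<eta> * exp (- x) \<le> 1" by (simp add: exp_minus field_simps)
          have "t powr \<eta> = (2 / \<delta>) powr \<eta> * x powr \<eta>"
            using \<delta> that x by (simp add: powr_mult[symmetric] x_def)
          also have "(2 / \<delta>) powr \<eta> = 2 powr \<eta> * \<delta> powr (- \<eta>)"
            using \<delta> by (simp add: powr_divide powr_minus_divide)
          finally have "t powr \<eta> * exp (- x) = 2 powr \<eta> * \<delta> powr (- \<eta>) * (x powr \<eta> * exp (- x))" by simp
          also have "\<dots> \<le> 2 powr 1 * \<delta> powr (- \<eta>) * 1"
            using 1 \<eta> by (intro mult_mono[OF mult_right_mono[OF powr_mono]]) auto
          finally have 2: "t powr \<eta> * exp (- x) \<le> 2 * \<delta> powr (- \<eta>)" by simp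
          have "t powr (s0 + \<eta> - 1) * (exp (- x) * P n t) = (t powr \<eta> * exp (- x)) * (t powr (s0 - 1) * P n t)"
            using that by (simp add: powr_add[symmetric] algebra_simps)
          also have "\<dots> \<le> 2 * \<delta> powr (- \<eta>) * (t powr (s0 - 1) * P n t)"
            using 2 P(2)[OF that, of n] by (intro mult_right_mono) auto
          finally show ?thesis by (simp add: x_def)
        qed
        have "(\<integral>\<^sup>+t\<in>{0<..}. ennreal (t powr (Re (w \<zeta>) - 1) * (exp (- (t * (\<delta> / 2))) * P n t)) \<partial>lborel)
          \<le> (\<integral>\<^sup>+t. ennreal (2 * \<delta> powr (- \<eta>)) * (ennreal (t powr (s0 - 1) * P n t) * indicator {0<..} t) \<partial>lborel)"
        proof (rule nn_integral_mono)
          fix t :: real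
          show "ennreal (t powr (Re (w \<zeta>) - 1) * (exp (- (t * (\<delta> / 2))) * P n t)) * indicator {0<..} t
             \<le> ennreal (2 * \<delta> powr (- \<eta>)) * (ennreal (t powr (s0 - 1) * P n t) * indicator {0<..} t)"
          proof (cases "t > 0")
            case True
            thus ?thesis using pt[OF True] P(2)[OF True, of n]
              by (simp add: wz ennreal_mult'[symmetric] ennreal_leI)
          qed auto
        qed
        also have "\<dots> = ennreal (2 * \<delta> powr (- \<eta>)) * (\<integral>\<^sup>+t\<in>{0<..}. ennreal (t powr (s0 - 1) * P n t) \<partial>lborel)"
          by (rule nn_integral_cmult) measurable
        also have "\<dots> \<le> ennreal (2 * \<delta> powr (- \<eta>)) * ennreal Bd"
          by (intro mult_left_mono PB) auto
        also have "\<dots> = ennreal (2 * \<delta> powr (- \<eta>) * Bd)"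
          using Bd by (simp add: ennreal_mult')
        finally show ?thesis .
      qed
      have Kb: "norm (K \<zeta> n) \<le> \<delta> powr (- \<eta>) * (R * exp (c * y\<^sup>2))" for n
      proof -
        have "norm (K \<zeta> n) \<le> norm (rGamma (w \<zeta>)) * (2 * \<delta> powr (- \<eta>) * Bd)"
          unfolding K_def
        proof (rule power_kernel_from_semigroup[OF lm _ re])
          show "Re (w \<zeta>) > 0" using s0 \<eta> by (simp add: wz)
        qed (use \<delta> P q PBn Bd in auto)
        also have "norm (rGamma (w \<zeta>)) \<le> rGamma (s0 + \<eta>) * exp ((s0 * y)\<^sup>2)"
          unfolding wz using s0 \<eta> by (intro norm_rGamma_le) auto
        also have "rGamma (s0 + \<eta>) * exp ((s0 * y)\<^sup>2) * (2 * \<delta> powr (- \<eta>) * Bd)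
          = \<delta> powr (- \<eta>) * ((2 * rGamma (s0 + \<eta>) * Bd) * exp ((s0 * y)\<^sup>2))" by simp
        also have "\<dots> \<le> \<delta> powr (- \<eta>) * (R * exp (c * y\<^sup>2))"
          using R by (intro mult_left_mono mult_mono) (auto simp: c_def power_mult_distrib distrib_right)
        finally show ?thesis using Bd by (simp add: mult_right_mono)
      qed
      define Q where "Q = \<delta> powr (- \<eta>) * (R * exp (c * y\<^sup>2))"
      have Q: "Q \<ge> 0" using R by (simp add: Q_def)
      have "norm (\<Phi> \<zeta>) \<le> (\<Sum>m\<in>A. \<Sum>n\<in>B. norm ((a m * p \<zeta> m) * K \<zeta> (m - n) * (p \<zeta> n * b n)))"
        unfolding \<Phi>_def by (intro order_trans[OF norm_sum] sum_mono norm_sum)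
      also have "\<dots> \<le> (\<Sum>m\<in>A. \<Sum>n\<in>B. (norm (a m) * W m) * Q * (W n * norm (b n)))"
      proof (intro sum_mono)
        fix m n
        have pn: "norm (p \<zeta> k) \<le> W k" for k
          using np[of 1 y k] W[of k] by (simp add: \<zeta>_def)
        show "norm ((a m * p \<zeta> m) * K \<zeta> (m - n) * (p \<zeta> n * b n)) \<le> (norm (a m) * W m) * Q * (W n * norm (b n))"
          unfolding norm_mult using pn W Kb[folded Q_def] Q by (intro mult_mono mult_nonneg_nonneg) auto
      qed
      also have "\<dots> = Q * ((\<Sum>m\<in>A. norm (a m) * W m) * (\<Sum>n\<in>B. W n * norm (b n)))"
        unfolding sum_product unfolding sum_distrib_left by (simp add: mult_ac)
      also have "\<dots> \<le> Q * ((?a * 1) * (1 * ?b))"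
      proof (intro mult_left_mono mult_mono)
        have "(\<Sum>m\<in>A. norm (a m) * W m) \<le> ?a * L2_set W A"
          using L2_set_mult_ineq[of "\<lambda>m. norm (a m)" W A] W by simp
        also have "\<dots> \<le> ?a * 1"
          using WA by (intro mult_left_mono) (auto simp: L2_set_def intro!: sum_nonneg)
        finally show "(\<Sum>m\<in>A. norm (a m) * W m) \<le> ?a * 1" .
        have "(\<Sum>n\<in>B. W n * norm (b n)) \<le> L2_set W B * ?b"
          using L2_set_mult_ineq[of W "\<lambda>m. norm (b m)" B] W by simp
        also have "\<dots> \<le> 1 * ?b"
          using WB by (intro mult_right_mono) (auto simp: L2_set_def intro!: sum_nonneg)
        finally show "(\<Sum>n\<in>B. W n * norm (b n)) \<le> 1 * ?b" .
      qed (use Q W in \<open>auto intro!: sum_nonneg\<close>)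
      also have "\<dots> = M * exp (c * y\<^sup>2)" by (simp add: M_def Q_def)
      finally show "norm (\<Phi> (Complex 1 y)) \<le> M * exp (c * y\<^sup>2)" by (simp add: \<zeta>_def)
    next
      fix x y :: real assume x: "0 \<le> x" "x \<le> 1"
      define \<zeta> where "\<zeta> = Complex x y"
      define E where "E = exp ((s0 + 1) * L + (s0 * pi)\<^sup>2) * exp (y\<^sup>2)"
      have L0: "L \<ge> 0" by (simp add: L_def)
      have Kb: "norm (K \<zeta> n) \<le> E" for n
        unfolding K_def
      proof (rule multiplier_kernel_le[OF pm])
        fix \<xi> :: "real ^ 'd"
        have "norm (l \<xi> powr (- w \<zeta>)) \<le> exp (\<bar>Re (w \<zeta>)\<bar> * L + pi * \<bar>Im (w \<zeta>)\<bar>)" by (rule crude)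
        also have "\<bar>Re (w \<zeta>)\<bar> * L + pi * \<bar>Im (w \<zeta>)\<bar> \<le> (s0 + 1) * L + ((s0 * pi)\<^sup>2 + y\<^sup>2)"
        proof (intro add_mono mult_right_mono L0)
          have "s0 * x \<le> s0 * 1" using x s0 by (intro mult_left_mono) auto
          moreover have "0 \<le> s0 * x" using x s0 by simp
          ultimately have "\<bar>\<eta> + s0 * x\<bar> \<le> s0 + 1" using \<eta> by linarith
          thus "\<bar>Re (w \<zeta>)\<bar> \<le> s0 + 1" by (simp only: wC \<zeta>_def)
          show "pi * \<bar>Im (w \<zeta>)\<bar> \<le> (s0 * pi)\<^sup>2 + y\<^sup>2" using expsq[of y] by (simp add: wC \<zeta>_def)
        qed
        finally show "norm (l \<xi> powr (- w \<zeta>)) \<le> E" by (simp add: E_def exp_add mult.assoc)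
      qed
      have E: "E \<ge> 0" by (simp add: E_def)
      have "norm (\<Phi> \<zeta>) \<le> (\<Sum>m\<in>A. \<Sum>n\<in>B. norm ((a m * p \<zeta> m) * K \<zeta> (m - n) * (p \<zeta> n * b n)))"
        unfolding \<Phi>_def by (intro order_trans[OF norm_sum] sum_mono norm_sum)
      also have "\<dots> \<le> (\<Sum>m\<in>A. \<Sum>n\<in>B. (norm (a m) * 1) * E * (1 * norm (b n)))"
      proof (intro sum_mono)
        fix m n assume "m \<in> A" "n \<in> B"
        thus "norm ((a m * p \<zeta> m) * K \<zeta> (m - n) * (p \<zeta> n * b n)) \<le> (norm (a m) * 1) * E * (1 * norm (b n))"
          unfolding norm_mult \<zeta>_def using np1 x Kb[unfolded \<zeta>_def] E by (intro mult_mono mult_nonneg_nonneg) auto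
      qed
      also have "\<dots> = Kg * exp (y\<^sup>2)"
        by (simp add: Kg_def E_def sum_distrib_left sum_distrib_right mult_ac)
      also have "\<dots> \<le> Kg * exp (c * y\<^sup>2)"
        by (intro mult_left_mono expc) (auto simp: Kg_def intro!: mult_nonneg_nonneg sum_nonneg)
      finally show "norm (\<Phi> (Complex x y)) \<le> Kg * exp (c * y\<^sup>2)" by (simp add: \<zeta>_def)
    qed
    also have "\<Phi> (of_real (1 / s)) = (weighted_form (multiplier_kernel (\<lambda>\<xi>. 1 / l \<xi>)) (\<lambda>n. W n powr (1 / s)) A B a b)"
    proof -
      have "w (of_real (1 / s)) = 1"
      proof -
        have "w (of_real (1 / s)) = of_real (\<eta> + s0 / s)" by (simp add: w_def)
        also have "\<eta> + s0 / s = 1" by (simp add: \<eta>_def)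
        finally show ?thesis by simp
      qed
      hence "K (of_real (1 / s)) = multiplier_kernel (\<lambda>\<xi>. 1 / l \<xi>)"
        using nz by (simp add: K_def powr_minus_divide)
      moreover have "p (of_real (1 / s)) n = of_real (W n powr (1 / s))" for n
        unfolding p_def using W by (intro powr_of_real) (auto simp: sp less_imp_le)
      ultimately show ?thesis by (simp add: \<Phi>_def mult_ac)
    qed
    finally show ?thesis
      by (simp add: M_def R_def c_def mult_ac add_ac)
  qed
qed

section \<open>Kernels of the rotated semigroups\<close>

lemma integral_affine_real:
  fixes f :: "real \<Rightarrow> complex"
  assumes "continuous_on UNIV f" "m > 0"
  shows "integral {a..b} (\<lambda>x. f (m * x + c)) = integral {m * a + c..m * b + c} f / of_real m"
proof -
  have "(f has_integral integral {m * a + c..m * b + c} f) (cbox (m * a + c) (m * b + c))"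
    unfolding cbox_interval
    by (intro integrable_integral integrable_continuous_interval continuous_on_subset[OF assms(1)]) auto
  from has_integral_affinity'[OF this assms(2), of c]
  have "((\<lambda>x. f (m * x + c)) has_integral (integral {m * a + c..m * b + c} f /\<^sub>R m)) {a..b}"
    using assms(2) by (simp add: cbox_interval divide_simps mult.commute)
  thus ?thesis by (simp add: integral_unique scaleR_conv_of_real divide_inverse mult.commute)
qed

lemma integral_reflect_pi:
  "integral {0..pi} f = integral {0..pi} (\<lambda>\<alpha>::real. f (pi - \<alpha>) :: complex)"
proof -
  have "integral {0..pi} f = integral {- pi..- 0} (\<lambda>x. f (- x))" by (rule Henstock_Kurzweil_Integration.integral_reflect_real[symmetric])
  also have "\<dots> = integral {0 + (- pi)..pi + (- pi)} (\<lambda>x. f (- x))" by simp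
  also have "\<dots> = integral {0..pi} ((\<lambda>x. f (- x)) \<circ> (+) (- pi))" by (rule integral_shift_Icc_real[symmetric])
  finally show ?thesis by (simp add: o_def)
qed

lemma bessel_integral_minus_left: "norm (bessel_integral (- \<nu>) \<tau>) = norm (bessel_integral \<nu> \<tau>)"
proof -
  have "bessel_integral (- \<nu>) \<tau> = integral {0..pi} (\<lambda>\<alpha>. exp (\<i> * complex_of_real (- \<nu> * (pi - \<alpha>) - \<tau> * sin (pi - \<alpha>))))"
    unfolding bessel_integral_def by (rule integral_reflect_pi)
  also have "\<dots> = integral {0..pi} (\<lambda>\<alpha>. exp (- \<i> * of_real (\<nu> * pi)) * exp (\<i> * complex_of_real (\<nu> * \<alpha> - \<tau> * sin \<alpha>)))"
    by (intro integral_cong) (simp add: exp_add[symmetric] algebra_simps)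
  also have "\<dots> = exp (- \<i> * of_real (\<nu> * pi)) * bessel_integral \<nu> \<tau>"
    unfolding bessel_integral_def by (rule integral_mult_right)
  finally have "norm (bessel_integral (- \<nu>) \<tau>) = norm (exp (- \<i> * of_real (\<nu> * pi))) * norm (bessel_integral \<nu> \<tau>)"
    by (simp only: norm_mult)
  thus ?thesis by (simp add: norm_exp_eq_Re)
qed

lemma bessel_integral_minus_both: "bessel_integral (- \<nu>) (- \<tau>) = cnj (bessel_integral \<nu> \<tau>)"
  unfolding bessel_integral_def
  by (simp add: integral_cnj exp_cnj algebra_simps)

lemma norm_bessel_integral_abs: "norm (bessel_integral \<nu> \<tau>) = norm (bessel_integral \<bar>\<nu>\<bar> \<bar>\<tau>\<bar>)"
proof -
  have 1: "norm (bessel_integral \<nu> (- \<tau>)) = norm (bessel_integral \<nu> \<tau>)" for \<nu> \<tau>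
  proof -
    have "bessel_integral \<nu> (- \<tau>) = cnj (bessel_integral (- \<nu>) \<tau>)"
      using bessel_integral_minus_both[of "- \<nu>" \<tau>] by simp
    thus ?thesis by (simp only: complex_mod_cnj bessel_integral_minus_left)
  qed
  have "norm (bessel_integral \<nu> \<bar>\<tau>\<bar>) = norm (bessel_integral \<nu> \<tau>)"
    by (cases "\<tau> \<ge> 0") (simp_all only: abs_of_nonneg abs_of_neg not_le 1)
  thus ?thesis
    by (cases "\<nu> \<ge> 0") (simp_all only: abs_of_nonneg abs_of_neg not_le bessel_integral_minus_left)
qed

definition circle_kernel :: "complex \<Rightarrow> real \<Rightarrow> int \<Rightarrow> complex" where
  "circle_kernel \<kappa> t k = (LINT x|circle_measure. exp (- (of_real t * \<kappa> * of_real (4 * (sin (pi * x))\<^sup>2))) * exp (2 * pi * \<i> * of_int k * of_real x))"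

lemma circle_kernel_eq:
  "circle_kernel \<kappa> t k = integral {-1/2..1/2} (\<lambda>x. exp (- (of_real t * \<kappa> * of_real (4 * (sin (pi * x))\<^sup>2))) * exp (2 * pi * \<i> * of_int k * of_real x))"
  unfolding circle_kernel_def by (rule circle_continuous_integrable) (intro continuous_intros)

abbreviation semigroup_kernel :: "complex \<Rightarrow> complex \<Rightarrow> real \<Rightarrow> int ^ 'd::finite \<Rightarrow> complex" where
  "semigroup_kernel \<kappa> z t n \<equiv> multiplier_kernel (\<lambda>\<xi>. exp (- (of_real t * (\<kappa> * (of_real (laplacian_symbol \<xi>) - z))))) n"

lemma semigroup_kernel_product:
  fixes n :: "int ^ 'd::finite"
  shows "semigroup_kernel \<kappa> z t n
     = exp (of_real t * \<kappa> * z) * (\<Prod>j\<in>UNIV. circle_kernel \<kappa> t (n $ j))"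
proof -
  define g where "g = (\<lambda>j x. exp (- (of_real t * \<kappa> * of_real (4 * (sin (pi * x))\<^sup>2))) * exp (2 * pi * \<i> * of_int (n $ j) * of_real x))"
  have "exp (- (of_real t * (\<kappa> * (of_real (laplacian_symbol \<xi>) - z)))) * character n \<xi> = exp (of_real t * \<kappa> * z) * (\<Prod>j\<in>UNIV. g j (\<xi> $ j))" for \<xi> :: "real ^ 'd"
  proof -
    have "(\<Prod>j\<in>UNIV. exp (- (of_real t * \<kappa> * of_real (4 * (sin (pi * \<xi> $ j))\<^sup>2)))) = exp (- (of_real t * \<kappa> * of_real (laplacian_symbol \<xi>)))"
      by (simp add: exp_sum[symmetric] laplacian_symbol_def sum_distrib_left sum_negf)
    hence "(\<Prod>j\<in>UNIV. g j (\<xi> $ j)) = exp (- (of_real t * \<kappa> * of_real (laplacian_symbol \<xi>))) * character n \<xi>"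
      by (simp add: g_def prod.distrib character_product)
    thus ?thesis by (simp add: exp_add[symmetric] algebra_simps)
  qed
  hence "semigroup_kernel \<kappa> z t n
     = exp (of_real t * \<kappa> * z) * (LINT \<xi>|torus_measure. (\<Prod>j\<in>UNIV. g j (\<xi> $ j)))"
    by (simp add: multiplier_kernel_def)
  also have "(LINT \<xi>|torus_measure. (\<Prod>j\<in>UNIV. g j (\<xi> $ j))) = (\<Prod>j\<in>UNIV. (LINT x|circle_measure. g j x))"
    unfolding g_def by (intro torus_product(2) circle_continuous_integrable(1) continuous_intros)
  finally show ?thesis by (simp add: g_def circle_kernel_def)
qed

text \<open>
  In the variable \<open>\<alpha> = 2 \<pi> x - \<pi> / 2\<close> the integrand is a constant phase times the \<open>2 \<pi>\<close>-periodic function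
  \<open>F \<alpha> = exp (i (k \<alpha> - \<tau> sin \<alpha>))\<close>. Its integrals over \<open>[- \<pi>, 0]\<close> and \<open>[0, \<pi>]\<close> are complex conjugates
  of each other.
\<close>
lemma circle_kernel_oscillatory:
  assumes \<epsilon>: "\<epsilon> = 1 \<or> \<epsilon> = (-1 :: real)"
  shows "norm (circle_kernel (\<i> * of_real \<epsilon>) t k) \<le> norm (bessel_integral (of_int \<bar>k\<bar>) (2 * \<bar>t\<bar>))"
proof -
  define \<tau> where "\<tau> = 2 * (\<epsilon> * t)"
  define F where "F = (\<lambda>\<alpha>. exp (\<i> * complex_of_real (of_int k * \<alpha> - \<tau> * sin \<alpha>)))"
  define u where "u = exp (- \<i> * of_real \<tau>) * exp (\<i> * of_real (of_int k * (pi / 2)))"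
  have Fc: "continuous_on S F" for S unfolding F_def by (intro continuous_intros)
  have Fi: "F integrable_on {a..b}" for a b by (intro integrable_continuous_interval Fc)
  have eq: "exp (- (of_real t * (\<i> * of_real \<epsilon>) * of_real (4 * (sin (pi * x))\<^sup>2))) * exp (2 * pi * \<i> * of_int k * of_real x)
     = u * F (2 * pi * x + (- (pi / 2)))" for x
  proof -
    have s: "sin (2 * pi * x + (- (pi / 2))) = - cos (2 * (pi * x))"
      by (simp add: sin_diff mult.assoc)
    have "4 * (sin (pi * x))\<^sup>2 = 2 - 2 * cos (2 * (pi * x))"
      by (simp add: cos_double_sin)
    have "- (of_real t * (\<i> * of_real \<epsilon>) * of_real (4 * (sin (pi * x))\<^sup>2)) =
       - \<i> * of_real \<tau> + \<i> * of_real (\<tau> * cos (2 * (pi * x)))"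
      unfolding \<open>4 * (sin (pi * x))\<^sup>2 = 2 - 2 * cos (2 * (pi * x))\<close>
      by (simp add: \<tau>_def algebra_simps)
    moreover have "2 * complex_of_real pi * \<i> * of_int k * of_real x =
        \<i> * of_real (of_int k * (pi / 2)) + \<i> * of_real (of_int k * (2 * pi * x + (- (pi / 2))))"
      by (simp add: algebra_simps)
    ultimately show ?thesis
      unfolding u_def F_def s by (simp add: exp_add[symmetric] algebra_simps)
  qed
  have per: "F (\<alpha> + 2 * pi) = F \<alpha>" for \<alpha>
  proof -
    have e: "\<i> * complex_of_real (of_int k * (\<alpha> + 2 * pi) - \<tau> * sin \<alpha>)
       = \<i> * complex_of_real (of_int k * \<alpha> - \<tau> * sin \<alpha>) + 2 * of_real pi * \<i> * of_int k"
      by (simp add: algebra_simps)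
    have "F (\<alpha> + 2 * pi) = F \<alpha> * exp (2 * of_real pi * \<i> * of_int k)"
      unfolding F_def sin_periodic e by (rule exp_add)
    also have "exp (2 * of_real pi * \<i> * of_int k) = 1"
      using exp_integer_2pi[of "of_int k"] by (simp add: mult_ac)
    finally show ?thesis by simp
  qed
  have "circle_kernel (\<i> * of_real \<epsilon>) t k = u * integral {-1/2..1/2} (\<lambda>x. F (2 * pi * x + (- (pi / 2))))"
    unfolding circle_kernel_eq eq by (rule integral_mult_right)
  also have "integral {-1/2..1/2} (\<lambda>x. F (2 * pi * x + (- (pi / 2)))) = integral {- pi - pi / 2..pi / 2} F / of_real (2 * pi)"
    by (subst integral_affine_real[OF Fc]) auto
  also have "integral {- pi - pi / 2..pi / 2} F = integral {- pi - pi / 2..- pi} F + (integral {- pi..0} F + integral {0..pi / 2} F)"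
    using Fi by (simp add: Henstock_Kurzweil_Integration.integral_combine)
  also have "integral {- pi - pi / 2..- pi} F = integral {pi / 2..pi} F"
  proof -
    have "integral {pi / 2..pi} F = integral {(- pi - pi / 2) + 2 * pi..- pi + 2 * pi} F" by simp
    also have "\<dots> = integral {- pi - pi / 2..- pi} (F \<circ> (+) (2 * pi))" by (rule integral_shift_Icc_real[symmetric])
    also have "F \<circ> (+) (2 * pi) = F" using per by (auto simp: fun_eq_iff add.commute)
    finally show ?thesis by simp
  qed
  also have "integral {- pi..0} F = cnj (bessel_integral (of_int k) \<tau>)"
  proof -
    have "integral {- pi..- 0} F = integral {0..pi} (\<lambda>x. F (- x))"
      using Henstock_Kurzweil_Integration.integral_reflect_real[of pi 0 "\<lambda>x. F (- x)"] by simp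
    also have "\<dots> = cnj (bessel_integral (of_int k) \<tau>)"
      unfolding F_def bessel_integral_def by (simp add: integral_cnj exp_cnj algebra_simps)
    finally show ?thesis by simp
  qed
  also have "integral {pi / 2..pi} F + (cnj (bessel_integral (of_int k) \<tau>) + integral {0..pi / 2} F) = cnj (bessel_integral (of_int k) \<tau>) + bessel_integral (of_int k) \<tau>"
    using Henstock_Kurzweil_Integration.integral_combine[of 0 "pi/2" pi F] Fi
    by (simp add: bessel_integral_def F_def add.commute)
  finally have "circle_kernel (\<i> * of_real \<epsilon>) t k = u * ((cnj (bessel_integral (of_int k) \<tau>) + bessel_integral (of_int k) \<tau>) / of_real (2 * pi))" .
  moreover have "norm u = 1" by (simp add: u_def norm_mult norm_exp_eq_Re)
  ultimately have "norm (circle_kernel (\<i> * of_real \<epsilon>) t k) = norm (cnj (bessel_integral (of_int k) \<tau>) + bessel_integral (of_int k) \<tau>) / (2 * pi)"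
    by (simp add: norm_mult norm_divide)
  also have "\<dots> \<le> (2 * norm (bessel_integral (of_int k) \<tau>)) / (2 * pi)"
    using norm_triangle_ineq[of "cnj (bessel_integral (of_int k) \<tau>)" "bessel_integral (of_int k) \<tau>"]
    by (intro divide_right_mono) auto
  also have "\<dots> \<le> norm (bessel_integral (of_int k) \<tau>)"
    using pi_ge_two mult_left_mono[of 1 pi "norm (bessel_integral (of_int k) \<tau>)"] by (simp add: field_simps)
  also have "\<dots> = norm (bessel_integral (of_int \<bar>k\<bar>) (2 * \<bar>t\<bar>))"
    using \<epsilon> by (subst norm_bessel_integral_abs) (auto simp: \<tau>_def abs_mult)
  finally show ?thesis .
qed

lemma lorentzian_integral_le:
  assumes t: "t > 0"
  shows "(\<lambda>x. 1 / (1 + 2 * t * (x - x0)\<^sup>2)) integrable_on {-1/2..1/2}"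
    and "integral {-1/2..1/2} (\<lambda>x. 1 / (1 + 2 * t * (x - x0)\<^sup>2)) \<le> pi / sqrt (2 * t)"
proof -
  define q where "q = sqrt (2 * t)"
  have q: "q > 0" "q\<^sup>2 = 2 * t" using t by (auto simp: q_def)
  have I: "((\<lambda>x. 1 / (1 + 2 * t * (x - x0)\<^sup>2)) has_integral
     (arctan (q * (1/2 - x0)) / q - arctan (q * (-1/2 - x0)) / q)) {-1/2..1/2}"
  proof (rule fundamental_theorem_of_calculus)
    fix x :: real
    have "((\<lambda>x. arctan (q * (x - x0)) / q) has_real_derivative 1 / (1 + 2 * t * (x - x0)\<^sup>2)) (at x)"
      using q by (auto intro!: derivative_eq_intros simp: power_mult_distrib divide_inverse)
    thus "((\<lambda>x. arctan (q * (x - x0)) / q) has_vector_derivative 1 / (1 + 2 * t * (x - x0)\<^sup>2)) (at x within {-1/2..1/2})"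
      using has_real_derivative_iff_has_vector_derivative has_vector_derivative_at_within by blast
  qed auto
  thus "(\<lambda>x. 1 / (1 + 2 * t * (x - x0)\<^sup>2)) integrable_on {-1/2..1/2}" by blast
  have "arctan (q * (1/2 - x0)) / q - arctan (q * (-1/2 - x0)) / q \<le> pi / q"
    using q arctan_bounded[of "q * (1/2 - x0)"] arctan_bounded[of "q * (-1/2 - x0)"]
    by (simp add: diff_divide_distrib[symmetric] divide_right_mono)
  thus "integral {-1/2..1/2} (\<lambda>x. 1 / (1 + 2 * t * (x - x0)\<^sup>2)) \<le> pi / sqrt (2 * t)"
    using I by (simp add: integral_unique q_def)
qed

lemma exp_minus_sq_le_lorentzian:
  assumes "t > 0" "0 \<le> y" "y \<le> 1/2" "\<bar>s\<bar> = sin (pi * y)"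
  shows "exp (- (4 * t * s\<^sup>2)) \<le> 1 / (1 + 2 * t * y\<^sup>2)"
proof -
  have "pi * y \<le> pi * (1/2)" using assms by (intro mult_left_mono) auto
  hence "sin (pi * y) \<ge> pi * y / 4"
    using assms pi_gt_zero by (intro sin_ge_quarter) (auto simp del: pi_gt_zero)
  moreover have "pi * y / 4 \<ge> 3 * y / 4" using assms pi_gt3 by (intro divide_right_mono mult_right_mono) auto
  ultimately have "\<bar>s\<bar> \<ge> 3 * y / 4" using assms by linarith
  hence "(3 * y / 4)\<^sup>2 \<le> \<bar>s\<bar>\<^sup>2" using assms by (intro power_mono) auto
  moreover have "y\<^sup>2 / 2 \<le> (3 * y / 4)\<^sup>2" by (simp add: power2_eq_square)
  ultimately have "s\<^sup>2 \<ge> y\<^sup>2 / 2" by simp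
  hence "4 * t * s\<^sup>2 \<ge> 4 * t * (y\<^sup>2 / 2)" using assms(1) by (intro mult_left_mono) auto
  hence "exp (- (4 * t * s\<^sup>2)) \<le> exp (- (2 * t * y\<^sup>2))" by simp
  also have "\<dots> = 1 / exp (2 * t * y\<^sup>2)" by (simp add: exp_minus inverse_eq_divide)
  also have "\<dots> \<le> 1 / (1 + 2 * t * y\<^sup>2)"
    using exp_ge_add_one_self[of "2 * t * y\<^sup>2"] assms(1) by (intro divide_left_mono) (auto intro!: mult_pos_pos add_pos_nonneg)
  finally show ?thesis .
qed

text \<open>
  These kernels serve for \<open>z\<close> to the left and to the right of the spectrum. The moduli of the integrands are
  peaks of width \<open>t\<^sup>-\<^sup>1\<^sup>/\<^sup>2\<close> at the zeros of \<open>sin (\<pi> x)\<close> and of \<open>cos (\<pi> x)\<close>; the factor \<open>exp (- 4 t)\<close>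
  turns \<open>exp (4 t sin\<^sup>2)\<close> into \<open>exp (- 4 t cos\<^sup>2)\<close>.
\<close>
lemma circle_kernel_heat:
  assumes t: "t > 0"
  shows "norm (circle_kernel 1 t k) \<le> min 1 (5 * t powr (- 1 / 2))"
    and "norm (exp (- (of_real (4 * t))) * circle_kernel (- 1) t k) \<le> min 1 (5 * t powr (- 1 / 2))"
proof -
  have root: "2 * (pi / sqrt (2 * t)) \<le> 5 * t powr (- 1 / 2)"
  proof -
    have "pi \<le> 3.15" using pi_approx by simp
    moreover have "sqrt 2 \<ge> 1.4" by (rule real_le_rsqrt) (simp add: power2_eq_square)
    ultimately have "2 * pi / sqrt 2 \<le> 5" by (simp add: field_simps)
    hence "2 * pi / sqrt 2 * t powr (- 1 / 2) \<le> 5 * t powr (- 1 / 2)" by (intro mult_right_mono) auto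
    thus ?thesis using t by (simp add: real_sqrt_mult powr_minus_divide powr_half_sqrt)
  qed
  \<comment> \<open>Here \<open>X\<close> stands for the zeros of \<open>s\<close>; near such a zero \<open>x0\<close> the integrand is compared with a Lorentzian centred at \<open>x0\<close>.\<close>
  have gen: "norm (integral {-1/2..1/2} G) \<le> min 1 (5 * t powr (- 1 / 2))"
    if G: "continuous_on {-1/2..1/2} G"
      and b: "\<And>x. x \<in> {-1/2..1/2} \<Longrightarrow> norm (G x) = exp (- (4 * t * (s x)\<^sup>2))"
      and s: "\<And>x. x \<in> {-1/2..1/2} \<Longrightarrow> \<exists>x0\<in>{0,1/2,-1/2}. x0 \<in> X \<and> \<bar>x - x0\<bar> \<le> 1/2 \<and> \<bar>s x\<bar> = sin (pi * \<bar>x - x0\<bar>)"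
      and X: "X = {0} \<or> X = {1/2, -1/2}"
    for G :: "real \<Rightarrow> complex" and s :: "real \<Rightarrow> real" and X :: "real set"
  proof -
    have Gi: "G integrable_on {-1/2..1/2}" by (intro integrable_continuous_interval G)
    have "norm (integral {-1/2..1/2} G) \<le> 1 * (1/2 - (-1/2))"
      by (rule integral_bound) (use G b t in auto)
    moreover have "norm (integral {-1/2..1/2} G) \<le> 2 * (pi / sqrt (2 * t))"
    proof -
      let ?L = "\<lambda>x0 x. 1 / (1 + 2 * t * (x - x0)\<^sup>2)"
      have L0: "?L x0 x \<ge> 0" for x0 x using t by (auto intro!: divide_nonneg_nonneg add_nonneg_nonneg)
      have finX: "finite X" "card X \<le> 2" using X by auto
      have "norm (integral {-1/2..1/2} G) \<le> integral {-1/2..1/2} (\<lambda>x. \<Sum>x0\<in>X. ?L x0 x)"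
      proof (rule integral_norm_bound_integral[OF Gi])
        show "(\<lambda>x. \<Sum>x0\<in>X. ?L x0 x) integrable_on {-1/2..1/2}"
          using finX by (intro integrable_sum lorentzian_integral_le t)
        fix x :: real assume x: "x \<in> {-1/2..1/2}"
        then obtain x0 where x0: "x0 \<in> X" "\<bar>x - x0\<bar> \<le> 1/2" "\<bar>s x\<bar> = sin (pi * \<bar>x - x0\<bar>)"
          using s by blast
        have "norm (G x) \<le> ?L x0 x"
          unfolding b[OF x] using exp_minus_sq_le_lorentzian[OF t _ x0(2,3)] by simp
        also have "\<dots> \<le> (\<Sum>x0\<in>X. ?L x0 x)"
          using finX x0 L0 by (intro member_le_sum[where f = "\<lambda>x0. ?L x0 x"]) auto
        finally show "norm (G x) \<le> (\<Sum>x0\<in>X. ?L x0 x)" .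
      qed
      also have "\<dots> = (\<Sum>x0\<in>X. integral {-1/2..1/2} (?L x0))"
        using finX by (intro integral_sum lorentzian_integral_le t)
      also have "\<dots> \<le> (\<Sum>x0\<in>X. pi / sqrt (2 * t))"
        by (intro sum_mono lorentzian_integral_le t)
      also have "\<dots> = real (card X) * (pi / sqrt (2 * t))" by simp
      also have "\<dots> \<le> 2 * (pi / sqrt (2 * t))"
        using finX t by (intro mult_right_mono) auto
      finally show ?thesis .
    qed
    ultimately show ?thesis using root by simp
  qed
  show "norm (circle_kernel 1 t k) \<le> min 1 (5 * t powr (- 1 / 2))"
    unfolding circle_kernel_eq
  proof (rule gen[where s = "\<lambda>x. sin (pi * x)" and X = "{0}"])
    fix x :: real assume x: "x \<in> {-1/2..1/2}"
    have "\<bar>sin (pi * x)\<bar> = sin (pi * \<bar>x\<bar>)"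
    proof -
      have "sin (pi * \<bar>x\<bar>) \<ge> 0" using x by (intro sin_ge_zero) (auto intro: mult_left_le)
      thus ?thesis by (cases "x \<ge> 0") auto
    qed
    thus "\<exists>x0\<in>{0, 1 / 2, - 1 / 2}. x0 \<in> {0} \<and> \<bar>x - x0\<bar> \<le> 1 / 2 \<and> \<bar>sin (pi * x)\<bar> = sin (pi * \<bar>x - x0\<bar>)"
      using x by auto
  qed (auto intro!: continuous_intros simp: norm_mult norm_exp_eq_Re)
  have "exp (- (of_real (4 * t))) * circle_kernel (- 1) t k = integral {-1/2..1/2} (\<lambda>x. exp (- (of_real (4 * t))) *
     (exp (- (of_real t * (-1) * of_real (4 * (sin (pi * x))\<^sup>2))) * exp (2 * pi * \<i> * of_int k * of_real x)))"
    unfolding circle_kernel_eq by (rule integral_mult_right[symmetric])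
  also have "norm \<dots> \<le> min 1 (5 * t powr (- 1 / 2))"
  proof (rule gen[where s = "\<lambda>x. cos (pi * x)" and X = "{1/2, -1/2}"])
    fix x :: real assume x: "x \<in> {-1/2..1/2}"
    have c: "- (4 * t) + t * (4 * (sin (pi * x))\<^sup>2) = - (4 * t * (cos (pi * x))\<^sup>2)"
      by (simp add: cos_squared_eq algebra_simps)
    show "norm (exp (- (of_real (4 * t))) * (exp (- (of_real t * (-1) * of_real (4 * (sin (pi * x))\<^sup>2))) * exp (2 * pi * \<i> * of_int k * of_real x)))
       = exp (- (4 * t * (cos (pi * x))\<^sup>2))"
      unfolding c[symmetric] by (simp add: norm_mult norm_exp_eq_Re flip: exp_add)
    have cos0: "cos (pi * x) \<ge> 0"
    proof -
      have "pi * x \<le> pi * (1/2)" "pi * (-1/2) \<le> pi * x"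
        by (intro mult_left_mono; use x in simp)+
      thus ?thesis by (intro cos_ge_zero) auto
    qed
    show "\<exists>x0\<in>{0, 1 / 2, - 1 / 2}. x0 \<in> {1 / 2, - 1 / 2} \<and> \<bar>x - x0\<bar> \<le> 1 / 2 \<and> \<bar>cos (pi * x)\<bar> = sin (pi * \<bar>x - x0\<bar>)"
    proof (cases "x \<ge> 0")
      case True
      hence "pi * \<bar>x - 1/2\<bar> = pi / 2 - pi * x" using x by (simp add: abs_if algebra_simps)
      thus ?thesis using cos0 True x by (auto simp: cos_sin_eq)
    next
      case False
      hence "pi * \<bar>x + 1/2\<bar> = pi / 2 - pi * (- x)" using x by (simp add: abs_if algebra_simps)
      moreover have "cos (pi * x) = cos (pi * (- x))" by simp
      ultimately show ?thesis using cos0 False x by (intro bexI[of _ "-1/2"]) (auto simp: cos_sin_eq)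
    qed
  qed (auto intro!: continuous_intros)
  finally show "norm (exp (- (of_real (4 * t))) * circle_kernel (- 1) t k) \<le> min 1 (5 * t powr (- 1 / 2))" .
qed

lemma prod_le_sum_power:
  fixes x :: "'d::finite \<Rightarrow> real"
  assumes "\<And>j. x j \<ge> 0"
  shows "(\<Prod>j\<in>UNIV. x j) \<le> (\<Sum>j\<in>UNIV. x j ^ CARD('d))"
proof -
  have "Max (range x) \<in> range x" by (intro Max_in) auto
  then obtain j0 where j0: "Max (range x) = x j0" by (rule imageE)
  have le: "x j \<le> x j0" for j unfolding j0[symmetric] by (intro Max_ge) auto
  have "(\<Prod>j\<in>UNIV. x j) \<le> (\<Prod>j\<in>(UNIV :: 'd set). x j0)"
    using assms le by (intro prod_mono) auto
  also have "\<dots> = x j0 ^ CARD('d)" by simp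
  also have "\<dots> \<le> (\<Sum>j\<in>UNIV. x j ^ CARD('d))"
    using assms by (intro member_le_sum[where f = "\<lambda>j. x j ^ CARD('d)"]) auto
  finally show ?thesis .
qed

text \<open>
  The product of the Bessel factors is dominated by the sum of their \<open>d\<close>-th powers, whose time integral
  involves one coordinate at a time.
\<close>
definition bessel_profile :: "int ^ 'd::finite \<Rightarrow> real \<Rightarrow> real" where
  "bessel_profile n t = (\<Sum>j\<in>UNIV. norm (bessel_integral (of_int \<bar>n $ j\<bar>) (2 * t)) ^ CARD('d))"

definition heat_profile :: "'d::finite itself \<Rightarrow> real \<Rightarrow> real" where
  "heat_profile _ t = min 1 (5 * t powr (- 1 / 2)) ^ CARD('d)"

lemma bessel_profile_time_integral:
  assumes "CARD('d::finite) \<ge> 5"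
  shows "\<exists>B\<ge>0. \<forall>n :: int ^ 'd. (\<integral>\<^sup>+t\<in>{0<..}. ennreal (t powr ((real CARD('d) - 1) / 3) * bessel_profile n t) \<partial>lborel) \<le> ennreal B"
proof -
  let ?d = "CARD('d)"
  define p where "p = (real ?d - 1) / 3"
  have p: "p \<ge> 0" using assms by (simp add: p_def)
  obtain B where B: "B \<ge> 0" and Bk: "\<And>k::nat. (\<integral>\<^sup>+\<tau>\<in>{0<..}. ennreal (\<tau> powr p * norm (bessel_integral (real k) \<tau>) ^ ?d) \<partial>lborel) \<le> ennreal B"
    using bessel_power_time_integral[OF assms] unfolding p_def by blast
  have one: "(\<integral>\<^sup>+t\<in>{0<..}. ennreal (t powr p * norm (bessel_integral (real k) (2 * t)) ^ ?d) \<partial>lborel) \<le> ennreal B" for k :: nat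
  proof -
    let ?f = "\<lambda>\<tau>. ennreal (\<tau> powr p * norm (bessel_integral (real k) \<tau>) ^ ?d) * indicator {0<..} \<tau>"
    have "(\<integral>\<^sup>+t\<in>{0<..}. ennreal (t powr p * norm (bessel_integral (real k) (2 * t)) ^ ?d) \<partial>lborel)
      \<le> (\<integral>\<^sup>+t. ?f (0 + 2 * t) \<partial>lborel)"
    proof (rule nn_integral_mono)
      fix t :: real
      show "ennreal (t powr p * norm (bessel_integral (real k) (2 * t)) ^ ?d) * indicator {0<..} t \<le> ?f (0 + 2 * t)"
      proof (cases "t > 0")
        case True
        hence "t powr p \<le> (2 * t) powr p" using p by (intro powr_mono2) auto
        thus ?thesis using True by (auto intro!: ennreal_leI mult_right_mono)
      qed auto
    qed
    also have "\<dots> \<le> ennreal 2 * (\<integral>\<^sup>+t. ?f (0 + 2 * t) \<partial>lborel)"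
      using mult_right_mono[of 1 "ennreal 2"] by simp
    also have "\<dots> = (\<integral>\<^sup>+\<tau>. ?f \<tau> \<partial>lborel)"
      by (subst nn_integral_real_affine[where c = 2 and t = 0 and f = ?f]) auto
    finally show ?thesis using Bk[of k] by (rule order_trans)
  qed
  have "(\<integral>\<^sup>+t\<in>{0<..}. ennreal (t powr p * bessel_profile n t) \<partial>lborel) \<le> ennreal (real ?d * B)" for n :: "int ^ 'd"
  proof -
    have nat: "of_int \<bar>n $ j\<bar> = real (nat \<bar>n $ j\<bar>)" for j by simp
    have "(\<integral>\<^sup>+t\<in>{0<..}. ennreal (t powr p * bessel_profile n t) \<partial>lborel)
       = (\<integral>\<^sup>+t. (\<Sum>j\<in>UNIV. ennreal (t powr p * norm (bessel_integral (real (nat \<bar>n $ j\<bar>)) (2 * t)) ^ ?d) * indicator {0<..} t) \<partial>lborel)"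
      unfolding bessel_profile_def nat
      by (intro nn_integral_cong) (simp add: sum_distrib_left sum_distrib_right[symmetric])
    also have "\<dots> = (\<Sum>j\<in>UNIV. \<integral>\<^sup>+t\<in>{0<..}. ennreal (t powr p * norm (bessel_integral (real (nat \<bar>n $ j\<bar>)) (2 * t)) ^ ?d) \<partial>lborel)"
      by (rule nn_integral_sum) measurable
    also have "\<dots> \<le> (\<Sum>j\<in>(UNIV :: 'd set). ennreal B)" by (intro sum_mono one)
    also have "\<dots> = ennreal (real ?d * B)" using B by (simp add: ennreal_mult' ennreal_of_nat_eq_real_of_nat)
    finally show ?thesis .
  qed
  moreover have "real ?d * B \<ge> 0" using B by simp
  ultimately show ?thesis unfolding p_def by blast
qed

lemma heat_profile_time_integral:
  assumes d: "CARD('d::finite) \<ge> 5"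
  shows "(\<integral>\<^sup>+t\<in>{0<..}. ennreal (t powr ((real CARD('d) - 1) / 3) * heat_profile TYPE('d) t) \<partial>lborel) \<le> ennreal (1 + 6 * 5 ^ CARD('d))"
proof -
  let ?d = "CARD('d)"
  define p where "p = (real ?d - 1) / 3"
  have "(\<integral>\<^sup>+t\<in>{0<..}. ennreal (t powr p * heat_profile TYPE('d) t) \<partial>lborel)
     \<le> (\<integral>\<^sup>+t. indicator {0..1} t + ennreal (5 ^ ?d) * (ennreal (t powr (- 7 / 6)) * indicator {1..} t) \<partial>lborel)"
  proof (rule nn_integral_mono)
    fix t :: real
    consider "t \<le> 0" | "0 < t" "t \<le> 1" | "t > 1" by linarith
    thus "ennreal (t powr p * heat_profile TYPE('d) t) * indicator {0<..} t \<le> indicator {0..1} t + ennreal (5 ^ ?d) * (ennreal (t powr (- 7 / 6)) * indicator {1..} t)"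
    proof cases
      case 2
      have "t powr p \<le> 1 powr p" using 2 d by (intro powr_mono2) (auto simp: p_def)
      moreover have "heat_profile TYPE('d) t \<le> 1 ^ ?d" unfolding heat_profile_def by (intro power_mono) auto
      moreover have "heat_profile TYPE('d) t \<ge> 0" by (simp add: heat_profile_def)
      ultimately have "t powr p * heat_profile TYPE('d) t \<le> 1" using mult_mono[of "t powr p" 1 "heat_profile TYPE('d) t" 1] by simp
      hence "ennreal (t powr p * heat_profile TYPE('d) t) \<le> ennreal 1" by (rule ennreal_leI)
      also have "\<dots> \<le> 1 + ennreal (5 ^ ?d) * (ennreal (t powr (- 7 / 6)) * indicator {1..} t)" by simp
      finally show ?thesis using 2 by simp
    next
      case 3
      have "heat_profile TYPE('d) t \<le> (5 * t powr (- 1 / 2)) ^ ?d" unfolding heat_profile_def by (intro power_mono) auto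
      hence "t powr p * heat_profile TYPE('d) t \<le> t powr p * (5 * t powr (- 1 / 2)) ^ ?d"
        by (intro mult_left_mono) auto
      also have "\<dots> = 5 ^ ?d * t powr (p - real ?d / 2)"
        using 3 by (simp add: power_mult_distrib powr_power powr_add[symmetric])
      also have "\<dots> \<le> 5 ^ ?d * t powr (- 7 / 6)"
        using 3 d by (intro mult_left_mono powr_mono) (auto simp: p_def field_simps)
      finally have "ennreal (t powr p * heat_profile TYPE('d) t) \<le> ennreal (5 ^ ?d * t powr (- 7 / 6))" by (rule ennreal_leI)
      thus ?thesis using 3 by (simp add: ennreal_mult)
    qed auto
  qed
  also have "\<dots> = (\<integral>\<^sup>+t. indicator {0..1::real} t \<partial>lborel) + ennreal (5 ^ ?d) * (\<integral>\<^sup>+t\<in>{1..}. ennreal (t powr (- 7 / 6)) \<partial>lborel)"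
    by (simp add: nn_integral_add nn_integral_cmult)
  also have "\<dots> = 1 + ennreal (5 ^ ?d) * 6"
    unfolding nn_integral_long_time by simp
  also have "\<dots> = ennreal (1 + 6 * 5 ^ ?d)"
    by (simp add: ennreal_mult mult.commute)
  finally show ?thesis by (simp add: p_def)
qed

lemma spectral_interval_facts:
  shows "closed (spectral_interval TYPE('d::finite))" "spectral_interval TYPE('d) \<noteq> {}"
    and "complex_of_real (laplacian_symbol (\<xi> :: real ^ 'd)) \<in> spectral_interval TYPE('d)"
proof -
  have "compact (complex_of_real ` {0..4 * real CARD('d)})"
    by (intro compact_continuous_image continuous_intros compact_Icc)
  thus "closed (spectral_interval TYPE('d))" by (simp add: spectral_interval_def compact_imp_closed)
  show "spectral_interval TYPE('d) \<noteq> {}" by (simp add: spectral_interval_def)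
  show "complex_of_real (laplacian_symbol (\<xi> :: real ^ 'd)) \<in> spectral_interval TYPE('d)"
    using laplacian_symbol_bounds[of \<xi>] by (auto simp: spectral_interval_def)
qed

text \<open>
  If \<open>|Im z| \<ge> \<delta> / 2\<close>, take \<open>\<kappa> = \<plusminus>i\<close>, so that the real part of \<open>\<kappa> (h - z)\<close> is \<open>|Im z|\<close>. Otherwise \<open>Re z\<close> lies
  to the left or to the right of the spectrum at distance at least \<open>\<delta> / 2\<close>, and \<open>\<kappa> = \<plusminus>1\<close> makes the real
  part that large. The two profiles are added so that the bound has the same form in all cases.
\<close>
lemma rotated_resolvent_kernel:
  fixes z :: complex
  defines "\<delta> \<equiv> infdist z (spectral_interval TYPE('d::finite))"
  assumes z: "z \<notin> spectral_interval TYPE('d)"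
  obtains \<kappa> where "norm \<kappa> = 1"
    and "\<And>\<xi> :: real ^ 'd. Re (\<kappa> * (of_real (laplacian_symbol \<xi>) - z)) \<ge> \<delta> / 2"
    and "\<And>t (n :: int ^ 'd). t > 0 \<Longrightarrow>
       norm (semigroup_kernel \<kappa> z t n)
         \<le> exp (- (t * (\<delta> / 2))) * (bessel_profile n t + heat_profile TYPE('d) t)"
proof -
  let ?S = "spectral_interval TYPE('d)" and ?d = "CARD('d)"
  have \<delta>: "\<delta> > 0"
    unfolding \<delta>_def using spectral_interval_facts[where 'd = 'd] z by (intro infdist_pos_not_in_closed) auto
  have dle: "\<delta> \<le> norm (z - of_real x)" if "0 \<le> x" "x \<le> 4 * real ?d" for x
    unfolding \<delta>_def using that by (intro order_trans[OF infdist_le]) (auto simp: spectral_interval_def dist_norm)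
  have bp: "bessel_profile n t \<ge> 0" for n :: "int ^ 'd" and t by (auto simp: bessel_profile_def intro!: sum_nonneg)
  have hp: "heat_profile TYPE('d) t \<ge> 0" for t by (auto simp: heat_profile_def)
  have hb: "0 \<le> laplacian_symbol \<xi>" "laplacian_symbol \<xi> \<le> 4 * real ?d" for \<xi> :: "real ^ 'd"
    by (rule laplacian_symbol_bounds)+
  show thesis
  proof (cases "\<bar>Im z\<bar> \<ge> \<delta> / 2")
    case True
    define \<epsilon> where "\<epsilon> = (if Im z \<ge> 0 then 1 else -1 :: real)"
    have e: "\<epsilon> = 1 \<or> \<epsilon> = -1" by (simp add: \<epsilon>_def)
    have im: "\<epsilon> * Im z \<ge> \<delta> / 2" using True by (auto simp: \<epsilon>_def)
    show thesis
    proof (rule that[of "\<i> * of_real \<epsilon>"])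
      show "norm (\<i> * of_real \<epsilon>) = 1" using e by auto
      show "Re (\<i> * of_real \<epsilon> * (of_real (laplacian_symbol \<xi>) - z)) \<ge> \<delta> / 2" for \<xi> :: "real ^ 'd"
        using im by simp
      fix t :: real and n :: "int ^ 'd" assume t: "t > 0"
      have "norm (exp (of_real t * (\<i> * of_real \<epsilon>) * z)) \<le> exp (- (t * (\<delta> / 2)))"
        using t im mult_left_mono[OF im, of t] by (simp add: norm_exp_eq_Re algebra_simps)
      moreover have "norm (\<Prod>j\<in>UNIV. circle_kernel (\<i> * of_real \<epsilon>) t (n $ j)) \<le> bessel_profile n t + heat_profile TYPE('d) t"
      proof -
        have "norm (\<Prod>j\<in>UNIV. circle_kernel (\<i> * of_real \<epsilon>) t (n $ j)) \<le> (\<Prod>j\<in>UNIV. norm (bessel_integral (of_int \<bar>n $ j\<bar>) (2 * \<bar>t\<bar>)))"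
          unfolding prod_norm[symmetric] by (intro prod_mono conjI norm_ge_zero circle_kernel_oscillatory e)
        also have "\<dots> \<le> bessel_profile n t"
          unfolding bessel_profile_def using t prod_le_sum_power[of "\<lambda>j. norm (bessel_integral (of_int \<bar>n $ j\<bar>) (2 * t))"] by simp
        finally show ?thesis using hp[of t] by linarith
      qed
      ultimately show "norm (semigroup_kernel (\<i> * of_real \<epsilon>) z t n)
         \<le> exp (- (t * (\<delta> / 2))) * (bessel_profile n t + heat_profile TYPE('d) t)"
        unfolding semigroup_kernel_product norm_mult by (intro mult_mono) auto
    qed
  next
    case False
    have out: "Re z \<le> - \<delta> / 2 \<or> Re z \<ge> 4 * real ?d + \<delta> / 2"
    proof (rule ccontr)
      assume h: "\<not> ?thesis"
      \<comment> \<open>The point of the spectrum closest to \<open>Re z\<close>.\<close>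
      define x where "x = max 0 (min (4 * real ?d) (Re z))"
      have x: "0 \<le> x" "x \<le> 4 * real ?d" by (auto simp: x_def)
      have "\<bar>Re z - x\<bar> < \<delta> / 2" using h \<delta> by (auto simp: x_def max_def min_def abs_if)
      moreover have "norm (z - of_real x) \<le> \<bar>Re z - x\<bar> + \<bar>Im z\<bar>"
        using cmod_le[of "z - of_real x"] by simp
      ultimately show False using dle[OF x] False by linarith
    qed
    thus thesis
    proof
      assume neg: "Re z \<le> - \<delta> / 2"
      show thesis
      proof (rule that[of 1])
        show "Re (1 * (of_real (laplacian_symbol \<xi>) - z)) \<ge> \<delta> / 2" for \<xi> :: "real ^ 'd"
          using neg hb[of \<xi>] by simp
        fix t :: real and n :: "int ^ 'd" assume t: "t > 0"
        have "norm (exp (of_real t * 1 * z)) \<le> exp (- (t * (\<delta> / 2)))"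
          using mult_left_mono[OF neg, of t] t by (simp add: norm_exp_eq_Re)
        moreover have "norm (\<Prod>j\<in>UNIV. circle_kernel 1 t (n $ j)) \<le> bessel_profile n t + heat_profile TYPE('d) t"
        proof -
          have "norm (\<Prod>j\<in>UNIV. circle_kernel 1 t (n $ j)) \<le> (\<Prod>j\<in>(UNIV :: 'd set). min 1 (5 * t powr (- 1 / 2)))"
            unfolding prod_norm[symmetric] by (intro prod_mono conjI norm_ge_zero circle_kernel_heat t)
          also have "\<dots> = heat_profile TYPE('d) t" by (simp add: heat_profile_def)
          finally show ?thesis using bp[of n t] by linarith
        qed
        ultimately show "norm (semigroup_kernel 1 z t n)
           \<le> exp (- (t * (\<delta> / 2))) * (bessel_profile n t + heat_profile TYPE('d) t)"
          unfolding semigroup_kernel_product norm_mult by (intro mult_mono) auto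
      qed simp
    next
      assume pos: "Re z \<ge> 4 * real ?d + \<delta> / 2"
      show thesis
      proof (rule that[of "-1"])
        show "Re (-1 * (of_real (laplacian_symbol \<xi>) - z)) \<ge> \<delta> / 2" for \<xi> :: "real ^ 'd"
          using pos hb[of \<xi>] by simp
        fix t :: real and n :: "int ^ 'd" assume t: "t > 0"
        have split: "exp (of_real t * (-1) * z) * (\<Prod>j\<in>UNIV. circle_kernel (-1) t (n $ j))
          = exp (of_real t * (of_real (4 * real ?d) - z)) * (\<Prod>j\<in>UNIV. exp (- (of_real (4 * t))) * circle_kernel (-1) t (n $ j))"
        proof -
          have "(\<Prod>j\<in>UNIV. exp (- (of_real (4 * t))) * circle_kernel (-1) t (n $ j)) = exp (- (of_real (4 * t))) ^ ?d * (\<Prod>j\<in>UNIV. circle_kernel (-1) t (n $ j))"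
            by (simp add: prod.distrib)
          moreover have "exp (- (of_real (4 * t))) ^ ?d = exp (of_nat ?d * (- (complex_of_real (4 * t))))"
            by (simp only: exp_of_nat_mult)
          ultimately show ?thesis by (simp add: exp_add[symmetric] mult.assoc[symmetric]) (simp add: algebra_simps)
        qed
        have "norm (exp (of_real t * (of_real (4 * real ?d) - z))) \<le> exp (- (t * (\<delta> / 2)))"
          using mult_left_mono[OF pos, of t] t by (simp add: norm_exp_eq_Re algebra_simps)
        moreover have "norm (\<Prod>j\<in>UNIV. exp (- (of_real (4 * t))) * circle_kernel (-1) t (n $ j)) \<le> bessel_profile n t + heat_profile TYPE('d) t"
        proof -
          have "norm (\<Prod>j\<in>UNIV. exp (- (of_real (4 * t))) * circle_kernel (-1) t (n $ j)) \<le> (\<Prod>j\<in>(UNIV :: 'd set). min 1 (5 * t powr (- 1 / 2)))"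
            unfolding prod_norm[symmetric] by (intro prod_mono conjI norm_ge_zero circle_kernel_heat t)
          also have "\<dots> = heat_profile TYPE('d) t" by (simp add: heat_profile_def)
          finally show ?thesis using bp[of n t] by linarith
        qed
        ultimately show "norm (semigroup_kernel (-1) z t n)
           \<le> exp (- (t * (\<delta> / 2))) * (bessel_profile n t + heat_profile TYPE('d) t)"
          unfolding semigroup_kernel_product split norm_mult[of "exp (of_real t * (of_real (4 * real ?d) - z))"] by (intro mult_mono) auto
      qed simp
    qed
  qed
qed

section \<open>The resolvent kernel and the Birman-Schwinger principle\<close>

lemma has_sum_minus:
  fixes f g :: "'a \<Rightarrow> complex"
  assumes "(f has_sum a) A" "(g has_sum b) A"
  shows "((\<lambda>x. f x - g x) has_sum (a - b)) A"
proof -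
  have "((\<lambda>x. - g x) has_sum (- b)) A" using assms(2) by (simp add: has_sum_uminus)
  from has_sum_add[OF assms(1) this] show ?thesis by simp
qed

lemma has_sum_sum_finite:
  fixes f :: "'i \<Rightarrow> 'a \<Rightarrow> complex"
  assumes "\<And>i. i \<in> I \<Longrightarrow> (f i has_sum s i) A"
  shows "((\<lambda>x. \<Sum>i\<in>I. f i x) has_sum (\<Sum>i\<in>I. s i)) A"
proof -
  have "((\<lambda>F. \<Sum>i\<in>I. sum (f i) F) \<longlongrightarrow> (\<Sum>i\<in>I. s i)) (finite_subsets_at_top A)"
    using assms by (intro tendsto_sum) (auto simp: has_sum_def)
  moreover have "(\<lambda>F. \<Sum>i\<in>I. sum (f i) F) = sum (\<lambda>x. \<Sum>i\<in>I. f i x)"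
    by (intro ext sum.swap)
  ultimately show ?thesis by (simp add: has_sum_def)
qed

lemma ell_2_mult_summable:
  assumes "f \<in> ell 2" "g \<in> ell 2"
  shows "(\<lambda>n. f n * g n) summable_on UNIV"
proof -
  have sum: "(\<lambda>n. (norm (f n))\<^sup>2 + (norm (g n))\<^sup>2) summable_on UNIV"
    using assms by (intro summable_on_add) (auto simp: ell_2_iff)
  have le: "norm (f n * g n) \<le> (norm (f n))\<^sup>2 + (norm (g n))\<^sup>2" for n
  proof -
    have "2 * (norm (f n) * norm (g n)) \<le> (norm (f n))\<^sup>2 + (norm (g n))\<^sup>2"
      using sum_squares_bound[of "norm (f n)" "norm (g n)"] by (simp add: mult.assoc)
    moreover have "0 \<le> norm (f n) * norm (g n)" by simp
    ultimately show ?thesis unfolding norm_mult by linarith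
  qed
  have "(\<lambda>n. norm (f n * g n)) summable_on UNIV"
    by (rule summable_on_comparison_test[OF sum le]) auto
  thus ?thesis by (rule abs_summable_summable)
qed

lemma bij_minus_left: "bij (\<lambda>n :: int ^ 'd. m - n)"
  by (rule bij_betw_byWitness[where f' = "\<lambda>n. m - n"]) auto

lemma bij_plus_right: "bij (\<lambda>n :: int ^ 'd. n + m)"
  by (rule bij_betw_byWitness[where f' = "\<lambda>n. n - m"]) auto

lemma ell_2_reflect:
  fixes f :: "int ^ 'd::finite \<Rightarrow> complex"
  assumes "f \<in> ell 2"
  shows "(\<lambda>n. f (m - n)) \<in> ell 2"
  using assms summable_on_reindex_bij_betw[OF bij_minus_left, of "\<lambda>n. (norm (f n))\<^sup>2"]
  by (simp add: ell_2_iff)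

definition resolvent_kernel :: "complex \<Rightarrow> int ^ 'd::finite \<Rightarrow> complex" where
  "resolvent_kernel z = multiplier_kernel (\<lambda>\<xi>. 1 / (of_real (laplacian_symbol \<xi>) - z))"

lemma resolvent_symbol_props:
  fixes z :: complex
  defines "\<delta> \<equiv> infdist z (spectral_interval TYPE('d::finite))"
  assumes z: "z \<notin> spectral_interval TYPE('d)"
  shows "\<delta> > 0" and "norm (of_real (laplacian_symbol (\<xi> :: real ^ 'd)) - z) \<ge> \<delta>"
    and "of_real (laplacian_symbol \<xi>) - z \<noteq> 0"
    and "norm (1 / (of_real (laplacian_symbol \<xi>) - z)) \<le> 1 / \<delta>"
    and "norm (of_real (laplacian_symbol (\<xi> :: real ^ 'd)) - z) \<le> 4 * real CARD('d) + norm z"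
    and "(\<lambda>\<xi> :: real ^ 'd. 1 / (of_real (laplacian_symbol \<xi>) - z)) \<in> borel_measurable borel"
proof -
  show d: "\<delta> > 0"
    unfolding \<delta>_def using spectral_interval_facts[where 'd = 'd] z by (intro infdist_pos_not_in_closed) auto
  show le: "norm (of_real (laplacian_symbol \<xi>) - z) \<ge> \<delta>" for \<xi> :: "real ^ 'd"
    unfolding \<delta>_def using infdist_le[OF spectral_interval_facts(3)[of \<xi>], of z] by (simp add: dist_norm norm_minus_commute)
  show "of_real (laplacian_symbol \<xi>) - z \<noteq> 0" using le[of \<xi>] d by auto
  show "norm (1 / (of_real (laplacian_symbol \<xi>) - z)) \<le> 1 / \<delta>"
    using le[of \<xi>] d by (simp add: norm_divide frac_le)
  show "norm (of_real (laplacian_symbol (\<xi> :: real ^ 'd)) - z) \<le> 4 * real CARD('d) + norm z"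
    using norm_triangle_ineq4[of "complex_of_real (laplacian_symbol \<xi>)" z] laplacian_symbol_bounds[of \<xi>] by simp
  show "(\<lambda>\<xi> :: real ^ 'd. 1 / (of_real (laplacian_symbol \<xi>) - z)) \<in> borel_measurable borel"
    by measurable
qed

text \<open>
  Bessel's inequality, obtained by testing the multiplier form with the kernel itself against a unit
  vector.
\<close>
lemma resolvent_kernel_ell_2:
  assumes z: "z \<notin> spectral_interval TYPE('d::finite)"
  shows "(resolvent_kernel z :: int ^ 'd \<Rightarrow> complex) \<in> ell 2"
  unfolding ell_2_iff
proof (rule nonneg_bounded_partial_sums_imp_summable_on)
  let ?K = "resolvent_kernel z :: int ^ 'd \<Rightarrow> complex"
  define \<delta> where "\<delta> = infdist z (spectral_interval TYPE('d))"
  note p = resolvent_symbol_props[OF z, folded \<delta>_def]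
  have "(\<Sum>n\<in>A. (norm (?K n))\<^sup>2) \<le> (1 / \<delta>)\<^sup>2" if A: "finite A" for A
  proof -
    define L where "L = L2_set (\<lambda>n. norm (?K n)) A"
    have L: "L \<ge> 0" "L\<^sup>2 = (\<Sum>n\<in>A. (norm (?K n))\<^sup>2)"
      by (auto simp: L_def L2_set_def sum_nonneg)
    have "norm (\<Sum>m\<in>A. \<Sum>n\<in>{0}. cnj (?K m) * (LINT \<xi>|torus_measure. 1 / (of_real (laplacian_symbol \<xi>) - z) * character (m - n) \<xi>) * 1)
      \<le> 1 / \<delta> * (L2_set (\<lambda>m. norm (cnj (?K m))) A * L2_set (\<lambda>n. norm (1 :: complex)) {0 :: int ^ 'd})"
      by (rule multiplier_form_bound[OF A _ p(6,4)]) simp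
    also have "(\<Sum>m\<in>A. \<Sum>n\<in>{0}. cnj (?K m) * (LINT \<xi>|torus_measure. 1 / (of_real (laplacian_symbol \<xi>) - z) * character (m - n) \<xi>) * 1)
       = (\<Sum>m\<in>A. of_real ((norm (?K m))\<^sup>2))"
    proof (rule sum.cong[OF refl])
      fix m
      have "(LINT \<xi>|torus_measure. 1 / (of_real (laplacian_symbol \<xi>) - z) * character (m - 0) \<xi>) = ?K m"
        by (simp only: resolvent_kernel_def multiplier_kernel_def diff_zero)
      thus "(\<Sum>n\<in>{0}. cnj (?K m) * (LINT \<xi>|torus_measure. 1 / (of_real (laplacian_symbol \<xi>) - z) * character (m - n) \<xi>) * 1) = of_real ((norm (?K m))\<^sup>2)"
        using complex_norm_square[of "?K m"] by (simp add: mult.commute)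
    qed
    also have "\<dots> = of_real (L\<^sup>2)" by (simp add: L)
    finally have "L\<^sup>2 \<le> 1 / \<delta> * L" by (simp add: L_def norm_power)
    hence "L * L \<le> 1 / \<delta> * L" by (simp add: power2_eq_square)
    hence "L \<le> 1 / \<delta>" using L(1) p(1) mult_right_le_imp_le[of L L "1 / \<delta>"] by (cases "L = 0") auto
    hence "L\<^sup>2 \<le> (1 / \<delta>)\<^sup>2" using L(1) by (intro power_mono)
    thus ?thesis by (simp add: L)
  qed
  thus "eventually (\<lambda>A. (\<Sum>n\<in>A. (norm (?K n))\<^sup>2) \<le> (1 / \<delta>)\<^sup>2) (finite_subsets_at_top UNIV)"
    by (intro eventually_finite_subsets_at_top_weakI) auto
qed auto

lemma resolvent_kernel_green:
  fixes k :: "int ^ 'd::finite"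
  assumes z: "z \<notin> spectral_interval TYPE('d)"
  shows "(difference_laplacian (resolvent_kernel z) k) - z * resolvent_kernel z k
       = of_bool (k = 0)"
proof -
  note p = resolvent_symbol_props[OF z]
  define r where "r = (\<lambda>\<xi> :: real ^ 'd. 1 / (of_real (laplacian_symbol \<xi>) - z))"
  have rb: "norm (r \<xi>) \<le> 1 / infdist z (spectral_interval TYPE('d))" for \<xi>
    unfolding r_def by (rule p(4))
  have [measurable]: "r \<in> borel_measurable borel"
    unfolding r_def by (rule p(6))
  have int: "integrable torus_measure (\<lambda>\<xi>. r \<xi> * character m \<xi>)" for m
    by (rule torus.integrable_const_bound[of _ "1 / infdist z (spectral_interval TYPE('d))"])
       (auto simp: norm_mult rb)
  have K: "resolvent_kernel z m = (LINT \<xi>|torus_measure. r \<xi> * character m \<xi>)" for m :: "int ^ 'd"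
    by (simp add: resolvent_kernel_def multiplier_kernel_def r_def)
  have "(difference_laplacian (resolvent_kernel z) k) - z * resolvent_kernel z k
    = (LINT \<xi>|torus_measure. (\<Sum>j\<in>UNIV. 2 * (r \<xi> * character k \<xi>) - r \<xi> * character (k + axis j 1) \<xi> - r \<xi> * character (k - axis j 1) \<xi>) - z * (r \<xi> * character k \<xi>))"
    unfolding K using int by (simp add: Bochner_Integration.integral_sum)
  also have "\<dots> = (LINT \<xi>|torus_measure. character k \<xi>)"
  proof (rule Bochner_Integration.integral_cong[OF refl])
    fix \<xi> :: "real ^ 'd"
    have "(\<Sum>j\<in>UNIV. 2 * (r \<xi> * character k \<xi>) - r \<xi> * character (k + axis j 1) \<xi> - r \<xi> * character (k - axis j 1) \<xi>)
       = r \<xi> * character k \<xi> * (\<Sum>j\<in>UNIV. 2 - character (axis j 1) \<xi> - character (- axis j 1) \<xi>)"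
      using character_add[of k "- _" \<xi>] by (simp add: sum_distrib_left character_add algebra_simps)
    also have "\<dots> = r \<xi> * character k \<xi> * of_real (laplacian_symbol \<xi>)" by (simp only: laplacian_symbol_eq)
    finally have "(\<Sum>j\<in>UNIV. 2 * (r \<xi> * character k \<xi>) - r \<xi> * character (k + axis j 1) \<xi> - r \<xi> * character (k - axis j 1) \<xi>) - z * (r \<xi> * character k \<xi>)
      = (r \<xi> * (of_real (laplacian_symbol \<xi>) - z)) * character k \<xi>" by (simp add: algebra_simps)
    also have "r \<xi> * (of_real (laplacian_symbol \<xi>) - z) = 1" using p(3)[of \<xi>] by (simp add: r_def)
    finally show "(\<Sum>j\<in>UNIV. 2 * (r \<xi> * character k \<xi>) - r \<xi> * character (k + axis j 1) \<xi> - r \<xi> * character (k - axis j 1) \<xi>) - z * (r \<xi> * character k \<xi>)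
      = character k \<xi>" by simp
  qed
  finally show ?thesis by (simp add: character_integral)
qed

text \<open>
  Summation by parts moves the difference operator from \<open>f\<close> to the kernel, where it produces a point mass.
  All rearrangements are justified by square summability.
\<close>
lemma resolvent_kernel_inverts:
  fixes f :: "int ^ 'd::finite \<Rightarrow> complex"
  assumes z: "z \<notin> spectral_interval TYPE('d)" and f: "f \<in> ell 2"
  shows "((\<lambda>n. resolvent_kernel z (m - n) * (discrete_laplacian f n - z * f n)) has_sum f m) UNIV"
proof -
  let ?K = "resolvent_kernel z :: int ^ 'd \<Rightarrow> complex"
  define T where "T = (\<lambda>k. infsum (\<lambda>n. ?K (k - n) * f n) UNIV)"
  have T: "((\<lambda>n. ?K (k - n) * f n) has_sum T k) UNIV" for k
    unfolding T_def by (intro has_sum_infsum ell_2_mult_summable ell_2_reflect resolvent_kernel_ell_2 z f)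
  have S: "((\<lambda>n. ?K (m - n) * f (n + e)) has_sum T (m + e)) UNIV" for e
  proof -
    have "((\<lambda>n. ?K (m + e - (n + e)) * f (n + e)) has_sum T (m + e)) UNIV"
      using has_sum_reindex_bij_betw[OF bij_plus_right, of "\<lambda>n. ?K (m + e - n) * f n" e] T by blast
    thus ?thesis by simp
  qed
  let ?X = "(difference_laplacian T m) - z * T m"
  have "((\<lambda>n. (\<Sum>j\<in>UNIV. 2 * (?K (m - n) * f (n + 0)) - ?K (m - n) * f (n + axis j 1) - ?K (m - n) * f (n + (- axis j 1))) - z * (?K (m - n) * f (n + 0)))
     has_sum ((\<Sum>j\<in>UNIV. 2 * T (m + 0) - T (m + axis j 1) - T (m + (- axis j 1))) - z * T (m + 0))) UNIV"
    by (intro has_sum_minus has_sum_sum_finite has_sum_cmult_right S)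
  hence 1: "((\<lambda>n. ?K (m - n) * (discrete_laplacian f n - z * f n)) has_sum ?X) UNIV"
    by (simp add: discrete_laplacian_difference[OF f] algebra_simps sum_distrib_left)
  have "((\<lambda>n. (\<Sum>j\<in>UNIV. 2 * (?K (m - n) * f n) - ?K (m + axis j 1 - n) * f n - ?K (m - axis j 1 - n) * f n) - z * (?K (m - n) * f n)) has_sum ?X) UNIV"
    by (intro has_sum_minus has_sum_sum_finite has_sum_cmult_right T)
  moreover have "(\<Sum>j\<in>UNIV. 2 * (?K (m - n) * f n) - ?K (m + axis j 1 - n) * f n - ?K (m - axis j 1 - n) * f n) - z * (?K (m - n) * f n)
      = of_bool (n = m) * f n" for n
  proof -
    have sh: "m + axis j 1 - n = (m - n) + axis j 1" "m - axis j 1 - n = (m - n) - axis j 1" for j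
      by (simp_all add: algebra_simps)
    have "(\<Sum>j\<in>UNIV. 2 * (?K (m - n) * f n) - ?K (m + axis j 1 - n) * f n - ?K (m - axis j 1 - n) * f n) - z * (?K (m - n) * f n)
      = ((difference_laplacian ?K (m - n)) - z * ?K (m - n)) * f n"
      unfolding sh by (simp add: left_diff_distrib sum_distrib_right mult.assoc)
    also have "\<dots> = of_bool (n = m) * f n"
      unfolding resolvent_kernel_green[OF z] by auto
    finally show ?thesis .
  qed
  ultimately have 2: "((\<lambda>n. of_bool (n = m) * f n) has_sum ?X) UNIV" by simp
  have "((\<lambda>n. of_bool (n = m) * f n) has_sum f m) UNIV"
    by (rule has_sum_finite_neutralI[of "{m}"]) auto
  with 2 have "?X = f m" by (rule has_sum_unique)
  with 1 show ?thesis by simp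
qed

lemma ell_norm_powr:
  fixes V :: "int ^ 'd::finite \<Rightarrow> complex"
  assumes "s > 0" "V \<in> ell s"
  shows "ell_norm s V \<ge> 0" "ell_norm s V powr s = (\<Sum>\<^sub>\<infinity>n. norm (V n) powr s)"
    and "norm (V n) \<le> ell_norm s V"
proof -
  have I: "(\<Sum>\<^sub>\<infinity>n. norm (V n) powr s) \<ge> 0" by (rule infsum_nonneg) simp
  show 1: "ell_norm s V \<ge> 0" by (simp add: ell_norm_def)
  show 2: "ell_norm s V powr s = (\<Sum>\<^sub>\<infinity>n. norm (V n) powr s)"
    using assms I by (simp add: ell_norm_def powr_powr)
  have "norm (V n) powr s = (\<Sum>n\<in>{n}. norm (V n) powr s)" by simp
  also have "\<dots> \<le> (\<Sum>\<^sub>\<infinity>n. norm (V n) powr s)"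
    using assms by (intro finite_sum_le_infsum) (auto simp: ell_def)
  finally have "norm (V n) powr s \<le> ell_norm s V powr s" by (simp add: 2)
  thus "norm (V n) \<le> ell_norm s V"
    using assms(1) 1 by (metis linorder_not_less norm_ge_zero powr_less_mono2)
qed

text \<open>
  The weights \<open>W = (|V| / \<parallel>V\<parallel>\<^sub>s) powr (s / 2)\<close> have square sum at most one, and
  \<open>|V|\<^sup>1\<^sup>/\<^sup>2 = \<parallel>V\<parallel>\<^sub>s\<^sup>1\<^sup>/\<^sup>2 W powr (1 / s)\<close>, which is the form treated by the interpolation.
\<close>
lemma birman_schwinger_form_bound:
  fixes s0 s :: real
  assumes d: "CARD('d::finite) \<ge> 5" and s0: "s0 = (real CARD('d) + 2) / 3" and s: "s \<ge> s0"
  shows "\<exists>C>0. \<forall>(V :: int ^ 'd \<Rightarrow> complex) z A B a b. V \<in> ell s \<longrightarrow> z \<notin> spectral_interval TYPE('d) \<longrightarrow> finite A \<longrightarrow> finite B \<longrightarrow>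
     norm (weighted_form (resolvent_kernel z) (\<lambda>n. sqrt (norm (V n))) A B a b)
      \<le> C * ell_norm s V * infdist z (spectral_interval TYPE('d)) powr (- (1 - s0 / s))
          * (l2_norm a A * l2_norm b B)"
proof -
  have s01: "s0 \<ge> 1" using d by (simp add: s0)
  have sp: "s > 0" using s s01 by simp
  obtain B0 where B0: "B0 \<ge> 0" and BP: "\<And>n :: int ^ 'd. (\<integral>\<^sup>+t\<in>{0<..}. ennreal (t powr ((real CARD('d) - 1) / 3) * bessel_profile n t) \<partial>lborel) \<le> ennreal B0"
    using bessel_profile_time_integral[OF d] by blast
  define Bd where "Bd = B0 + (1 + 6 * 5 ^ CARD('d))"
  have Bd: "Bd \<ge> 0" using B0 by (simp add: Bd_def)
  define C where "C = exp (s0\<^sup>2 + 2) * (exp ((s0 * pi)\<^sup>2) + 2 * rGamma (s0 + (1 - s0 / s)) * Bd)"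
  have "rGamma (s0 + (1 - s0 / s)) \<ge> 0"
    using s01 s sp Gamma_real_pos[of "s0 + (1 - s0 / s)"] by (simp add: rGamma_inverse_Gamma add_pos_nonneg)
  hence C: "C > 0" using Bd by (auto simp: C_def intro!: mult_pos_pos add_pos_nonneg)
  define P where "P = (\<lambda>(n :: int ^ 'd) t. bessel_profile n t + heat_profile TYPE('d) t)"
  have [measurable]: "bessel_profile (n :: int ^ 'd) \<in> borel_measurable borel" "heat_profile TYPE('d) \<in> borel_measurable borel" for n
    unfolding bessel_profile_def[abs_def] heat_profile_def[abs_def] by measurable
  have pr0: "bessel_profile n t \<ge> 0" "heat_profile TYPE('d) t \<ge> 0" for n :: "int ^ 'd" and t
    by (auto simp: bessel_profile_def heat_profile_def intro!: sum_nonneg)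
  have PB: "(\<integral>\<^sup>+t\<in>{0<..}. ennreal (t powr (s0 - 1) * P n t) \<partial>lborel) \<le> ennreal Bd" for n
  proof -
    have e: "s0 - 1 = (real CARD('d) - 1) / 3" by (simp add: s0 field_simps)
    have "(\<integral>\<^sup>+t\<in>{0<..}. ennreal (t powr (s0 - 1) * P n t) \<partial>lborel)
       = (\<integral>\<^sup>+t. ennreal (t powr (s0 - 1) * bessel_profile n t) * indicator {0<..} t + ennreal (t powr (s0 - 1) * heat_profile TYPE('d) t) * indicator {0<..} t \<partial>lborel)"
      using pr0 by (intro nn_integral_cong) (simp add: P_def distrib_left distrib_right ennreal_plus[symmetric] del: ennreal_plus split: split_indicator)
    also have "\<dots> = (\<integral>\<^sup>+t\<in>{0<..}. ennreal (t powr (s0 - 1) * bessel_profile n t) \<partial>lborel) + (\<integral>\<^sup>+t\<in>{0<..}. ennreal (t powr (s0 - 1) * heat_profile TYPE('d) t) \<partial>lborel)"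
      by (rule nn_integral_add) measurable
    also have "\<dots> \<le> ennreal B0 + ennreal (1 + 6 * 5 ^ CARD('d))"
      unfolding e by (intro add_mono BP heat_profile_time_integral d)
    also have "\<dots> = ennreal Bd" using B0 by (simp add: Bd_def)
    finally show ?thesis .
  qed
  show ?thesis
  proof (intro exI[of _ C] conjI allI impI C)
    fix V :: "int ^ 'd \<Rightarrow> complex" and z :: complex and A B :: "(int ^ 'd) set" and a b :: "int ^ 'd \<Rightarrow> complex"
    assume V: "V \<in> ell s" and z: "z \<notin> spectral_interval TYPE('d)" and A: "finite A" and B: "finite B"
    define \<delta> where "\<delta> = infdist z (spectral_interval TYPE('d))"
    define N where "N = ell_norm s V"
    note p = resolvent_symbol_props[OF z, folded \<delta>_def]
    note Vs = ell_norm_powr[OF sp V, folded N_def]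
    show "norm (weighted_form (resolvent_kernel z) (\<lambda>n. sqrt (norm (V n))) A B a b)
      \<le> C * N * \<delta> powr (- (1 - s0 / s)) * (l2_norm a A * l2_norm b B)"
    proof (cases "N = 0")
      case True
      hence "V n = 0" for n using Vs(3)[of n] by simp
      thus ?thesis using True by simp
    next
      case False
      hence N: "N > 0" using Vs(1) by simp
      define W where "W = (\<lambda>n. (norm (V n) / N) powr (s / 2))"
      have W2: "(W n)\<^sup>2 = norm (V n) powr s / N powr s" for n
        using N by (simp add: W_def powr_divide power_divide power2_eq_square flip: powr_add)
      have Wsum: "(\<Sum>n\<in>X. (W n)\<^sup>2) \<le> 1" if "finite X" for X
      proof -
        have "(\<Sum>n\<in>X. norm (V n) powr s) \<le> N powr s"
          unfolding Vs(2) using that V by (intro finite_sum_le_infsum) (auto simp: ell_def)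
        thus ?thesis using N unfolding W2 by (simp add: sum_divide_distrib[symmetric])
      qed
      have sqrtV: "sqrt (norm (V n)) = sqrt N * W n powr (1 / s)" for n
      proof -
        have "W n powr (1 / s) = (norm (V n) / N) powr (1 / 2)"
          using sp by (simp add: W_def powr_powr)
        also have "\<dots> = sqrt (norm (V n) / N)" using N by (simp add: powr_half_sqrt)
        finally show ?thesis using N by (simp add: real_sqrt_divide)
      qed
      obtain \<kappa> where \<kappa>: "norm \<kappa> = 1"
        and re: "\<And>\<xi> :: real ^ 'd. Re (\<kappa> * (of_real (laplacian_symbol \<xi>) - z)) \<ge> \<delta> / 2"
        and q: "\<And>t (n :: int ^ 'd). t > 0 \<Longrightarrow>
          norm (semigroup_kernel \<kappa> z t n) \<le> exp (- (t * (\<delta> / 2))) * (bessel_profile n t + heat_profile TYPE('d) t)"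
        by (rule rotated_resolvent_kernel[OF z, folded \<delta>_def], rule that)
      have \<kappa>0: "\<kappa> \<noteq> 0" using \<kappa> by auto
      let ?l = "\<lambda>\<xi> :: real ^ 'd. \<kappa> * (of_real (laplacian_symbol \<xi>) - z)"
      let ?form = "weighted_form (multiplier_kernel (\<lambda>\<xi>. 1 / ?l \<xi>)) (\<lambda>n. W n powr (1 / s)) A B a b"
      have form: "norm ?form \<le> C * \<delta> powr (- (1 - s0 / s)) * (l2_norm a A * l2_norm b B)"
        unfolding C_def
      proof (rule interpolated_form_bound[where \<delta> = \<delta> and \<Lambda> = "4 * real CARD('d) + norm z" and P = P])
        show "continuous_on UNIV ?l" by (intro continuous_intros)
        show "norm (?l \<xi>) \<ge> \<delta>" for \<xi> using p(2)[of \<xi>] \<kappa> by (simp add: norm_mult)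
        show "norm (?l \<xi>) \<le> 4 * real CARD('d) + norm z" for \<xi> using p(5)[of \<xi>] \<kappa> by (simp add: norm_mult)
        show "P n \<in> borel_measurable borel" for n unfolding P_def by measurable
        show "P n t \<ge> 0" for n t using pr0 by (simp add: P_def)
        show "norm (multiplier_kernel (\<lambda>\<xi>. exp (- (of_real t * ?l \<xi>))) n) \<le> exp (- (t * (\<delta> / 2))) * P n t" if "t > 0" for t n
          unfolding P_def by (rule q[OF that])
      qed (use p re PB A B Wsum Bd s s01 in \<open>auto simp: W_def\<close>)
      have ker: "resolvent_kernel z n = \<kappa> * multiplier_kernel (\<lambda>\<xi>. 1 / ?l \<xi>) n" for n :: "int ^ 'd"
      proof -
        have "resolvent_kernel z n = multiplier_kernel (\<lambda>\<xi>. \<kappa> * (1 / ?l \<xi>)) n"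
          using \<kappa>0 by (simp add: resolvent_kernel_def)
        also have "\<dots> = \<kappa> * multiplier_kernel (\<lambda>\<xi>. 1 / ?l \<xi>) n"
          unfolding multiplier_kernel_def mult.assoc by (rule integral_mult_right_zero)
        finally show ?thesis .
      qed
      have NN: "complex_of_real (sqrt N) * complex_of_real (sqrt N) = of_real N"
        using N by (simp flip: of_real_mult)
      have "a m * of_real (sqrt (norm (V m))) * resolvent_kernel z (m - n) * of_real (sqrt (norm (V n))) * b n
         = (of_real N * \<kappa>) * (a m * of_real (W m powr (1 / s)) * multiplier_kernel (\<lambda>\<xi>. 1 / ?l \<xi>) (m - n) * of_real (W n powr (1 / s)) * b n)" for m n
        unfolding sqrtV ker NN[symmetric] by (simp add: mult_ac)
      hence "(weighted_form (resolvent_kernel z) (\<lambda>n. sqrt (norm (V n))) A B a b)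
         = (of_real N * \<kappa>) * ?form" by (simp only: sum_distrib_left)
      hence "norm (weighted_form (resolvent_kernel z) (\<lambda>n. sqrt (norm (V n))) A B a b)
         = N * norm ?form" using N \<kappa> by (simp only: norm_mult) simp
      also have "\<dots> \<le> N * (C * \<delta> powr (- (1 - s0 / s)) * (l2_norm a A * l2_norm b B))"
        using N form by (intro mult_left_mono) auto
      finally show ?thesis by (simp add: mult_ac)
    qed
  qed
qed

text \<open>
  With \<open>x = |V|\<^sup>1\<^sup>/\<^sup>2 f\<close> the eigenvalue equation gives \<open>x = |V|\<^sup>1\<^sup>/\<^sup>2 (H\<^sub>0 - z)\<^sup>-\<^sup>1 |V|\<^sup>1\<^sup>/\<^sup>2 y\<close> with \<open>|y| \<le> |x|\<close>, hence
  \<open>\<parallel>x\<parallel> \<le> N \<parallel>x\<parallel>\<close>. Here \<open>x\<close> is not zero: otherwise \<open>V f = 0\<close>, and \<open>f = (H\<^sub>0 - z)\<^sup>-\<^sup>1 0 = 0\<close>.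
\<close>
lemma birman_schwinger_principle:
  fixes V f :: "int ^ 'd::finite \<Rightarrow> complex"
  assumes z: "z \<notin> spectral_interval TYPE('d)" and f: "f \<in> ell 2" "f \<noteq> (\<lambda>n. 0)"
    and eig: "schroedinger V f = (\<lambda>n. z * f n)"
    and bV: "\<And>n. norm (V n) \<le> S" and N: "N \<ge> 0"
    and form: "\<And>A B a b. finite A \<Longrightarrow> finite B \<Longrightarrow>
      norm (weighted_form (resolvent_kernel z) (\<lambda>n. sqrt (norm (V n))) A B a b)
      \<le> N * (l2_norm a A * l2_norm b B)"
  shows "1 \<le> N"
proof -
  let ?K = "resolvent_kernel z :: int ^ 'd \<Rightarrow> complex"
  define v where "v = (\<lambda>n. sqrt (norm (V n)))"
  define x where "x = (\<lambda>n. of_real (v n) * f n)"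
  define y where "y = (\<lambda>n. - sgn (V n) * x n)"
  have nV: "complex_of_real (v n) * complex_of_real (v n) * sgn (V n) = V n" for n
  proof -
    have "complex_of_real (v n) * complex_of_real (v n) = of_real (norm (V n))"
      by (simp add: v_def flip: of_real_mult)
    thus ?thesis by (cases "V n = 0") (simp_all add: sgn_div_norm scaleR_conv_of_real)
  qed
  have eq: "discrete_laplacian f n - z * f n = of_real (v n) * y n" for n
  proof -
    have "discrete_laplacian f n + V n * f n = z * f n" using fun_cong[OF eig, of n] by (simp add: schroedinger_def)
    hence "discrete_laplacian f n - z * f n = - (V n * f n)" by (simp add: algebra_simps)
    also have "V n * f n = complex_of_real (v n) * complex_of_real (v n) * sgn (V n) * f n"
      by (simp only: nV)
    also have "- \<dots> = of_real (v n) * y n" by (simp add: x_def y_def mult_ac)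
    finally show ?thesis .
  qed
  have green: "((\<lambda>n. ?K (m - n) * (of_real (v n) * y n)) has_sum f m) UNIV" for m
    using resolvent_kernel_inverts[OF z f(1), of m] unfolding eq .
  have xs: "(\<lambda>n. (norm (x n))\<^sup>2) summable_on UNIV"
  proof (rule summable_on_comparison_test)
    show "(\<lambda>n. S * (norm (f n))\<^sup>2) summable_on UNIV"
      using f(1) by (intro summable_on_cmult_right) (simp add: ell_2_iff)
    show "(norm (x n))\<^sup>2 \<le> S * (norm (f n))\<^sup>2" for n
      using bV[of n] by (simp add: x_def v_def norm_mult power_mult_distrib mult_right_mono)
  qed auto
  define Q where "Q = infsum (\<lambda>n. (norm (x n))\<^sup>2) UNIV"
  have xQ: "l2_norm x A \<le> sqrt Q" if "finite A" for A
    unfolding L2_set_def Q_def using xs that by (intro real_sqrt_le_mono finite_sum_le_infsum) auto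
  have yx: "norm (y n) \<le> norm (x n)" for n by (simp add: y_def norm_mult norm_sgn)
  have Q0: "Q \<ge> 0" unfolding Q_def by (rule infsum_nonneg) simp
  have main: "l2_norm x A \<le> N * sqrt Q" if A: "finite A" for A
  proof -
    define L where "L = l2_norm x A"
    have L0: "L \<ge> 0" by (simp add: L_def)
    have "((\<lambda>n. \<Sum>m\<in>A. (cnj (x m) * of_real (v m)) * (?K (m - n) * (of_real (v n) * y n))) has_sum (\<Sum>m\<in>A. (cnj (x m) * of_real (v m)) * f m)) UNIV"
      by (intro has_sum_sum_finite has_sum_cmult_right green)
    moreover have "(\<Sum>m\<in>A. (cnj (x m) * of_real (v m)) * f m) = of_real (L\<^sup>2)"
    proof -
      have "(cnj (x m) * of_real (v m)) * f m = of_real ((norm (x m))\<^sup>2)" for m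
        unfolding complex_norm_square by (simp add: x_def mult_ac)
      moreover have "L\<^sup>2 = (\<Sum>m\<in>A. (norm (x m))\<^sup>2)" by (simp add: L_def L2_set_def sum_nonneg)
      ultimately show ?thesis by simp
    qed
    ultimately have lim: "((\<lambda>B. \<Sum>n\<in>B. \<Sum>m\<in>A. (cnj (x m) * of_real (v m)) * (?K (m - n) * (of_real (v n) * y n))) \<longlongrightarrow> complex_of_real (L\<^sup>2)) (finite_subsets_at_top UNIV)"
      by (simp add: has_sum_def)
    have "norm (complex_of_real (L\<^sup>2)) \<le> N * (L * sqrt Q)"
    proof (rule Lim_norm_ubound[OF _ lim])
      show "\<forall>\<^sub>F B in finite_subsets_at_top UNIV. norm (\<Sum>n\<in>B. \<Sum>m\<in>A. (cnj (x m) * of_real (v m)) * (?K (m - n) * (of_real (v n) * y n))) \<le> N * (L * sqrt Q)"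
      proof (rule eventually_finite_subsets_at_top_weakI)
        fix B :: "(int ^ 'd) set" assume B: "finite B"
        have "(\<Sum>n\<in>B. \<Sum>m\<in>A. (cnj (x m) * of_real (v m)) * (?K (m - n) * (of_real (v n) * y n)))
          = (\<Sum>m\<in>A. \<Sum>n\<in>B. cnj (x m) * of_real (sqrt (norm (V m))) * ?K (m - n) * of_real (sqrt (norm (V n))) * y n)"
          by (subst sum.swap) (simp add: v_def mult_ac)
        also have "norm \<dots> \<le> N * (L2_set (\<lambda>m. norm (cnj (x m))) A * l2_norm y B)"
          by (rule form[OF A B])
        also have "\<dots> \<le> N * (L * sqrt Q)"
        proof (intro mult_left_mono mult_mono N)
          have "l2_norm y B \<le> l2_norm x B" by (intro L2_set_mono yx) auto
          also have "\<dots> \<le> sqrt Q" by (rule xQ[OF B])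
          finally show "l2_norm y B \<le> sqrt Q" .
        qed (auto simp: L_def)
        finally show "norm (\<Sum>n\<in>B. \<Sum>m\<in>A. (cnj (x m) * of_real (v m)) * (?K (m - n) * (of_real (v n) * y n))) \<le> N * (L * sqrt Q)" .
      qed
    qed simp
    hence "L\<^sup>2 \<le> N * (L * sqrt Q)" by (simp only: norm_of_real abs_power2)
    hence "L * L \<le> (N * sqrt Q) * L" by (simp add: power2_eq_square mult_ac)
    hence "L \<le> N * sqrt Q"
      using L0 N Q0 mult_right_le_imp_le[of L L "N * sqrt Q"] by (cases "L = 0") auto
    thus ?thesis by (simp add: L_def)
  qed
  have "Q \<noteq> 0"
  proof
    assume "Q = 0"
    hence "L2_set (\<lambda>n. norm (x n)) {n} \<le> 0" for n using xQ[of "{n}"] by simp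
    hence x0: "x n = 0" for n by (simp add: L2_set_def)
    have "f m = 0" for m
    proof -
      have "((\<lambda>n :: int ^ 'd. 0) has_sum f m) UNIV" using green[of m] by (simp add: y_def x0)
      thus ?thesis using has_sum_unique[OF _ has_sum_0[of UNIV "\<lambda>n :: int ^ 'd. 0 :: complex"]] by blast
    qed
    thus False using f(2) by auto
  qed
  hence Qp: "Q > 0" using Q0 by simp
  have "Q \<le> (N * sqrt Q)\<^sup>2"
    unfolding Q_def
  proof (rule infsum_le_finite_sums[OF xs], fold Q_def)
    fix A :: "(int ^ 'd) set" assume "finite A"
    hence "(l2_norm x A)\<^sup>2 \<le> (N * sqrt Q)\<^sup>2" by (intro power_mono main) auto
    thus "(\<Sum>n\<in>A. (norm (x n))\<^sup>2) \<le> (N * sqrt Q)\<^sup>2" by (simp add: L2_set_def sum_nonneg)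
  qed
  hence "1 * Q \<le> N\<^sup>2 * Q" using Q0 by (simp add: power_mult_distrib)
  hence "1 \<le> N\<^sup>2" using Qp mult_le_cancel_right_pos by blast
  thus "1 \<le> N" using N by (metis abs_le_square_iff abs_of_nonneg abs_one power_one)
qed

theorem proposition2p3:
  fixes s0 :: real
  assumes "CARD('d::finite) \<ge> 5"
    and "s0 = (real CARD('d) + 2) / 3"
  shows "(\<forall>s > s0. \<exists>C :: real. \<forall>V :: int ^ 'd \<Rightarrow> complex. V \<in> ell s \<longrightarrow>
            (\<forall>z. z \<notin> spectral_interval TYPE('d) \<longrightarrow> eigenvalue_on_ell2 (schroedinger V) z \<longrightarrow>
               infdist z (spectral_interval TYPE('d)) powr (s - s0) \<le> C * ell_norm s V powr s))
       \<and> (\<exists>c > 0. \<forall>V :: int ^ 'd \<Rightarrow> complex. V \<in> ell s0 \<longrightarrow> ell_norm s0 V < c \<longrightarrow>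
            \<not> (\<exists>z. z \<notin> spectral_interval TYPE('d) \<and> eigenvalue_on_ell2 (schroedinger V) z))"
proof -
  have s01: "s0 > 0" using assms by simp
  have key: "\<exists>C>0. \<forall>(V :: int ^ 'd \<Rightarrow> complex) z. V \<in> ell s \<longrightarrow> z \<notin> spectral_interval TYPE('d) \<longrightarrow> eigenvalue_on_ell2 (schroedinger V) z \<longrightarrow>
      1 \<le> C * ell_norm s V * infdist z (spectral_interval TYPE('d)) powr (- (1 - s0 / s))" if s: "s \<ge> s0" for s
  proof -
    have sp: "s > 0" using s s01 by simp
    obtain C where C: "C > 0" and form: "\<And>(V :: int ^ 'd \<Rightarrow> complex) z A B a b. V \<in> ell s \<Longrightarrow> z \<notin> spectral_interval TYPE('d) \<Longrightarrow> finite A \<Longrightarrow> finite B \<Longrightarrow>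
       norm (weighted_form (resolvent_kernel z) (\<lambda>n. sqrt (norm (V n))) A B a b)
      \<le> C * ell_norm s V * infdist z (spectral_interval TYPE('d)) powr (- (1 - s0 / s))
          * (l2_norm a A * l2_norm b B)"
      using birman_schwinger_form_bound[OF assms s] by blast
    have "1 \<le> C * ell_norm s V * infdist z (spectral_interval TYPE('d)) powr (- (1 - s0 / s))"
      if V: "V \<in> ell s" and z: "z \<notin> spectral_interval TYPE('d)" and ev: "eigenvalue_on_ell2 (schroedinger V) z" for V :: "int ^ 'd \<Rightarrow> complex" and z
    proof -
      obtain f where f: "f \<in> ell 2" "f \<noteq> (\<lambda>n. 0)" "schroedinger V f = (\<lambda>n. z * f n)"
        using ev by (auto simp: eigenvalue_on_ell2_def)
      show ?thesis
        by (rule birman_schwinger_principle[OF z f ell_norm_powr(3)[OF sp V] _ form[OF V z]])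
           (use C ell_norm_powr(1)[OF sp V] in auto)
    qed
    thus ?thesis using C by blast
  qed
  show ?thesis
  proof (intro conjI allI impI)
    fix s assume s: "s > s0"
    hence sp: "s > 0" using s01 by simp
    from key[of s] s obtain C where C: "C > 0" and k: "\<And>(V :: int ^ 'd \<Rightarrow> complex) z. V \<in> ell s \<Longrightarrow> z \<notin> spectral_interval TYPE('d) \<Longrightarrow> eigenvalue_on_ell2 (schroedinger V) z \<Longrightarrow>
      1 \<le> C * ell_norm s V * infdist z (spectral_interval TYPE('d)) powr (- (1 - s0 / s))" by auto
    show "\<exists>C :: real. \<forall>V :: int ^ 'd \<Rightarrow> complex. V \<in> ell s \<longrightarrow>
            (\<forall>z. z \<notin> spectral_interval TYPE('d) \<longrightarrow> eigenvalue_on_ell2 (schroedinger V) z \<longrightarrow>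
               infdist z (spectral_interval TYPE('d)) powr (s - s0) \<le> C * ell_norm s V powr s)"
    proof (intro exI[of _ "C powr s"] allI impI)
      fix V :: "int ^ 'd \<Rightarrow> complex" and z
      assume V: "V \<in> ell s" and z: "z \<notin> spectral_interval TYPE('d)" and ev: "eigenvalue_on_ell2 (schroedinger V) z"
      define \<delta> where "\<delta> = infdist z (spectral_interval TYPE('d))"
      have \<delta>: "\<delta> > 0" unfolding \<delta>_def by (rule resolvent_symbol_props(1)[OF z])
      have N0: "ell_norm s V \<ge> 0" by (rule ell_norm_powr(1)[OF sp V])
      have "1 \<le> C * ell_norm s V * \<delta> powr (- (1 - s0 / s))" using k[OF V z ev] by (simp add: \<delta>_def)
      hence "\<delta> powr (1 - s0 / s) * 1 \<le> \<delta> powr (1 - s0 / s) * (C * ell_norm s V * \<delta> powr (- (1 - s0 / s)))"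
        by (intro mult_left_mono) auto
      also have "\<dots> = (\<delta> powr (1 - s0 / s) * \<delta> powr (- (1 - s0 / s))) * (C * ell_norm s V)"
        by (simp only: mult_ac)
      also have "\<delta> powr (1 - s0 / s) * \<delta> powr (- (1 - s0 / s)) = 1"
        using \<delta> by (simp flip: powr_add)
      finally have "\<delta> powr (1 - s0 / s) \<le> C * ell_norm s V" by simp
      hence "(\<delta> powr (1 - s0 / s)) powr s \<le> (C * ell_norm s V) powr s"
        using sp by (intro powr_mono2) auto
      also have "(\<delta> powr (1 - s0 / s)) powr s = \<delta> powr (s - s0)"
        using sp by (simp add: powr_powr left_diff_distrib)
      finally show "\<delta> powr (s - s0) \<le> C powr s * ell_norm s V powr s"
        using C N0 by (simp add: powr_mult)
    qed
  next
    from key[of s0] obtain C where C: "C > 0" and k: "\<And>(V :: int ^ 'd \<Rightarrow> complex) z. V \<in> ell s0 \<Longrightarrow> z \<notin> spectral_interval TYPE('d) \<Longrightarrow> eigenvalue_on_ell2 (schroedinger V) z \<Longrightarrow>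
      1 \<le> C * ell_norm s0 V * infdist z (spectral_interval TYPE('d)) powr (- (1 - s0 / s0))" by auto
    show "\<exists>c > 0. \<forall>V :: int ^ 'd \<Rightarrow> complex. V \<in> ell s0 \<longrightarrow> ell_norm s0 V < c \<longrightarrow>
            \<not> (\<exists>z. z \<notin> spectral_interval TYPE('d) \<and> eigenvalue_on_ell2 (schroedinger V) z)"
    proof (intro exI[of _ "1 / C"] conjI allI impI notI)
      show "1 / C > 0" using C by simp
      fix V :: "int ^ 'd \<Rightarrow> complex"
      assume V: "V \<in> ell s0" and small: "ell_norm s0 V < 1 / C"
        and "\<exists>z. z \<notin> spectral_interval TYPE('d) \<and> eigenvalue_on_ell2 (schroedinger V) z"
      then obtain z where z: "z \<notin> spectral_interval TYPE('d)" and ev: "eigenvalue_on_ell2 (schroedinger V) z" by blast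
      have "1 \<le> C * ell_norm s0 V"
        using k[OF V z ev] resolvent_symbol_props(1)[OF z] s01 by simp
      thus False using small C by (simp add: field_simps)
    qed
  qed
qed

end
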